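(* Let $(M,\langle\cdot,\cdot\rangle)$ be a Riemannian manifold with Levi--Civita connection $\nabla$ and let $k\ge1$. For $u\in T^{(k)}M$ and $X\in T_uT^{(k)}M$ choose a $k$-adapted family of curves $\gamma_s(t)=\gamma(s,t)$ on $M$ for $X$, and for $\alpha=1,\ldots,k$ set $$K^{(k)}_\alpha(X)=\frac1{\alpha!}\nabla^\alpha_{\frac{\partial\gamma}{\partial t}}\frac{\partial\gamma}{\partial s}\Big|_{(s,t)=(0,0)}.$$ Then $K^{(k)}=(K^{(k)}_1,\ldots,K^{(k)}_k)$ is a connection map on $T^{(k)}M$. Moreover, the family of maps $\{K^{(\alpha)}\}_{\alpha=1}^k$ obtained by applying the same construction at each order $\alpha$ (on $T^{(\alpha)}M$) is a connection tower.
   Context: $T^{(k)}M$ is the manifold of $k$-jets $u=j^k_0(q)$ at $0$ of smooth curves $q$ in $M$, with $T^{(1)}M=TM$. Projections: $\tau_k(j^k_0q)=q(0)\in M$ and $\tau^{(k)}_\alpha(j^k_0q)=j^\alpha_0q\in T^{(\alpha)}M$. Local coordinates $(q^i)$ on $M$ induce coordinates $q^{(\alpha)i}(j^k_0q)=\frac1{\alpha!}\frac{d^\alpha q^i}{dt^\alpha}(0)$, $0\le\alpha\le k$. The almost-tangent structure $J$ on $T^{(k)}M$ is the $(1,1)$-tensor field with $J(\partial/\partial q^{(\alpha)i})=\partial/\partial q^{(\alpha+1)i}$ for $\alpha<k$ and $J(\partial/\partial q^{(k)i})=0$. A family $\gamma_s(t)=\gamma(s,t)$ of curves on $M$ is $k$-adapted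 to $X\in T_uT^{(k)}M$ if the curve $s\mapsto j^k_0(\gamma_s)$ in $T^{(k)}M$ passes through $u$ at $s=0$ with velocity $X$. $\nabla^\alpha_{\partial\gamma/\partial t}$ denotes $\alpha$-fold covariant differentiation along the $t$-curves. $(TM)_\oplus^k$ is the Whitney sum of $k$ copies of $TM$. A connection map on $T^{(k)}M$ is a (well-defined, smooth) bundle morphism $K=(K_1,\ldots,K_k):TT^{(k)}M\to(TM)_\oplus^k$ over $\tau_k$ such that (1) each $K_\alpha:T_uT^{(k)}M\to T_{\tau_k(u)}M$ is linear; (2) $K_{\alpha+1}\circ J=K_\alpha$ for $\alpha=1,\ldots,k-1$; (3) $K_1\circ J=\tau_{k*}$. A connection map $K^{(k)}$ is a connection tower of order $k$ if for each $\alpha=1,\ldots,k$ there is a unique map $K^{(\alpha)}_\alpha:TT^{(\alpha)}M\to TM$ with $K^{(k)}_\alpha=K^{(\alpha)}_\alpha\circ\tau^{(k)}_{\alpha*}$; the induced maps at lower orders are $K^{(\alpha)}=(K^{(\alpha)}_1,\ldots,K^{(\alpha)}_\alpha)$, $K^{(\alpha)}_\mu=K^{(\mu)}_\mu\circ\tau^{(\alpha)}_{\mu*}$. *)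

theory Defs
  imports "HOL-Analysis.Analysis"
begin

section \<open>Smooth functions on open subsets of coordinate spaces\<close>

text \<open>The coordinate space attached to a finite index set \<open>I\<close> is \<open>powertop_real I\<close>, that is,
  the space of extensional functions from \<open>I\<close> to the reals. Using index sets rather than index types
  lets the order of a jet be an ordinary natural number.\<close>

definition partial :: "'i \<Rightarrow> (('i \<Rightarrow> real) \<Rightarrow> real) \<Rightarrow> ('i \<Rightarrow> real) \<Rightarrow> real" where
  "partial i f x = deriv (\<lambda>t. f (x(i := t))) (x i)"

text \<open>\<open>Cr_on r I S f\<close>: \<open>f\<close> is of class \<open>C\<^sup>r\<close> on the open set \<open>S\<close>.\<close>

primrec Cr_on :: "nat \<Rightarrow> 'i set \<Rightarrow> ('i \<Rightarrow> real) set \<Rightarrow> (('i \<Rightarrow> real) \<Rightarrow> real) \<Rightarrow> bool" where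
  "Cr_on 0 I S f \<longleftrightarrow> continuous_map (subtopology (powertop_real I) S) euclideanreal f"
| "Cr_on (Suc r) I S f \<longleftrightarrow>
     continuous_map (subtopology (powertop_real I) S) euclideanreal f \<and>
     (\<forall>i\<in>I. (\<forall>x\<in>S. (\<lambda>t. f (x(i := t))) differentiable at (x i)) \<and> Cr_on r I S (partial i f))"

definition smooth_on_coords :: "'i set \<Rightarrow> ('i \<Rightarrow> real) set \<Rightarrow> (('i \<Rightarrow> real) \<Rightarrow> real) \<Rightarrow> bool" where
  "smooth_on_coords I S f \<longleftrightarrow> (\<forall>r. Cr_on r I S f)"


section \<open>Smooth manifolds and smooth maps\<close>

text \<open>A manifold is a set of points with an atlas. A chart is a pair of its domain and its coordinate
  map; the values of the coordinate map outside the domain are irrelevant. The topology is the one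
  induced by the atlas.\<close>

record ('p, 'i) mfd =
  points :: "'p set"
  index :: "'i set"
  charts :: "('p set \<times> ('p \<Rightarrow> 'i \<Rightarrow> real)) set"

definition mfd_topology :: "('p, 'i) mfd \<Rightarrow> 'p topology" where
  "mfd_topology M = topology (\<lambda>W. W \<subseteq> points M \<and>
     (\<forall>(U, \<phi>)\<in>charts M. openin (powertop_real (index M)) (\<phi> ` (W \<inter> U))))"

lemma openin_mfd_topology:
  assumes inj: "\<And>U \<phi>. (U, \<phi>) \<in> charts M \<Longrightarrow> inj_on \<phi> U"
  shows "openin (mfd_topology M) W \<longleftrightarrow> W \<subseteq> points M \<and>
     (\<forall>(U, \<phi>)\<in>charts M. openin (powertop_real (index M)) (\<phi> ` (W \<inter> U)))"
proof -
  let ?P = "\<lambda>W. W \<subseteq> points M \<and>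
     (\<forall>(U, \<phi>)\<in>charts M. openin (powertop_real (index M)) (\<phi> ` (W \<inter> U)))"
  have "istopology ?P"
    unfolding istopology_def
  proof (intro conjI allI impI)
    fix S T assume S: "?P S" and T: "?P T"
    then show "S \<inter> T \<subseteq> points M" by blast
    show "\<forall>(U, \<phi>)\<in>charts M. openin (powertop_real (index M)) (\<phi> ` (S \<inter> T \<inter> U))"
    proof clarify
      fix U \<phi> assume c: "(U, \<phi>) \<in> charts M"
      have "\<phi> ` (S \<inter> T \<inter> U) = \<phi> ` (S \<inter> U) \<inter> \<phi> ` (T \<inter> U)"
        using inj[OF c] by (auto simp: inj_on_def)
      then show "openin (powertop_real (index M)) (\<phi> ` (S \<inter> T \<inter> U))"
        using S T c by auto
    qed
  next
    fix \<K> assume K: "\<forall>W\<in>\<K>. ?P W"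
    then show "\<Union>\<K> \<subseteq> points M" by blast
    show "\<forall>(U, \<phi>)\<in>charts M. openin (powertop_real (index M)) (\<phi> ` (\<Union>\<K> \<inter> U))"
    proof clarify
      fix U \<phi> assume c: "(U, \<phi>) \<in> charts M"
      have "\<phi> ` (\<Union>\<K> \<inter> U) = (\<Union>W\<in>\<K>. \<phi> ` (W \<inter> U))" by blast
      then show "openin (powertop_real (index M)) (\<phi> ` (\<Union>\<K> \<inter> U))"
        using K c by (auto intro!: openin_Union)
    qed
  qed
  then show ?thesis
    unfolding mfd_topology_def by (simp add: topology_inverse')
qed

definition smooth_manifold :: "('p, 'i) mfd \<Rightarrow> bool" where
  "smooth_manifold M \<longleftrightarrow>
     finite (index M) \<and>
     (\<Union>(U, \<phi>)\<in>charts M. U) = points M \<and>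
     (\<forall>(U, \<phi>)\<in>charts M. inj_on \<phi> U \<and> openin (powertop_real (index M)) (\<phi> ` U)) \<and>
     (\<forall>(U, \<phi>)\<in>charts M. \<forall>(V, \<psi>)\<in>charts M.
        openin (powertop_real (index M)) (\<phi> ` (U \<inter> V)) \<and>
        (\<forall>j\<in>index M. smooth_on_coords (index M) (\<phi> ` (U \<inter> V)) (\<lambda>x. \<psi> (inv_into U \<phi> x) j))) \<and>
     Hausdorff_space (mfd_topology M) \<and>
     second_countable (mfd_topology M)"

definition smooth_map_on :: "('p, 'i) mfd \<Rightarrow> ('q, 'j) mfd \<Rightarrow> 'p set \<Rightarrow> ('p \<Rightarrow> 'q) \<Rightarrow> bool" where
  "smooth_map_on M N A f \<longleftrightarrow> (\<forall>p\<in>A. f p \<in> points N \<and>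
     (\<exists>(U, \<phi>)\<in>charts M. \<exists>(V, \<psi>)\<in>charts N. \<exists>W.
        openin (mfd_topology M) W \<and> p \<in> W \<and> W \<subseteq> A \<inter> U \<and> f ` W \<subseteq> V \<and>
        (\<forall>j\<in>index N. smooth_on_coords (index M) (\<phi> ` W) (\<lambda>x. \<psi> (f (inv_into U \<phi> x)) j))))"

definition coord_space :: "'i set \<Rightarrow> ('i \<Rightarrow> real, 'i) mfd" where
  "coord_space I = \<lparr>points = topspace (powertop_real I), index = I,
     charts = {(topspace (powertop_real I), \<lambda>x. x)}\<rparr>"

definition smooth_fun_on :: "('p, 'i) mfd \<Rightarrow> 'p set \<Rightarrow> ('p \<Rightarrow> real) \<Rightarrow> bool" where
  "smooth_fun_on M A f \<longleftrightarrow> smooth_map_on M (coord_space (UNIV :: unit set)) A (\<lambda>p _. f p)"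

text \<open>Curves and families of curves are total functions of which only the germ at the origin matters.
  The real line and the plane are the coordinate spaces over \<open>unit\<close> and \<open>bool\<close>; in the plane the
  coordinate \<open>False\<close> is \<open>s\<close> and the coordinate \<open>True\<close> is \<open>t\<close>.\<close>

definition smooth_curve :: "('p, 'i) mfd \<Rightarrow> (real \<Rightarrow> 'p) \<Rightarrow> bool" where
  "smooth_curve M c \<longleftrightarrow> (\<exists>\<epsilon>>0.
     smooth_map_on (coord_space (UNIV :: unit set)) M {x. \<bar>x ()\<bar> < \<epsilon>} (\<lambda>x. c (x ())))"

definition smooth_family :: "('p, 'i) mfd \<Rightarrow> (real \<Rightarrow> real \<Rightarrow> 'p) \<Rightarrow> bool" where
  "smooth_family M \<gamma> \<longleftrightarrow> (\<exists>\<epsilon>>0.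
     smooth_map_on (coord_space (UNIV :: bool set)) M {x. \<bar>x False\<bar> < \<epsilon> \<and> \<bar>x True\<bar> < \<epsilon>}
       (\<lambda>x. \<gamma> (x False) (x True)))"


section \<open>Jets of curves\<close>

text \<open>The \<open>k\<close>-jet at 0 of \<open>q\<close>, as the class of all smooth curves having contact of order \<open>k\<close> with \<open>q\<close>.\<close>

definition jet :: "('p, 'i) mfd \<Rightarrow> nat \<Rightarrow> (real \<Rightarrow> 'p) \<Rightarrow> (real \<Rightarrow> 'p) set" where
  "jet M k q = {c. smooth_curve M c \<and> c 0 = q 0 \<and>
     (\<forall>(U, \<phi>)\<in>charts M. q 0 \<in> U \<longrightarrow> (\<forall>i\<in>index M. \<forall>\<alpha>\<le>k.
        (deriv ^^ \<alpha>) (\<lambda>t. \<phi> (c t) i) 0 = (deriv ^^ \<alpha>) (\<lambda>t. \<phi> (q t) i) 0))}"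

definition rep :: "(real \<Rightarrow> 'p) set \<Rightarrow> real \<Rightarrow> 'p" where
  "rep u = (SOME c. c \<in> u)"

text \<open>The projection of a jet to its base point, and the projection to a lower order \<open>\<alpha>\<close>.\<close>

definition foot :: "(real \<Rightarrow> 'p) set \<Rightarrow> 'p" where
  "foot u = rep u 0"

definition jet_proj :: "('p, 'i) mfd \<Rightarrow> nat \<Rightarrow> (real \<Rightarrow> 'p) set \<Rightarrow> (real \<Rightarrow> 'p) set" where
  "jet_proj M \<alpha> u = jet M \<alpha> (rep u)"

definition jet_coord :: "('p, 'i) mfd \<Rightarrow> nat \<Rightarrow> ('p \<Rightarrow> 'i \<Rightarrow> real) \<Rightarrow> (real \<Rightarrow> 'p) set \<Rightarrow> nat \<times> 'i \<Rightarrow> real" where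
  "jet_coord M k \<phi> u = restrict
     (\<lambda>(\<alpha>, i). (deriv ^^ \<alpha>) (\<lambda>t. \<phi> (rep u t) i) 0 / fact \<alpha>) ({..k} \<times> index M)"

definition jet_mfd :: "('p, 'i) mfd \<Rightarrow> nat \<Rightarrow> ((real \<Rightarrow> 'p) set, nat \<times> 'i) mfd" where
  "jet_mfd M k =
     \<lparr>points = jet M k ` {q. smooth_curve M q},
      index = {..k} \<times> index M,
      charts = (\<lambda>(U, \<phi>). ({u \<in> jet M k ` {q. smooth_curve M q}. foot u \<in> U}, jet_coord M k \<phi>)) ` charts M\<rparr>"


section \<open>Tangent vectors\<close>

text \<open>Tangent vectors are 1-jets of curves. This applies to every manifold, in particular to
  \<open>jet_mfd M k\<close> itself.\<close>

abbreviation TB :: "('p, 'i) mfd \<Rightarrow> ((real \<Rightarrow> 'p) set, nat \<times> 'i) mfd" where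
  "TB M \<equiv> jet_mfd M 1"

definition tangent_space :: "('p, 'i) mfd \<Rightarrow> 'p \<Rightarrow> (real \<Rightarrow> 'p) set set" where
  "tangent_space M p = {v \<in> points (TB M). foot v = p}"

definition velocity :: "('p, 'i) mfd \<Rightarrow> (real \<Rightarrow> 'p) \<Rightarrow> real \<Rightarrow> (real \<Rightarrow> 'p) set" where
  "velocity M c t = jet M 1 (\<lambda>r. c (t + r))"

text \<open>The \<open>i\<close>-th component of \<open>v\<close> with respect to the coordinate vectors of the chart \<open>\<phi>\<close>.\<close>

definition tcomp :: "('p \<Rightarrow> 'i \<Rightarrow> real) \<Rightarrow> (real \<Rightarrow> 'p) set \<Rightarrow> 'i \<Rightarrow> real" where
  "tcomp \<phi> v i = deriv (\<lambda>t. \<phi> (rep v t) i) 0"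

definition tzero :: "('p, 'i) mfd \<Rightarrow> 'p \<Rightarrow> (real \<Rightarrow> 'p) set" where
  "tzero M p = jet M 1 (\<lambda>_. p)"

definition tadd :: "('p, 'i) mfd \<Rightarrow> (real \<Rightarrow> 'p) set \<Rightarrow> (real \<Rightarrow> 'p) set \<Rightarrow> (real \<Rightarrow> 'p) set" where
  "tadd M v w = (THE z. z \<in> tangent_space M (foot v) \<and>
     (\<forall>(U, \<phi>)\<in>charts M. foot v \<in> U \<longrightarrow> (\<forall>i\<in>index M. tcomp \<phi> z i = tcomp \<phi> v i + tcomp \<phi> w i)))"

definition tscale :: "('p, 'i) mfd \<Rightarrow> real \<Rightarrow> (real \<Rightarrow> 'p) set \<Rightarrow> (real \<Rightarrow> 'p) set" where
  "tscale M a v = (THE z. z \<in> tangent_space M (foot v) \<and>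
     (\<forall>(U, \<phi>)\<in>charts M. foot v \<in> U \<longrightarrow> (\<forall>i\<in>index M. tcomp \<phi> z i = a * tcomp \<phi> v i)))"

definition tlinear :: "('p, 'i) mfd \<Rightarrow> 'p \<Rightarrow> ('q, 'j) mfd \<Rightarrow> 'q \<Rightarrow> ((real \<Rightarrow> 'p) set \<Rightarrow> (real \<Rightarrow> 'q) set) \<Rightarrow> bool" where
  "tlinear M p N q L \<longleftrightarrow>
     (\<forall>v\<in>tangent_space M p. L v \<in> tangent_space N q) \<and>
     (\<forall>v\<in>tangent_space M p. \<forall>w\<in>tangent_space M p. L (tadd M v w) = tadd N (L v) (L w)) \<and>
     (\<forall>a. \<forall>v\<in>tangent_space M p. L (tscale M a v) = tscale N a (L v))"

text \<open>The differential of a map into \<open>N\<close>, and the derivative of a function in the direction \<open>v\<close>.\<close>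

definition pushforward :: "('q, 'j) mfd \<Rightarrow> ('p \<Rightarrow> 'q) \<Rightarrow> (real \<Rightarrow> 'p) set \<Rightarrow> (real \<Rightarrow> 'q) set" where
  "pushforward N f v = jet N 1 (\<lambda>t. f (rep v t))"

definition dir_deriv :: "(real \<Rightarrow> 'p) set \<Rightarrow> ('p \<Rightarrow> real) \<Rightarrow> real" where
  "dir_deriv v f = deriv (\<lambda>t. f (rep v t)) 0"

definition vector_field_on :: "('p, 'i) mfd \<Rightarrow> 'p set \<Rightarrow> ('p \<Rightarrow> (real \<Rightarrow> 'p) set) \<Rightarrow> bool" where
  "vector_field_on M W X \<longleftrightarrow>
     smooth_map_on M (TB M) W X \<and> (\<forall>p\<in>W. X p \<in> tangent_space M p)"

definition coord_field :: "('p, 'i) mfd \<Rightarrow> 'p set \<Rightarrow> ('p \<Rightarrow> 'i \<Rightarrow> real) \<Rightarrow> 'i \<Rightarrow> 'p \<Rightarrow> (real \<Rightarrow> 'p) set" where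
  "coord_field M U \<phi> i p = jet M 1 (\<lambda>t. inv_into U \<phi> ((\<phi> p)(i := \<phi> p i + t)))"


section \<open>Riemannian metrics and the Levi-Civita connection\<close>

text \<open>\<open>g\<close> is only evaluated on pairs of tangent vectors with the same foot point.\<close>

definition riemannian_manifold :: "('p, 'i) mfd \<Rightarrow> ((real \<Rightarrow> 'p) set \<Rightarrow> (real \<Rightarrow> 'p) set \<Rightarrow> real) \<Rightarrow> bool" where
  "riemannian_manifold M g \<longleftrightarrow> smooth_manifold M \<and>
     (\<forall>p\<in>points M. \<forall>u\<in>tangent_space M p. \<forall>v\<in>tangent_space M p. \<forall>w\<in>tangent_space M p. \<forall>a.
        g v w = g w v \<and>
        g (tadd M u v) w = g u w + g v w \<and>
        g (tscale M a v) w = a * g v w \<and>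
        (v \<noteq> tzero M p \<longrightarrow> g v v > 0)) \<and>
     (\<forall>W X Y. openin (mfd_topology M) W \<and> vector_field_on M W X \<and> vector_field_on M W Y \<longrightarrow>
        smooth_fun_on M W (\<lambda>p. g (X p) (Y p)))"

text \<open>An affine connection, as an operator on vector fields over open sets: \<open>nab v Y\<close> is
  \<open>\<nabla>\<^sub>v Y\<close> for a tangent vector \<open>v\<close> at \<open>p\<close> and a vector field \<open>Y\<close> on an open neighbourhood of \<open>p\<close>.
  The last clause but one makes it depend on the germ of \<open>Y\<close> only. A connection on global
  vector fields extends uniquely to such an operator.\<close>

definition affine_connection ::
  "('p, 'i) mfd \<Rightarrow> ((real \<Rightarrow> 'p) set \<Rightarrow> ('p \<Rightarrow> (real \<Rightarrow> 'p) set) \<Rightarrow> (real \<Rightarrow> 'p) set) \<Rightarrow> bool" where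
  "affine_connection M nab \<longleftrightarrow>
     (\<forall>W. openin (mfd_topology M) W \<longrightarrow>
       (\<forall>Y p. vector_field_on M W Y \<and> p \<in> W \<longrightarrow> tlinear M p M p (\<lambda>v. nab v Y)) \<and>
       (\<forall>Y Z p. vector_field_on M W Y \<and> vector_field_on M W Z \<and> p \<in> W \<longrightarrow>
          (\<forall>v\<in>tangent_space M p. nab v (\<lambda>q. tadd M (Y q) (Z q)) = tadd M (nab v Y) (nab v Z))) \<and>
       (\<forall>f Y p. smooth_fun_on M W f \<and> vector_field_on M W Y \<and> p \<in> W \<longrightarrow>
          (\<forall>v\<in>tangent_space M p. nab v (\<lambda>q. tscale M (f q) (Y q)) =
             tadd M (tscale M (dir_deriv v f) (Y p)) (tscale M (f p) (nab v Y)))) \<and>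
       (\<forall>Y Z p. vector_field_on M W Y \<and> vector_field_on M W Z \<and> (\<forall>q\<in>W. Y q = Z q) \<and> p \<in> W \<longrightarrow>
          (\<forall>v\<in>tangent_space M p. nab v Y = nab v Z)) \<and>
       (\<forall>X Y. vector_field_on M W X \<and> vector_field_on M W Y \<longrightarrow>
          vector_field_on M W (\<lambda>p. nab (X p) Y)))"

text \<open>\<open>\<nabla>\<^sub>X Y - \<nabla>\<^sub>Y X = [X, Y]\<close>, both sides being applied to smooth functions.\<close>

definition torsion_free ::
  "('p, 'i) mfd \<Rightarrow> ((real \<Rightarrow> 'p) set \<Rightarrow> ('p \<Rightarrow> (real \<Rightarrow> 'p) set) \<Rightarrow> (real \<Rightarrow> 'p) set) \<Rightarrow> bool" where
  "torsion_free M nab \<longleftrightarrow>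
     (\<forall>W X Y f p. openin (mfd_topology M) W \<and> vector_field_on M W X \<and> vector_field_on M W Y \<and>
        smooth_fun_on M W f \<and> p \<in> W \<longrightarrow>
        dir_deriv (nab (X p) Y) f - dir_deriv (nab (Y p) X) f =
        dir_deriv (X p) (\<lambda>q. dir_deriv (Y q) f) - dir_deriv (Y p) (\<lambda>q. dir_deriv (X q) f))"

definition metric_compatible ::
  "('p, 'i) mfd \<Rightarrow> ((real \<Rightarrow> 'p) set \<Rightarrow> (real \<Rightarrow> 'p) set \<Rightarrow> real) \<Rightarrow>
   ((real \<Rightarrow> 'p) set \<Rightarrow> ('p \<Rightarrow> (real \<Rightarrow> 'p) set) \<Rightarrow> (real \<Rightarrow> 'p) set) \<Rightarrow> bool" where
  "metric_compatible M g nab \<longleftrightarrow>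
     (\<forall>W Y Z p. openin (mfd_topology M) W \<and> vector_field_on M W Y \<and> vector_field_on M W Z \<and> p \<in> W \<longrightarrow>
        (\<forall>v\<in>tangent_space M p.
           dir_deriv v (\<lambda>q. g (Y q) (Z q)) = g (nab v Y) (Z p) + g (Y p) (nab v Z)))"

definition levi_civita ::
  "('p, 'i) mfd \<Rightarrow> ((real \<Rightarrow> 'p) set \<Rightarrow> (real \<Rightarrow> 'p) set \<Rightarrow> real) \<Rightarrow>
   ((real \<Rightarrow> 'p) set \<Rightarrow> ('p \<Rightarrow> (real \<Rightarrow> 'p) set) \<Rightarrow> (real \<Rightarrow> 'p) set) \<Rightarrow> bool" where
  "levi_civita M g nab \<longleftrightarrow>
     affine_connection M nab \<and> torsion_free M nab \<and> metric_compatible M g nab"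

text \<open>\<open>christoffel M nab U \<phi> i j l\<close> is \<open>\<Gamma>\<close> with lower indices \<open>i\<close>, \<open>j\<close> and upper index \<open>l\<close>.\<close>

definition christoffel ::
  "('p, 'i) mfd \<Rightarrow> ((real \<Rightarrow> 'p) set \<Rightarrow> ('p \<Rightarrow> (real \<Rightarrow> 'p) set) \<Rightarrow> (real \<Rightarrow> 'p) set) \<Rightarrow>
   'p set \<Rightarrow> ('p \<Rightarrow> 'i \<Rightarrow> real) \<Rightarrow> 'i \<Rightarrow> 'i \<Rightarrow> 'i \<Rightarrow> 'p \<Rightarrow> real" where
  "christoffel M nab U \<phi> i j l p =
     tcomp \<phi> (nab (coord_field M U \<phi> i p) (coord_field M U \<phi> j)) l"

text \<open>The covariant derivative along the curve \<open>c\<close> of a vector field \<open>V\<close> along \<open>c\<close>.\<close>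

definition cov_deriv_along ::
  "('p, 'i) mfd \<Rightarrow> ((real \<Rightarrow> 'p) set \<Rightarrow> ('p \<Rightarrow> (real \<Rightarrow> 'p) set) \<Rightarrow> (real \<Rightarrow> 'p) set) \<Rightarrow>
   (real \<Rightarrow> 'p) \<Rightarrow> (real \<Rightarrow> (real \<Rightarrow> 'p) set) \<Rightarrow> real \<Rightarrow> (real \<Rightarrow> 'p) set" where
  "cov_deriv_along M nab c V t = (THE z. z \<in> tangent_space M (c t) \<and>
     (\<forall>(U, \<phi>)\<in>charts M. c t \<in> U \<longrightarrow> (\<forall>l\<in>index M.
        tcomp \<phi> z l = deriv (\<lambda>r. tcomp \<phi> (V r) l) t +
          (\<Sum>i\<in>index M. \<Sum>j\<in>index M.
             christoffel M nab U \<phi> i j l (c t) * tcomp \<phi> (velocity M c t) i * tcomp \<phi> (V t) j))))"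


section \<open>The almost-tangent structure, Whitney sums, connection maps and towers\<close>

text \<open>\<open>J\<close> shifts the components of a tangent vector to \<open>jet_mfd M k\<close> in every induced chart:
  \<open>J (\<partial>/\<partial>q\<^sup>(\<^sup>\<alpha>\<^sup>)\<^sup>i) = \<partial>/\<partial>q\<^sup>(\<^sup>\<alpha>\<^sup>+\<^sup>1\<^sup>)\<^sup>i\<close>, and the vectors \<open>\<partial>/\<partial>q\<^sup>(\<^sup>k\<^sup>)\<^sup>i\<close> are sent to 0.\<close>

definition almost_tangent ::
  "('p, 'i) mfd \<Rightarrow> nat \<Rightarrow> (real \<Rightarrow> (real \<Rightarrow> 'p) set) set \<Rightarrow> (real \<Rightarrow> (real \<Rightarrow> 'p) set) set" where
  "almost_tangent M k X = (THE Y. Y \<in> tangent_space (jet_mfd M k) (foot X) \<and>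
     (\<forall>(U, \<phi>)\<in>charts M. foot (foot X) \<in> U \<longrightarrow> (\<forall>i\<in>index M.
        tcomp (jet_coord M k \<phi>) Y (0, i) = 0 \<and>
        (\<forall>\<alpha><k. tcomp (jet_coord M k \<phi>) Y (Suc \<alpha>, i) = tcomp (jet_coord M k \<phi>) X (\<alpha>, i)))))"

text \<open>The Whitney sum of \<open>k \<ge> 1\<close> copies of the tangent bundle, its points being the tuples
  \<open>(w 1, \<dots>, w k)\<close> of tangent vectors at a common point. Coordinates with index \<open>(0, i)\<close> are those of
  the foot point, coordinates with index \<open>(\<alpha>, i)\<close> are the components of \<open>w \<alpha>\<close>.\<close>

definition whitney_points :: "('p, 'i) mfd \<Rightarrow> nat \<Rightarrow> (nat \<Rightarrow> (real \<Rightarrow> 'p) set) set" where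
  "whitney_points M k = (\<Union>p\<in>points M. {1..k} \<rightarrow>\<^sub>E tangent_space M p)"

definition whitney_sum :: "('p, 'i) mfd \<Rightarrow> nat \<Rightarrow> (nat \<Rightarrow> (real \<Rightarrow> 'p) set, nat \<times> 'i) mfd" where
  "whitney_sum M k =
     \<lparr>points = whitney_points M k,
      index = {..k} \<times> index M,
      charts = (\<lambda>(U, \<phi>). ({w \<in> whitney_points M k. foot (w 1) \<in> U},
        \<lambda>w. restrict (\<lambda>(\<alpha>, i). if \<alpha> = 0 then \<phi> (foot (w 1)) i else tcomp \<phi> (w \<alpha>) i)
              ({..k} \<times> index M))) ` charts M\<rparr>"

definition connection_map ::
  "('p, 'i) mfd \<Rightarrow> nat \<Rightarrow> ((real \<Rightarrow> (real \<Rightarrow> 'p) set) set \<Rightarrow> nat \<Rightarrow> (real \<Rightarrow> 'p) set) \<Rightarrow> bool" where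
  "connection_map M k K \<longleftrightarrow>
     smooth_map_on (TB (jet_mfd M k)) (whitney_sum M k) (points (TB (jet_mfd M k))) K \<and>
     (\<forall>u\<in>points (jet_mfd M k). \<forall>\<alpha>\<in>{1..k}. tlinear (jet_mfd M k) u M (foot u) (\<lambda>X. K X \<alpha>)) \<and>
     (\<forall>X\<in>points (TB (jet_mfd M k)). \<forall>\<alpha>\<in>{1..<k}. K (almost_tangent M k X) (\<alpha> + 1) = K X \<alpha>) \<and>
     (\<forall>X\<in>points (TB (jet_mfd M k)). K (almost_tangent M k X) 1 = pushforward M foot X)"

text \<open>\<open>L\<close> is a map \<open>TT\<^sup>(\<^sup>\<alpha>\<^sup>)M \<rightarrow> TM\<close> through which the \<open>\<alpha>\<close>-th component of \<open>K\<close> factors.\<close>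

definition tower_factor ::
  "('p, 'i) mfd \<Rightarrow> nat \<Rightarrow> ((real \<Rightarrow> (real \<Rightarrow> 'p) set) set \<Rightarrow> nat \<Rightarrow> (real \<Rightarrow> 'p) set) \<Rightarrow> nat \<Rightarrow>
   ((real \<Rightarrow> (real \<Rightarrow> 'p) set) set \<Rightarrow> (real \<Rightarrow> 'p) set) \<Rightarrow> bool" where
  "tower_factor M k K \<alpha> L \<longleftrightarrow>
     L \<in> points (TB (jet_mfd M \<alpha>)) \<rightarrow>\<^sub>E points (TB M) \<and>
     (\<forall>X\<in>points (TB (jet_mfd M k)). K X \<alpha> = L (pushforward (jet_mfd M \<alpha>) (jet_proj M \<alpha>) X))"

definition connection_tower ::
  "('p, 'i) mfd \<Rightarrow> nat \<Rightarrow> ((real \<Rightarrow> (real \<Rightarrow> 'p) set) set \<Rightarrow> nat \<Rightarrow> (real \<Rightarrow> 'p) set) \<Rightarrow> bool" where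
  "connection_tower M k K \<longleftrightarrow>
     connection_map M k K \<and> (\<forall>\<alpha>\<in>{1..k}. \<exists>!L. tower_factor M k K \<alpha> L)"

text \<open>The maps at lower orders \<open>\<alpha>\<close> induced by a connection tower of order \<open>k\<close>.\<close>

definition induced_map ::
  "('p, 'i) mfd \<Rightarrow> nat \<Rightarrow> ((real \<Rightarrow> (real \<Rightarrow> 'p) set) set \<Rightarrow> nat \<Rightarrow> (real \<Rightarrow> 'p) set) \<Rightarrow> nat \<Rightarrow>
   (real \<Rightarrow> (real \<Rightarrow> 'p) set) set \<Rightarrow> nat \<Rightarrow> (real \<Rightarrow> 'p) set" where
  "induced_map M k K \<alpha> X = (\<lambda>\<mu>\<in>{1..\<alpha>}.
     (THE L. tower_factor M k K \<mu> L) (pushforward (jet_mfd M \<mu>) (jet_proj M \<mu>) X))"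

text \<open>A family of maps, one at each order up to \<open>k\<close>, is a connection tower if the top one is a tower
  of order \<open>k\<close> and the others are the maps it induces.\<close>

definition connection_tower_family ::
  "('p, 'i) mfd \<Rightarrow> nat \<Rightarrow> (nat \<Rightarrow> (real \<Rightarrow> (real \<Rightarrow> 'p) set) set \<Rightarrow> nat \<Rightarrow> (real \<Rightarrow> 'p) set) \<Rightarrow> bool" where
  "connection_tower_family M k F \<longleftrightarrow>
     connection_tower M k (F k) \<and>
     (\<forall>\<alpha>\<in>{1..k}. \<forall>X\<in>points (TB (jet_mfd M \<alpha>)). F \<alpha> X = induced_map M k (F k) \<alpha> X)"


section \<open>The maps induced by the Levi-Civita connection\<close>

definition adapted ::
  "('p, 'i) mfd \<Rightarrow> nat \<Rightarrow> (real \<Rightarrow> (real \<Rightarrow> 'p) set) set \<Rightarrow> (real \<Rightarrow> real \<Rightarrow> 'p) \<Rightarrow> bool" where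
  "adapted M k X \<gamma> \<longleftrightarrow>
     smooth_family M \<gamma> \<and> jet M k (\<gamma> 0) = foot X \<and> velocity (jet_mfd M k) (\<lambda>s. jet M k (\<gamma> s)) 0 = X"

text \<open>\<open>1/\<alpha>! \<nabla>\<^sup>\<alpha> \<partial>\<gamma>/\<partial>s\<close> at the origin, with \<open>\<nabla>\<close> taken along the curve \<open>t \<mapsto> \<gamma> 0 t\<close>.\<close>

definition family_cov_deriv ::
  "('p, 'i) mfd \<Rightarrow> ((real \<Rightarrow> 'p) set \<Rightarrow> ('p \<Rightarrow> (real \<Rightarrow> 'p) set) \<Rightarrow> (real \<Rightarrow> 'p) set) \<Rightarrow>
   nat \<Rightarrow> (real \<Rightarrow> real \<Rightarrow> 'p) \<Rightarrow> (real \<Rightarrow> 'p) set" where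
  "family_cov_deriv M nab \<alpha> \<gamma> = tscale M (1 / fact \<alpha>)
     ((cov_deriv_along M nab (\<gamma> 0) ^^ \<alpha>) (\<lambda>t. velocity M (\<lambda>s. \<gamma> s t) 0) 0)"

definition induced_connection_map ::
  "('p, 'i) mfd \<Rightarrow> ((real \<Rightarrow> 'p) set \<Rightarrow> ('p \<Rightarrow> (real \<Rightarrow> 'p) set) \<Rightarrow> (real \<Rightarrow> 'p) set) \<Rightarrow>
   nat \<Rightarrow> (real \<Rightarrow> (real \<Rightarrow> 'p) set) set \<Rightarrow> nat \<Rightarrow> (real \<Rightarrow> 'p) set" where
  "induced_connection_map M nab k X =
     (\<lambda>\<alpha>\<in>{1..k}. family_cov_deriv M nab \<alpha> (SOME \<gamma>. adapted M k X \<gamma>))"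

end

theory Submission
  imports Defs
begin

text \<open>In a chart, \<open>\<nabla>\<close> along the curve \<open>t \<mapsto> \<gamma> 0 t\<close> is a first-order operator \<open>D\<close> on component functions, with
  coefficients built from the Christoffel symbols and the velocity of the curve. By symmetry of second
  derivatives the components of the velocity of \<open>s \<mapsto> jet M k (\<gamma> s)\<close> are the Taylor coefficients of the
  variation field \<open>V = \<partial>\<gamma>/\<partial>s\<close>. Since \<open>D\<^sup>a V\<close> at \<open>0\<close> involves only \<open>a\<close>-jets, it depends on \<open>X\<close> alone, linearly;
  evaluating it on families that are polynomial in the chart gives existence and smooth dependence.
  The family \<open>\<gamma> (s t) t\<close> has variation field \<open>t V\<close>, hence is adapted to \<open>J X\<close>, and
  \<open>D\<^sup>a\<^sup>+\<^sup>1 (t V) = (a + 1) D\<^sup>a V\<close> at \<open>0\<close> yields the two axioms on \<open>J\<close>. For the tower, a family adapted to \<open>X\<close>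
  at order \<open>k\<close> is adapted to the projection of \<open>X\<close> at every lower order.\<close>

section \<open>Calculus on coordinate spaces\<close>

text \<open>Jets are classes of curves with an arbitrary representative \<open>rep\<close>, and sums
  of tangent vectors and covariant derivatives along curves are definite descriptions that quantify
  over all charts. Nothing can be computed in one chart until the prescribed components are known to
  transform correctly; for the covariant derivative this is the transformation law of the
  Christoffel symbols, derived here from the axioms of a connection. A vector tangent to
  \<open>jet_mfd M k\<close> is a 1-jet of a curve of jets, so the jet construction is shown to
  preserve the atlas axioms and then applied to its own result. The factors 1/b! in the jet
  coordinates make the shift J exactly the multiplication of V by t, and the factor a + 1 of the
  Leibniz rule turns 1/(a + 1)! into 1/a!. For a = 0 what remains is V(0), the velocity of the base
  point, whence K_1 J is the differential of the projection to M. The tower factors are unique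
  because the differential of the jet projection is onto: a family adapted to Y at order \<alpha>
  also has a velocity at order k, and that velocity projects to Y.\<close>

lemma PiE_UNIV_eq_extensional [simp]: "PiE I (\<lambda>i. UNIV) = extensional I"
  by (auto simp: PiE_def)

text \<open>A basic open box constrains finitely many coordinates, so the least of the coordinate
  radii serves them all. Extensionality is demanded separately because points are total
  functions.\<close>

lemma openin_powertop_iff:
  assumes "finite I"
  shows "openin (powertop_real I) S \<longleftrightarrow> S \<subseteq> extensional I \<and>
    (\<forall>x\<in>S. \<exists>\<delta>>0. \<forall>x'\<in>extensional I. (\<forall>i\<in>I. \<bar>x' i - x i\<bar> < \<delta>) \<longrightarrow> x' \<in> S)" (is "?L \<longleftrightarrow> ?R")
proof
  assume L: ?L
  show ?R
  proof (intro conjI ballI)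
    show "S \<subseteq> extensional I" using openin_subset[OF L] by simp
    fix x assume x: "x \<in> S"
    obtain X where X: "\<forall>i\<in>I. open (X i)" "x \<in> Pi\<^sub>E I X" "Pi\<^sub>E I X \<subseteq> S"
      using L x unfolding openin_product_topology_alt by auto
    have "\<forall>i\<in>I. \<exists>\<delta>>0. \<forall>r. \<bar>r - x i\<bar> < \<delta> \<longrightarrow> r \<in> X i"
      using X unfolding open_dist by (force simp: dist_real_def)
    then obtain \<delta> where d: "\<forall>i\<in>I. \<delta> i > (0::real) \<and> (\<forall>r. \<bar>r - x i\<bar> < \<delta> i \<longrightarrow> r \<in> X i)" by metis
    \<comment> \<open>The inserted 1 keeps the minimum defined and positive when \<open>I\<close> is
      empty.\<close>
    define D where "D = Min (insert 1 (\<delta> ` I))"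
    have D: "D > 0" "\<And>i. i \<in> I \<Longrightarrow> D \<le> \<delta> i" using assms d by (auto simp: D_def)
    have "x' \<in> S" if "x' \<in> extensional I" "\<forall>i\<in>I. \<bar>x' i - x i\<bar> < D" for x'
    proof -
      have "x' i \<in> X i" if "i \<in> I" for i
      proof -
        have "\<bar>x' i - x i\<bar> < \<delta> i" using \<open>\<forall>i\<in>I. \<bar>x' i - x i\<bar> < D\<close> D(2)[OF that] that by force
        then show ?thesis using d that by blast
      qed
      then have "x' \<in> Pi\<^sub>E I X" using that(1) by (simp add: PiE_iff)
      then show ?thesis using X by blast
    qed
    then show "\<exists>\<delta>>0. \<forall>x'\<in>extensional I. (\<forall>i\<in>I. \<bar>x' i - x i\<bar> < \<delta>) \<longrightarrow> x' \<in> S" using D(1) by blast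
  qed
next
  assume R: ?R
  show ?L
  proof (subst openin_subopen, intro ballI)
    fix x assume x: "x \<in> S"
    obtain \<delta> where d: "\<delta> > 0" "\<forall>x'\<in>extensional I. (\<forall>i\<in>I. \<bar>x' i - x i\<bar> < \<delta>) \<longrightarrow> x' \<in> S" using R x by blast
    have "openin (powertop_real I) (Pi\<^sub>E I (\<lambda>i. ball (x i) \<delta>))"
      using assms by (simp add: openin_PiE_gen)
    moreover have "x \<in> Pi\<^sub>E I (\<lambda>i. ball (x i) \<delta>)" using R x d by (auto simp: PiE_def)
    moreover have "Pi\<^sub>E I (\<lambda>i. ball (x i) \<delta>) \<subseteq> S"
      using d(2) by (auto simp: PiE_def Pi_def dist_real_def abs_minus_commute)
    ultimately show "\<exists>T. openin (powertop_real I) T \<and> x \<in> T \<and> T \<subseteq> S" by blast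
  qed
qed

lemma openin_powertop_subset: "openin (powertop_real I) S \<Longrightarrow> S \<subseteq> extensional I"
  using openin_subset by fastforce

lemma continuous_map_fun_upd:
  "x \<in> extensional I \<Longrightarrow> i \<in> I \<Longrightarrow> continuous_map euclideanreal (powertop_real I) (\<lambda>t. x(i := t))"
  by (auto simp: continuous_map_componentwise extensional_def)

text \<open>\<open>partial\<close> evaluates its argument at updates of the point, so the locality
  of partial derivatives comes down to this fact.\<close>

lemma eventually_fun_upd_mem:
  assumes S: "openin (powertop_real I) S" and x: "x \<in> S" "i \<in> I"
  shows "\<forall>\<^sub>F t in nhds (x i). x(i := t) \<in> S"
proof -
  have e: "x \<in> extensional I" using S x openin_powertop_subset by blast
  have "open {t. x(i := t) \<in> S}"
    using openin_continuous_map_preimage[OF continuous_map_fun_upd[OF e x(2)] S]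
    by simp
  then show ?thesis using x eventually_nhds[of "\<lambda>t. x(i := t) \<in> S"] by force
qed

lemma DERIV_cong_eventually:
  fixes f h :: "real \<Rightarrow> real"
  assumes "(f has_real_derivative d) (at x)" "\<forall>\<^sub>F t in nhds x. f t = h t"
  shows "(h has_real_derivative d) (at x)"
  using assms DERIV_cong_ev[of x x f h d d] by simp

lemma partial_cong:
  assumes S: "openin (powertop_real I) S" and x: "x \<in> S" "i \<in> I"
    and eq: "\<And>x. x \<in> S \<Longrightarrow> f x = h x"
  shows "partial i f x = partial i h x"
  unfolding partial_def
proof (rule deriv_cong_ev)
  show "\<forall>\<^sub>F t in nhds (x i). f (x(i := t)) = h (x(i := t))"
    using eventually_fun_upd_mem[OF S x] by eventually_elim (rule eq)
qed simp

lemma differentiable_fun_upd_cong: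
  fixes f h :: "('i \<Rightarrow> real) \<Rightarrow> real"
  assumes S: "openin (powertop_real I) S" and x: "x \<in> S" "i \<in> I"
    and eq: "\<And>x. x \<in> S \<Longrightarrow> f x = h x"
    and f: "(\<lambda>t. f (x(i := t))) differentiable at (x i)"
  shows "(\<lambda>t. h (x(i := t))) differentiable at (x i)"
proof -
  have "\<forall>\<^sub>F t in nhds (x i). f (x(i := t)) = h (x(i := t))"
    using eventually_fun_upd_mem[OF S x] by eventually_elim (rule eq)
  moreover obtain d where "((\<lambda>t. f (x(i := t))) has_real_derivative d) (at (x i))"
    using f by (auto simp: real_differentiable_def)
  ultimately show ?thesis
    using DERIV_cong_eventually[of "\<lambda>t. f (x(i := t))" d "x i" "\<lambda>t. h (x(i := t))"]
    unfolding real_differentiable_def by blast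
qed

lemma openin_preimage_real:
  assumes f: "continuous_map (subtopology (powertop_real I) S) euclideanreal f"
    and S: "openin (powertop_real I) S" and W: "open W"
  shows "openin (powertop_real I) {x \<in> S. f x \<in> W}"
proof -
  have "openin (subtopology (powertop_real I) S) {x \<in> topspace (subtopology (powertop_real I) S). f x \<in> W}"
    using openin_continuous_map_preimage[OF f] W by simp
  moreover have "topspace (subtopology (powertop_real I) S) = S"
    using openin_subset[OF S] by auto
  ultimately show ?thesis using S openin_open_subtopology by metis
qed

section \<open>Functions of class C^r: restriction, locality and algebra\<close>

lemma Cr_on_continuous: "Cr_on r I S f \<Longrightarrow> continuous_map (subtopology (powertop_real I) S) euclideanreal f"
  by (cases r) auto

lemma Cr_on_SucD:
  "Cr_on (Suc r) I S f \<Longrightarrow> i \<in> I \<Longrightarrow> x \<in> S \<Longrightarrow>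
    ((\<lambda>t. f (x(i := t))) has_real_derivative partial i f x) (at (x i))"
  by (auto simp: partial_def DERIV_deriv_iff_real_differentiable)

lemma Cr_on_subset: "Cr_on r I S f \<Longrightarrow> T \<subseteq> S \<Longrightarrow> Cr_on r I T f"
proof (induction r arbitrary: f)
  case 0 then show ?case by (auto intro: continuous_map_from_subtopology_mono)
next
  case (Suc r) then show ?case by (auto intro: continuous_map_from_subtopology_mono)
qed

lemma Cr_on_lower: "Cr_on (Suc r) I S f \<Longrightarrow> Cr_on r I S f"
  by (induction r arbitrary: f) auto

text \<open>\<open>Cr_on\<close> speaks of total functions, so agreement on \<open>S\<close> has to
  survive each differentiation; it does because \<open>S\<close> is open, which makes the partial
  derivatives agree on \<open>S\<close> again.\<close>

lemma Cr_on_cong: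
  assumes S: "openin (powertop_real I) S"
  shows "Cr_on r I S f \<Longrightarrow> (\<And>x. x \<in> S \<Longrightarrow> f x = h x) \<Longrightarrow> Cr_on r I S h"
proof (induction r arbitrary: f h)
  case 0
  then show ?case by (auto elim!: continuous_map_eq)
next
  case (Suc r)
  have "Cr_on r I S (partial i h)" if i: "i \<in> I" for i
  proof (rule Suc.IH)
    show "Cr_on r I S (partial i f)" using Suc.prems i by simp
    show "partial i f x = partial i h x" if "x \<in> S" for x
      using partial_cong[OF S that i] Suc.prems by blast
  qed
  moreover have "continuous_map (subtopology (powertop_real I) S) euclideanreal h"
    using Suc.prems by (auto elim!: continuous_map_eq)
  moreover have "(\<lambda>t. h (x(i := t))) differentiable at (x i)" if "x \<in> S" "i \<in> I" for x i
  proof (rule differentiable_fun_upd_cong[OF S that])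
    show "f y = h y" if "y \<in> S" for y using Suc.prems(2) that .
    show "(\<lambda>t. f (x(i := t))) differentiable at (x i)" using Suc.prems(1) that by simp
  qed
  ultimately show ?case by auto
qed

lemma Cr_on_local:
  assumes S: "openin (powertop_real I) S"
  shows "(\<And>x. x \<in> S \<Longrightarrow> \<exists>T. openin (powertop_real I) T \<and> x \<in> T \<and> T \<subseteq> S \<and> Cr_on r I T f) \<Longrightarrow> Cr_on r I S f"
proof (induction r arbitrary: f)
  case 0
  have "\<exists>U. openin (powertop_real I) U \<and> x \<in> U \<and> U \<subseteq> {x \<in> S. f x \<in> W}"
    if x: "x \<in> S" "f x \<in> W" and W: "open W" for x W
  proof -
    obtain T where T: "openin (powertop_real I) T" "x \<in> T" "T \<subseteq> S"
      "continuous_map (subtopology (powertop_real I) T) euclideanreal f" using 0[OF x(1)] by auto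
    have "openin (powertop_real I) {x \<in> T. f x \<in> W}"
      using openin_preimage_real[OF T(4,1) W] .
    then show ?thesis using T x by blast
  qed
  then have "openin (powertop_real I) {x \<in> S. f x \<in> W}" if "open W" for W
    using that by (subst openin_subopen) blast
  moreover have "topspace (subtopology (powertop_real I) S) = S"
    using openin_subset[OF S] by auto
  ultimately have "openin (subtopology (powertop_real I) S)
      {x \<in> topspace (subtopology (powertop_real I) S). f x \<in> W}" if "open W" for W
    using that openin_open_subtopology[OF S] by auto
  then show ?case by (simp add: continuous_map_def)
next
  case (Suc r)
  have "Cr_on 0 I S f"
  proof -
    have "Cr_on r I S f"
    proof (rule Suc.IH)
      fix x assume "x \<in> S"
      then obtain T where "openin (powertop_real I) T" "x \<in> T" "T \<subseteq> S" "Cr_on (Suc r) I T f"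
        using Suc.prems by meson
      then show "\<exists>T. openin (powertop_real I) T \<and> x \<in> T \<and> T \<subseteq> S \<and> Cr_on r I T f"
        using Cr_on_lower[of r I T f] by (intro exI[of _ T] conjI)
    qed
    then show ?thesis using Cr_on_continuous by auto
  qed
  moreover have "Cr_on r I S (partial i f)" if "i \<in> I" for i
  proof (rule Suc.IH)
    fix x assume "x \<in> S"
    then obtain T where T: "openin (powertop_real I) T" "x \<in> T" "T \<subseteq> S" "Cr_on (Suc r) I T f"
      using Suc.prems by meson
    moreover have "Cr_on r I T (partial i f)" using T(4) that by simp
    ultimately show "\<exists>T. openin (powertop_real I) T \<and> x \<in> T \<and> T \<subseteq> S \<and> Cr_on r I T (partial i f)" by blast
  qed
  moreover have "(\<lambda>t. f (x(i := t))) differentiable at (x i)" if "x \<in> S" "i \<in> I" for x i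
  proof -
    from Suc.prems[OF that(1)] obtain T where "x \<in> T" "Cr_on (Suc r) I T f" by meson
    then show ?thesis using that(2) by simp
  qed
  ultimately show ?case by simp
qed

lemma Cr_on_const: "Cr_on r I S (\<lambda>x. a)"
proof (induction r arbitrary: a)
  case (Suc r)
  have "partial i (\<lambda>x. a) = (\<lambda>x. 0)" for i :: 'a by (simp add: partial_def fun_eq_iff)
  then show ?case using Suc by simp
qed simp

lemma partial_proj: "partial j (\<lambda>x. x i) = (\<lambda>x. if i = j then 1 else 0)"
  by (auto simp: partial_def fun_eq_iff)

lemma Cr_on_proj: "i \<in> I \<Longrightarrow> Cr_on r I S (\<lambda>x. x i)"
proof (cases r)
  case 0
  assume "i \<in> I"
  then show ?thesis using 0 by (auto intro: continuous_map_from_subtopology continuous_map_product_projection)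
next
  case (Suc n)
  assume i: "i \<in> I"
  then have c: "continuous_map (subtopology (powertop_real I) S) euclideanreal (\<lambda>x. x i)"
    by (auto intro: continuous_map_from_subtopology continuous_map_product_projection)
  have "(\<lambda>t. (x(j := t)) i) differentiable at (x j)" for x :: "'a \<Rightarrow> real" and j
    by (cases "i = j") auto
  then show ?thesis using c unfolding Suc by (simp add: partial_proj Cr_on_const)
qed

lemma Cr_on_add:
  assumes S: "openin (powertop_real I) S"
  shows "Cr_on r I S f \<Longrightarrow> Cr_on r I S h \<Longrightarrow> Cr_on r I S (\<lambda>x. f x + h x)"
proof (induction r arbitrary: f h)
  case 0 then show ?case by (auto intro: continuous_map_add)
next
  case (Suc r)
  have d: "((\<lambda>t. f (x(i := t)) + h (x(i := t))) has_real_derivative partial i f x + partial i h x) (at (x i))"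
    if "x \<in> S" "i \<in> I" for x i
    by (rule DERIV_add[OF Cr_on_SucD[OF Suc.prems(1) that(2,1)] Cr_on_SucD[OF Suc.prems(2) that(2,1)]])
  have "Cr_on r I S (partial i (\<lambda>x. f x + h x))" if i: "i \<in> I" for i
  proof (rule Cr_on_cong[OF S])
    show "Cr_on r I S (\<lambda>x. partial i f x + partial i h x)" using Suc i by simp
    show "partial i f x + partial i h x = partial i (\<lambda>x. f x + h x) x" if "x \<in> S" for x
      using DERIV_imp_deriv[OF d[OF that i]] by (simp add: partial_def)
  qed
  then show ?case using Suc.prems d by (auto intro: continuous_map_add simp: real_differentiable_def)
qed

lemma Cr_on_mult:
  assumes S: "openin (powertop_real I) S"
  shows "Cr_on r I S f \<Longrightarrow> Cr_on r I S h \<Longrightarrow> Cr_on r I S (\<lambda>x. f x * h x)"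
proof (induction r arbitrary: f h)
  case 0 then show ?case by (auto intro: continuous_map_real_mult)
next
  case (Suc r)
  have d: "((\<lambda>t. f (x(i := t)) * h (x(i := t))) has_real_derivative partial i f x * h x + partial i h x * f x) (at (x i))"
    if "x \<in> S" "i \<in> I" for x i
    by (rule DERIV_cong[OF DERIV_mult[OF Cr_on_SucD[OF Suc.prems(1) that(2,1)]
          Cr_on_SucD[OF Suc.prems(2) that(2,1)]]]) simp
  have "Cr_on r I S (partial i (\<lambda>x. f x * h x))" if i: "i \<in> I" for i
  proof (rule Cr_on_cong[OF S])
    show "Cr_on r I S (\<lambda>x. partial i f x * h x + partial i h x * f x)"
      using Suc i by (intro Cr_on_add[OF S] Suc.IH) (auto intro: Cr_on_lower[OF Suc.prems(1)] Cr_on_lower[OF Suc.prems(2)])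
    show "partial i f x * h x + partial i h x * f x = partial i (\<lambda>x. f x * h x) x" if "x \<in> S" for x
      using DERIV_imp_deriv[OF d[OF that i]] by (simp add: partial_def)
  qed
  then show ?case using Suc.prems d by (auto intro: continuous_map_real_mult simp: real_differentiable_def)
qed

lemma Cr_on_sum:
  assumes S: "openin (powertop_real I) S"
  shows "(\<And>a. a \<in> A \<Longrightarrow> Cr_on r I S (f a)) \<Longrightarrow> Cr_on r I S (\<lambda>x. \<Sum>a\<in>A. f a x)"
  by (induction A rule: infinite_finite_induct) (auto intro: Cr_on_const Cr_on_add[OF S])

text \<open>The quotient of \<open>\<phi> t\<close> by \<open>t - t0\<close> is at most \<epsilon>
  times the difference quotient of \<open>g\<close>, and the latter stays below
  \<open>\<bar>d\<bar> + 1\<close>. In the chain rule \<open>\<phi>\<close> is the error of the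
  linear approximation in a single coordinate.\<close>

lemma DERIV_zero_of_small:
  fixes g \<phi> :: "real \<Rightarrow> real"
  assumes g: "(g has_real_derivative d) (at t0)" and z: "\<phi> t0 = 0"
    and small: "\<And>\<epsilon>. \<epsilon> > 0 \<Longrightarrow> \<forall>\<^sub>F t in at t0. \<bar>\<phi> t\<bar> \<le> \<epsilon> * \<bar>g t - g t0\<bar>"
  shows "(\<phi> has_real_derivative 0) (at t0)"
proof -
  have q: "((\<lambda>t. (g t - g t0) / (t - t0)) \<longlongrightarrow> d) (at t0)"
    using g by (simp add: has_field_derivative_iff)
  have b: "\<forall>\<^sub>F t in at t0. \<bar>(g t - g t0) / (t - t0)\<bar> < \<bar>d\<bar> + 1"
    using order_tendstoD(2)[OF tendsto_rabs[OF q], of "\<bar>d\<bar> + 1"] by simp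
  have "((\<lambda>t. \<phi> t / (t - t0)) \<longlongrightarrow> 0) (at t0)"
  proof (rule tendstoI)
    fix e :: real assume e: "e > 0"
    define \<epsilon> where "\<epsilon> = e / (\<bar>d\<bar> + 1)"
    have ep: "\<epsilon> > 0" "\<epsilon> * (\<bar>d\<bar> + 1) = e" using e by (auto simp: \<epsilon>_def)
    show "\<forall>\<^sub>F t in at t0. dist (\<phi> t / (t - t0)) 0 < e"
      using b small[OF ep(1)] eventually_neq_at_within[of t0 t0 UNIV]
    proof eventually_elim
      case (elim t)
      have "\<bar>\<phi> t / (t - t0)\<bar> \<le> \<epsilon> * \<bar>(g t - g t0) / (t - t0)\<bar>"
        using elim by (simp add: abs_divide divide_right_mono)
      also have "\<dots> < \<epsilon> * (\<bar>d\<bar> + 1)" using elim ep by (intro mult_strict_left_mono) auto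
      finally show ?case using ep by simp
    qed
  qed
  then show ?thesis using z by (simp add: has_field_derivative_iff)
qed

text \<open>The coordinates are switched on one at a time; each step is a one-dimensional mean value estimate.\<close>

lemma chain_rule_curve:
  assumes I: "finite I" and S: "openin (powertop_real I) S" and f: "Cr_on (Suc 0) I S f"
    and g0: "g t0 \<in> S" and gext: "\<forall>\<^sub>F t in nhds t0. g t \<in> extensional I"
    and g: "\<And>i. i \<in> I \<Longrightarrow> ((\<lambda>t. g t i) has_real_derivative d i) (at t0)"
  shows "((\<lambda>t. f (g t)) has_real_derivative (\<Sum>i\<in>I. partial i f (g t0) * d i)) (at t0)"
proof -
  define h where "h J t = (\<lambda>i. if i \<in> J then g t i else g t0 i)" for J t
  have x0: "g t0 \<in> extensional I" using g0 openin_powertop_subset[OF S] by blast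
  have "J \<subseteq> I \<Longrightarrow> ((\<lambda>t. f (h J t)) has_real_derivative (\<Sum>i\<in>J. partial i f (g t0) * d i)) (at t0)"
    if "finite J" for J
    using that
  proof (induction J)
    case empty
    then show ?case by (simp add: h_def)
  next
    case (insert j J)
    define p where "p = partial j f (g t0)"
    define D where "D t = f ((h J t)(j := g t j)) - f ((h J t)(j := g t0 j))" for t
    have hj: "h (insert j J) t = (h J t)(j := g t j)" "h J t = (h J t)(j := g t0 j)" for t
      using insert.hyps by (auto simp: h_def)
    have jI: "j \<in> I" using insert.prems by simp
    have "((\<lambda>t. D t - p * (g t j - g t0 j)) has_real_derivative 0) (at t0)"
    proof (rule DERIV_zero_of_small[OF g[OF jI]])
      show "D t0 - p * (g t0 j - g t0 j) = 0" by (simp add: D_def)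
      fix \<epsilon> :: real assume e: "\<epsilon> > 0"
      have c: "continuous_map (subtopology (powertop_real I) S) euclideanreal (partial j f)"
        using f jI by simp
      have o: "openin (powertop_real I) {x \<in> S. partial j f x \<in> ball p \<epsilon>}"
        by (rule openin_preimage_real[OF c S open_ball])
      obtain \<delta> where d: "\<delta> > 0" "\<And>x. x \<in> extensional I \<Longrightarrow> (\<And>i. i \<in> I \<Longrightarrow> \<bar>x i - g t0 i\<bar> < \<delta>) \<Longrightarrow>
          x \<in> S \<and> partial j f x \<in> ball p \<epsilon>"
      proof -
        have "g t0 \<in> {x \<in> S. partial j f x \<in> ball p \<epsilon>}" using g0 e by (simp add: p_def)
        then obtain \<delta> where "\<delta> > 0"
          "\<forall>x\<in>extensional I. (\<forall>i\<in>I. \<bar>x i - g t0 i\<bar> < \<delta>) \<longrightarrow> x \<in> {x \<in> S. partial j f x \<in> ball p \<epsilon>}"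
          using o unfolding openin_powertop_iff[OF I] by blast
        then show ?thesis using that by blast
      qed
      have "\<forall>\<^sub>F t in at t0. \<bar>g t i - g t0 i\<bar> < \<delta>" if "i \<in> I" for i
      proof -
        have "((\<lambda>t. g t i) \<longlongrightarrow> g t0 i) (at t0)"
          using DERIV_isCont[OF g[OF that]] by (simp add: isCont_def)
        from tendstoD[OF this d(1)] show ?thesis by (simp add: dist_real_def)
      qed
      then have "\<forall>\<^sub>F t in at t0. \<forall>i\<in>I. \<bar>g t i - g t0 i\<bar> < \<delta>"
        using I by (simp add: eventually_ball_finite)
      moreover have "\<forall>\<^sub>F t in at t0. g t \<in> extensional I" using gext
        unfolding eventually_at_filter by eventually_elim simp
      ultimately show "\<forall>\<^sub>F t in at t0. \<bar>D t - p * (g t j - g t0 j)\<bar> \<le> \<epsilon> * \<bar>g t j - g t0 j\<bar>"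
      proof eventually_elim
        case (elim t)
        have m: "(h J t)(j := \<tau>) \<in> S \<and> partial j f ((h J t)(j := \<tau>)) \<in> ball p \<epsilon>"
          if "\<tau> \<in> ball (g t0 j) \<delta>" for \<tau>
        proof (rule d(2))
          show "(h J t)(j := \<tau>) \<in> extensional I"
            using elim(2) x0 jI by (auto simp: h_def extensional_def)
          fix i assume "i \<in> I"
          then show "\<bar>((h J t)(j := \<tau>)) i - g t0 i\<bar> < \<delta>"
            using that elim(1) d(1) by (auto simp: h_def dist_real_def)
        qed
        \<comment> \<open>With the linear part subtracted, the derivative is the deviation of
          \<open>partial j f\<close> from \<open>p\<close>; continuity keeps it below \<epsilon> on
          the segment, so the mean value estimate is the required small error.\<close>
        let ?F = "\<lambda>\<tau>. f ((h J t)(j := \<tau>)) - p * \<tau>"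
        have dF: "(?F has_real_derivative partial j f ((h J t)(j := \<tau>)) - p) (at \<tau> within ball (g t0 j) \<delta>)"
          if "\<tau> \<in> ball (g t0 j) \<delta>" for \<tau>
        proof -
          have "((\<lambda>s. f ((h J t)(j := s))) has_real_derivative partial j f ((h J t)(j := \<tau>))) (at \<tau>)"
            using Cr_on_SucD[OF f jI, of "(h J t)(j := \<tau>)"] m[OF that] by simp
          then have "(?F has_real_derivative partial j f ((h J t)(j := \<tau>)) - p) (at \<tau>)"
            by (auto intro!: derivative_eq_intros)
          then show ?thesis by (rule has_field_derivative_at_within)
        qed
        have "norm (?F (g t j) - ?F (g t0 j)) \<le> \<epsilon> * norm (g t j - g t0 j)"
        proof (rule field_differentiable_bound[OF convex_ball dF])
          show "norm (partial j f ((h J t)(j := \<tau>)) - p) \<le> \<epsilon>" if "\<tau> \<in> ball (g t0 j) \<delta>" for \<tau>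
            using m[OF that] by (auto simp: dist_real_def)
          show "g t j \<in> ball (g t0 j) \<delta>" using elim(1) jI by (simp add: dist_real_def abs_minus_commute)
          show "g t0 j \<in> ball (g t0 j) \<delta>" using d(1) by simp
        qed
        then show ?case by (simp add: D_def algebra_simps)
      qed
    qed
    then have "((\<lambda>t. (D t - p * (g t j - g t0 j)) + p * (g t j - g t0 j)) has_real_derivative 0 + p * (d j - 0)) (at t0)"
      by (intro DERIV_add DERIV_cmult DERIV_diff DERIV_const g[OF jI])
    then have "(D has_real_derivative p * d j) (at t0)" by simp
    then have "((\<lambda>t. f (h J t) + D t) has_real_derivative (\<Sum>i\<in>J. partial i f (g t0) * d i) + p * d j) (at t0)"
      using insert by (intro DERIV_add) auto
    moreover have "f (h J t) + D t = f (h (insert j J) t)" for t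
      using hj[of t] by (simp add: D_def)
    ultimately show ?case using insert.hyps by (simp add: p_def add.commute)
  qed
  from this[OF I order_refl]
  have "((\<lambda>t. f (h I t)) has_real_derivative (\<Sum>i\<in>I. partial i f (g t0) * d i)) (at t0)" .
  moreover have "\<forall>\<^sub>F t in nhds t0. f (h I t) = f (g t)"
    using gext
  proof eventually_elim
    case (elim t)
    then have "h I t = g t" using x0 by (auto simp: h_def extensional_def)
    then show ?case by simp
  qed
  ultimately show ?thesis by (rule DERIV_cong_eventually)
qed

text \<open>By the chain rule a partial derivative of the composite is a sum of products of
  \<open>partial i f\<close> composed with \<open>G\<close> and derivatives of \<open>G\<close>. The
  induction hypothesis covers the former at one order less; the inner map stays fixed, so only
  \<open>f\<close> is generalised.\<close>

lemma Cr_on_compose: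
  assumes I: "finite I" and S: "openin (powertop_real I) S" and T: "openin (powertop_real J) T"
    and GS: "\<And>y. y \<in> T \<Longrightarrow> G y \<in> S"
  shows "Cr_on r I S f \<Longrightarrow> (\<And>i. i \<in> I \<Longrightarrow> Cr_on r J T (\<lambda>y. G y i)) \<Longrightarrow> Cr_on r J T (\<lambda>y. f (G y))"
proof (induction r arbitrary: f)
  case 0
  have "continuous_map (subtopology (powertop_real J) T) (powertop_real I) G"
    using 0(2) GS openin_powertop_subset[OF S] by (auto simp: continuous_map_componentwise)
  then have "continuous_map (subtopology (powertop_real J) T) (subtopology (powertop_real I) S) G"
    using GS by (auto simp: continuous_map_in_subtopology)
  from continuous_map_compose[OF this] 0(1) show ?case by (force simp: o_def)
next
  case (Suc r)
  have G': "\<And>i. i \<in> I \<Longrightarrow> Cr_on r J T (\<lambda>y. G y i)" using Suc.prems(2) Cr_on_lower by blast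
  have f1: "Cr_on (Suc 0) I S f" using Suc.prems(1)
    by (auto intro: Cr_on_continuous)
  have d: "((\<lambda>t. f (G (y(j := t)))) has_real_derivative
      (\<Sum>i\<in>I. partial i f (G y) * partial j (\<lambda>y. G y i) y)) (at (y j))" if y: "y \<in> T" and j: "j \<in> J" for y j
  proof -
    have "\<forall>\<^sub>F t in nhds (y j). G (y(j := t)) \<in> extensional I"
      using eventually_fun_upd_mem[OF T y j]
      by eventually_elim (use GS openin_powertop_subset[OF S] in blast)
    then show ?thesis
      using chain_rule_curve[OF I S f1, of "\<lambda>t. G (y(j := t))" "y j" "\<lambda>i. partial j (\<lambda>y. G y i) y"]
        GS[OF y] Cr_on_SucD[OF Suc.prems(2) j y] by simp
  qed
  have "Cr_on r J T (partial j (\<lambda>y. f (G y)))" if j: "j \<in> J" for j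
  proof (rule Cr_on_cong[OF T])
    show "Cr_on r J T (\<lambda>y. \<Sum>i\<in>I. partial i f (G y) * partial j (\<lambda>y. G y i) y)"
    proof (intro Cr_on_sum[OF T] Cr_on_mult[OF T])
      fix i assume i: "i \<in> I"
      show "Cr_on r J T (\<lambda>y. partial i f (G y))" using Suc.IH[OF _ G'] Suc.prems(1) i by simp
      show "Cr_on r J T (partial j (\<lambda>y. G y i))" using Suc.prems(2)[OF i] j by simp
    qed
    show "(\<Sum>i\<in>I. partial i f (G y) * partial j (\<lambda>y. G y i) y) = partial j (\<lambda>y. f (G y)) y" if "y \<in> T" for y
      using DERIV_imp_deriv[OF d[OF that j]] by (simp add: partial_def)
  qed
  moreover have "continuous_map (subtopology (powertop_real J) T) euclideanreal (\<lambda>y. f (G y))"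
    using Suc.IH[OF Cr_on_lower[OF Suc.prems(1)] G'] Cr_on_continuous by blast
  ultimately show ?case using d by (auto simp: real_differentiable_def)
qed

section \<open>The same rules for smooth functions\<close>

lemma smooth_on_coords_partial: "smooth_on_coords I S f \<Longrightarrow> i \<in> I \<Longrightarrow> smooth_on_coords I S (partial i f)"
  using Cr_on.simps(2)[of _ I S f] unfolding smooth_on_coords_def by metis

lemma smooth_on_coords_partial_funpow:
  "smooth_on_coords I S f \<Longrightarrow> i \<in> I \<Longrightarrow> smooth_on_coords I S ((partial i ^^ n) f)"
  by (induction n) (auto intro: smooth_on_coords_partial)

lemma smooth_on_coords_DERIV:
  "smooth_on_coords I S f \<Longrightarrow> i \<in> I \<Longrightarrow> x \<in> S \<Longrightarrow>
    ((\<lambda>t. f (x(i := t))) has_real_derivative partial i f x) (at (x i))"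
  using Cr_on_SucD[of 0 I S f i x] unfolding smooth_on_coords_def by blast

lemma smooth_on_coords_continuous:
  "smooth_on_coords I S f \<Longrightarrow> continuous_map (subtopology (powertop_real I) S) euclideanreal f"
  using Cr_on_continuous[of 0 I S f] unfolding smooth_on_coords_def by blast

lemma smooth_on_coords_subset: "smooth_on_coords I S f \<Longrightarrow> T \<subseteq> S \<Longrightarrow> smooth_on_coords I T f"
  using Cr_on_subset[of _ I S f T] unfolding smooth_on_coords_def by blast

lemma smooth_on_coords_cong:
  "openin (powertop_real I) S \<Longrightarrow> smooth_on_coords I S f \<Longrightarrow> (\<And>x. x \<in> S \<Longrightarrow> f x = h x) \<Longrightarrow> smooth_on_coords I S h"
  using Cr_on_cong[of I S _ f h] unfolding smooth_on_coords_def by blast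

lemma smooth_on_coords_local:
  assumes "openin (powertop_real I) S"
    and "\<And>x. x \<in> S \<Longrightarrow> \<exists>T. openin (powertop_real I) T \<and> x \<in> T \<and> T \<subseteq> S \<and> smooth_on_coords I T f"
  shows "smooth_on_coords I S f"
  unfolding smooth_on_coords_def
proof
  fix r show "Cr_on r I S f"
    using assms(2) unfolding smooth_on_coords_def by (intro Cr_on_local[OF assms(1)]) blast
qed

lemma smooth_on_coords_const: "smooth_on_coords I S (\<lambda>x. a)"
  by (simp add: smooth_on_coords_def Cr_on_const)

lemma smooth_on_coords_proj: "i \<in> I \<Longrightarrow> smooth_on_coords I S (\<lambda>x. x i)"
  by (simp add: smooth_on_coords_def Cr_on_proj)

lemma smooth_on_coords_add:
  "openin (powertop_real I) S \<Longrightarrow> smooth_on_coords I S f \<Longrightarrow> smooth_on_coords I S h \<Longrightarrow>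
    smooth_on_coords I S (\<lambda>x. f x + h x)"
  by (simp add: smooth_on_coords_def Cr_on_add)

lemma smooth_on_coords_mult:
  "openin (powertop_real I) S \<Longrightarrow> smooth_on_coords I S f \<Longrightarrow> smooth_on_coords I S h \<Longrightarrow>
    smooth_on_coords I S (\<lambda>x. f x * h x)"
  by (simp add: smooth_on_coords_def Cr_on_mult)

lemma smooth_on_coords_power:
  "openin (powertop_real I) S \<Longrightarrow> smooth_on_coords I S f \<Longrightarrow> smooth_on_coords I S (\<lambda>x. f x ^ n)"
  by (induction n) (auto intro: smooth_on_coords_const smooth_on_coords_mult)

lemma smooth_on_coords_sum:
  "openin (powertop_real I) S \<Longrightarrow> (\<And>a. a \<in> A \<Longrightarrow> smooth_on_coords I S (f a)) \<Longrightarrow>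
    smooth_on_coords I S (\<lambda>x. \<Sum>a\<in>A. f a x)"
  by (simp add: smooth_on_coords_def Cr_on_sum)

lemma smooth_on_coords_compose:
  assumes "finite I" "openin (powertop_real I) S" "openin (powertop_real J) T"
    and "\<And>y. y \<in> T \<Longrightarrow> G y \<in> S"
    and "smooth_on_coords I S f" "\<And>i. i \<in> I \<Longrightarrow> smooth_on_coords J T (\<lambda>y. G y i)"
  shows "smooth_on_coords J T (\<lambda>y. f (G y))"
  unfolding smooth_on_coords_def
proof
  fix r
  have "Cr_on r I S f" "\<And>i. i \<in> I \<Longrightarrow> Cr_on r J T (\<lambda>y. G y i)"
    using assms(5,6) unfolding smooth_on_coords_def by auto
  then show "Cr_on r J T (\<lambda>y. f (G y))"
    using Cr_on_compose[of I S J T G r f] assms(1-4) by blast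
qed

lemma chain_rule_smooth:
  assumes "finite I" "openin (powertop_real I) S" "smooth_on_coords I S f"
    and "g t0 \<in> S" "\<forall>\<^sub>F t in nhds t0. g t \<in> extensional I"
    and "\<And>i. i \<in> I \<Longrightarrow> ((\<lambda>t. g t i) has_real_derivative d i) (at t0)"
  shows "((\<lambda>t. f (g t)) has_real_derivative (\<Sum>i\<in>I. partial i f (g t0) * d i)) (at t0)"
proof -
  have "Cr_on (Suc 0) I S f" using assms(3) unfolding smooth_on_coords_def ..
  from chain_rule_curve[of I S f g t0 d, OF assms(1,2) this assms(4-6)] show ?thesis .
qed

lemma openin_preimage_coords:
  assumes "openin (powertop_real J) T" "openin (powertop_real I) S"
    and "\<And>y. y \<in> T \<Longrightarrow> G y \<in> extensional I"
    and "\<And>i. i \<in> I \<Longrightarrow> smooth_on_coords J T (\<lambda>y. G y i)"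
  shows "openin (powertop_real J) {y \<in> T. G y \<in> S}"
proof -
  have "continuous_map (subtopology (powertop_real J) T) (powertop_real I) G"
    using assms by (auto simp: continuous_map_componentwise dest: smooth_on_coords_continuous)
  from openin_continuous_map_preimage[OF this assms(2)]
  have "openin (subtopology (powertop_real J) T)
      {y \<in> topspace (subtopology (powertop_real J) T). G y \<in> S}" .
  moreover have "topspace (subtopology (powertop_real J) T) = T"
    using openin_subset[OF assms(1)] by auto
  ultimately show ?thesis using assms(1) openin_open_subtopology by metis
qed

section \<open>Iterated and mixed partial derivatives\<close>

lemma partial_funpow: "(partial j ^^ n) f x = (deriv ^^ n) (\<lambda>t. f (x(j := t))) (x j)"
proof (induction n arbitrary: x)
  case (Suc n)
  have "(partial j ^^ Suc n) f x = deriv (\<lambda>t. (partial j ^^ n) f (x(j := t))) (x j)"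
    by (simp only: funpow.simps o_apply) (rule partial_def)
  \<comment> \<open>A later update of coordinate \<open>j\<close> overrides an earlier one, so
    iterated partial derivatives see a single function of one variable. Through this identity the
    higher derivatives in jets become partial derivatives of functions with parameters.\<close>
  also have "\<dots> = deriv (\<lambda>t. (deriv ^^ n) (\<lambda>s. f (x(j := s))) t) (x j)"
    by (simp only: Suc fun_upd_same fun_upd_upd)
  finally show ?case by (simp only: funpow.simps o_apply)
qed simp

text \<open>The second difference is the increment in coordinate \<open>i\<close> of an increment in
  coordinate \<open>j\<close>; one mean value theorem per coordinate turns it into a mixed
  derivative at an interior point.\<close>

lemma second_difference_mean_value:
  fixes h :: real
  assumes f: "smooth_on_coords I S f" and i: "i \<in> I" and j: "j \<in> I" and ij: "i \<noteq> j" and h: "h > 0"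
    and box: "\<And>a b. a \<in> {x i..x i + h} \<Longrightarrow> b \<in> {x j..x j + h} \<Longrightarrow> x(i := a, j := b) \<in> S"
  obtains a b where "a \<in> {x i<..<x i + h}" "b \<in> {x j<..<x j + h}"
    "f (x(i := x i + h, j := x j + h)) - f (x(i := x i + h)) - f (x(j := x j + h)) + f x =
      h * h * partial j (partial i f) (x(i := a, j := b))"
proof -
  have di: "((\<lambda>s. f (x(i := s, j := b))) has_real_derivative partial i f (x(i := a, j := b))) (at a)"
    if "a \<in> {x i..x i + h}" "b \<in> {x j..x j + h}" for a b
    using smooth_on_coords_DERIV[OF f i box[OF that]] ij by (simp add: fun_upd_twist)
  have dj: "((\<lambda>s. partial i f (x(i := a, j := s))) has_real_derivative partial j (partial i f) (x(i := a, j := b))) (at b)"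
    if "a \<in> {x i..x i + h}" "b \<in> {x j..x j + h}" for a b
    using smooth_on_coords_DERIV[OF smooth_on_coords_partial[OF f i] j box[OF that]] by simp
  let ?\<Phi> = "\<lambda>s. f (x(i := s, j := x j + h)) - f (x(i := s, j := x j))"
  have "\<exists>z. x i < z \<and> z < x i + h \<and> ?\<Phi> (x i + h) - ?\<Phi> (x i) = (x i + h - x i) *
      (partial i f (x(i := z, j := x j + h)) - partial i f (x(i := z, j := x j)))"
    using h by (intro MVT2 DERIV_diff di) auto
  then obtain a where a: "x i < a" "a < x i + h" "?\<Phi> (x i + h) - ?\<Phi> (x i) =
      h * (partial i f (x(i := a, j := x j + h)) - partial i f (x(i := a, j := x j)))" by auto
  have "\<exists>z. x j < z \<and> z < x j + h \<and> partial i f (x(i := a, j := x j + h)) - partial i f (x(i := a, j := x j)) =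
      (x j + h - x j) * partial j (partial i f) (x(i := a, j := z))"
    using h a by (intro MVT2 dj) auto
  then obtain b where b: "x j < b" "b < x j + h" "partial i f (x(i := a, j := x j + h)) - partial i f (x(i := a, j := x j)) =
      h * partial j (partial i f) (x(i := a, j := b))" by auto
  have e: "x(i := s, j := x j) = x(i := s)" for s using ij by auto
  show ?thesis
    using a b ij by (intro that[of a b]) (auto simp: e)
qed

text \<open>The second difference is symmetric in the two coordinates, so in every small square with
  corner \<open>x\<close> the two mixed derivatives take a common value, possibly at different
  points. Continuity then closes the gap between them at \<open>x\<close>.\<close>

lemma partial_commute:
  assumes I: "finite I" and S: "openin (powertop_real I) S" and f: "smooth_on_coords I S f"
    and x: "x \<in> S" and i: "i \<in> I" and j: "j \<in> I"
  shows "partial i (partial j f) x = partial j (partial i f) x"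
proof (cases "i = j")
  case False
  show ?thesis
  proof (rule ccontr)
    assume ne: "\<not> ?thesis"
    \<comment> \<open>Half of the supposed gap: the \<epsilon>-balls around the two values are
      disjoint, so they cannot share the common value.\<close>
    define \<epsilon> where "\<epsilon> = \<bar>partial i (partial j f) x - partial j (partial i f) x\<bar> / 2"
    have e: "\<epsilon> > 0" using ne by (simp add: \<epsilon>_def)
    have o: "openin (powertop_real I) {y \<in> S. partial a (partial b f) y \<in> ball (partial a (partial b f) x) \<epsilon>}"
      if "a \<in> I" "b \<in> I" for a b
    proof -
      have "continuous_map (subtopology (powertop_real I) S) euclideanreal (partial a (partial b f))"
        using that f by (intro smooth_on_coords_continuous smooth_on_coords_partial)
      then show ?thesis by (rule openin_preimage_real[OF _ S open_ball])
    qed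
    define Q where "Q = {y \<in> S. partial i (partial j f) y \<in> ball (partial i (partial j f) x) \<epsilon>} \<inter>
       {y \<in> S. partial j (partial i f) y \<in> ball (partial j (partial i f) x) \<epsilon>}"
    have "openin (powertop_real I) Q" "x \<in> Q" unfolding Q_def using o i j x e by auto
    then obtain \<delta> where d: "\<delta> > 0" "\<And>y. y \<in> extensional I \<Longrightarrow> (\<And>i. i \<in> I \<Longrightarrow> \<bar>y i - x i\<bar> < \<delta>) \<Longrightarrow> y \<in> Q"
      unfolding openin_powertop_iff[OF I] by blast
    define h where "h = \<delta> / 2"
    have h: "h > 0" "h < \<delta>" using d by (auto simp: h_def)
    have xe: "x \<in> extensional I" using x openin_powertop_subset[OF S] by blast
    have box: "x(i := a, j := b) \<in> Q" if "a \<in> {x i..x i + h}" "b \<in> {x j..x j + h}" for a b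
      using that h i j xe False by (intro d(2)) (auto simp: extensional_def)
    have box': "x(j := a, i := b) \<in> Q" if "a \<in> {x j..x j + h}" "b \<in> {x i..x i + h}" for a b
      using box[of b a] that False by (simp add: fun_upd_twist)
    have QS: "Q \<subseteq> S" by (auto simp: Q_def)
    obtain a b where 1: "a \<in> {x i<..<x i + h}" "b \<in> {x j<..<x j + h}"
      "f (x(i := x i + h, j := x j + h)) - f (x(i := x i + h)) - f (x(j := x j + h)) + f x =
      h * h * partial j (partial i f) (x(i := a, j := b))"
      using second_difference_mean_value[OF f i j False h(1), of x] box QS by blast
    obtain b' a' where 2: "b' \<in> {x j<..<x j + h}" "a' \<in> {x i<..<x i + h}"
      "f (x(j := x j + h, i := x i + h)) - f (x(j := x j + h)) - f (x(i := x i + h)) + f x =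
      h * h * partial i (partial j f) (x(j := b', i := a'))"
      using second_difference_mean_value[OF f j i False[symmetric] h(1), of x] box' QS by blast
    have tw: "x(j := t, i := r) = x(i := r, j := t)" for r t using False by (rule fun_upd_twist[symmetric])
    have "h * h * partial j (partial i f) (x(i := a, j := b)) = h * h * partial i (partial j f) (x(i := a', j := b'))"
      using 1(3) 2(3) unfolding tw by linarith
    then have eq: "partial j (partial i f) (x(i := a, j := b)) = partial i (partial j f) (x(i := a', j := b'))"
      using h by simp
    have "x(i := a, j := b) \<in> Q" "x(i := a', j := b') \<in> Q" using 1 2 box by auto
    then have "\<bar>partial i (partial j f) x - partial j (partial i f) x\<bar> < 2 * \<epsilon>"
      using eq unfolding Q_def by (auto simp: dist_real_def)
    then show False by (simp add: \<epsilon>_def)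
  qed
qed simp

lemma partial_funpow_commute:
  assumes I: "finite I" and S: "openin (powertop_real I) S" and f: "smooth_on_coords I S f"
    and x: "x \<in> S" and i: "i \<in> I" and j: "j \<in> I"
  shows "partial i ((partial j ^^ n) f) x = (partial j ^^ n) (partial i f) x"
  using x
proof (induction n arbitrary: x)
  case (Suc n)
  have "partial i ((partial j ^^ Suc n) f) x = partial j (partial i ((partial j ^^ n) f)) x"
    using partial_commute[OF I S smooth_on_coords_partial_funpow[OF f j] Suc.prems i j] by simp
  also have "\<dots> = partial j ((partial j ^^ n) (partial i f)) x"
    using Suc.IH by (intro partial_cong[OF S Suc.prems j])
  finally show ?case by simp
qed simp

section \<open>Functions of one variable near the origin\<close>

text \<open>Smoothness on a symmetric interval is expressed in the coordinate space over
  \<open>unit\<close>, so that all closure properties are inherited from the calculus above.\<close>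

definition smooth_ivl :: "real \<Rightarrow> (real \<Rightarrow> real) \<Rightarrow> bool" where
  "smooth_ivl \<epsilon> f \<longleftrightarrow> smooth_on_coords (UNIV :: unit set) {x. \<bar>x ()\<bar> < \<epsilon>} (\<lambda>x. f (x ()))"

lemma openin_powertop_unit_0:
  assumes "openin (powertop_real (UNIV :: unit set)) T" "(\<lambda>_. 0) \<in> T"
  shows "\<exists>\<delta>>0. \<forall>t. \<bar>t\<bar> < \<delta> \<longrightarrow> (\<lambda>_. t) \<in> T"
proof -
  have "(\<lambda>_ :: unit. 0 :: real)(() := t) = (\<lambda>_. t)" for t by auto
  then show ?thesis using eventually_fun_upd_mem[OF assms, of "()"]
    by (simp add: eventually_nhds_metric)
qed

lemma openin_box:
  assumes "finite I"
  shows "openin (powertop_real I) {x \<in> extensional I. \<forall>j\<in>I. \<bar>x j\<bar> < \<epsilon>}"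
proof -
  have "r \<in> {- \<epsilon><..<\<epsilon>} \<longleftrightarrow> \<bar>r\<bar> < \<epsilon>" for r by auto
  then have "{x \<in> extensional I. \<forall>j\<in>I. \<bar>x j\<bar> < \<epsilon>} = Pi\<^sub>E I (\<lambda>j. {- \<epsilon><..<\<epsilon>})"
    unfolding set_eq_iff PiE_iff mem_Collect_eq by blast
  then show ?thesis using assms by (simp add: openin_PiE_gen)
qed

lemma openin_unit_ivl: "openin (powertop_real (UNIV :: unit set)) {x. \<bar>x ()\<bar> < \<epsilon>}"
proof -
  have "{x. \<bar>x ()\<bar> < \<epsilon>} = {x \<in> extensional (UNIV :: unit set). \<forall>j\<in>UNIV. \<bar>x j\<bar> < \<epsilon>}"
    by (auto simp: extensional_def)
  then show ?thesis using openin_box[of "UNIV :: unit set"] by simp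
qed

lemma openin_bool_box: "openin (powertop_real (UNIV :: bool set)) {x. \<bar>x False\<bar> < \<epsilon> \<and> \<bar>x True\<bar> < \<epsilon>}"
proof -
  have "{x. \<bar>x False\<bar> < \<epsilon> \<and> \<bar>x True\<bar> < \<epsilon>} = {x \<in> extensional (UNIV :: bool set). \<forall>j\<in>UNIV. \<bar>x j\<bar> < \<epsilon>}"
    by (auto simp: extensional_def) (metis (full_types))+
  then show ?thesis using openin_box[of "UNIV :: bool set"] by simp
qed

lemma partial_unit: "partial () (\<lambda>x. f (x ())) = (\<lambda>x. deriv f (x ()))"
  by (simp add: partial_def fun_eq_iff)

lemma smooth_ivl_deriv: "smooth_ivl \<epsilon> f \<Longrightarrow> smooth_ivl \<epsilon> (deriv f)"
  using smooth_on_coords_partial[of UNIV "{x. \<bar>x ()\<bar> < \<epsilon>}" "\<lambda>x. f (x ())" "()"]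
  unfolding smooth_ivl_def by (simp add: partial_unit)

lemma smooth_ivl_DERIV:
  assumes "smooth_ivl \<epsilon> f" "\<bar>t\<bar> < \<epsilon>"
  shows "(f has_real_derivative deriv f t) (at t)"
  using smooth_on_coords_DERIV[of UNIV "{x. \<bar>x ()\<bar> < \<epsilon>}" "\<lambda>x. f (x ())" "()" "\<lambda>_. t"] assms
  unfolding smooth_ivl_def by (simp add: partial_unit)

lemma smooth_ivl_mono: "smooth_ivl \<epsilon> f \<Longrightarrow> \<delta> \<le> \<epsilon> \<Longrightarrow> smooth_ivl \<delta> f"
  unfolding smooth_ivl_def by (erule smooth_on_coords_subset) auto

lemma smooth_ivl_cong:
  assumes "smooth_ivl \<epsilon> f" "\<And>t. \<bar>t\<bar> < \<epsilon> \<Longrightarrow> f t = h t"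
  shows "smooth_ivl \<epsilon> h"
  using assms(1) unfolding smooth_ivl_def
  by (rule smooth_on_coords_cong[OF openin_unit_ivl]) (use assms(2) in simp)

lemma smooth_ivl_const: "smooth_ivl \<epsilon> (\<lambda>_. a)"
  unfolding smooth_ivl_def by (rule smooth_on_coords_const)

lemma smooth_ivl_id: "smooth_ivl \<epsilon> (\<lambda>t. t)"
  unfolding smooth_ivl_def by (rule smooth_on_coords_proj) simp

lemma smooth_ivl_add: "smooth_ivl \<epsilon> f \<Longrightarrow> smooth_ivl \<epsilon> h \<Longrightarrow> smooth_ivl \<epsilon> (\<lambda>t. f t + h t)"
  unfolding smooth_ivl_def by (rule smooth_on_coords_add[OF openin_unit_ivl])

lemma smooth_ivl_mult: "smooth_ivl \<epsilon> f \<Longrightarrow> smooth_ivl \<epsilon> h \<Longrightarrow> smooth_ivl \<epsilon> (\<lambda>t. f t * h t)"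
  unfolding smooth_ivl_def by (rule smooth_on_coords_mult[OF openin_unit_ivl])

lemma smooth_ivl_power: "smooth_ivl \<epsilon> f \<Longrightarrow> smooth_ivl \<epsilon> (\<lambda>t. f t ^ n)"
  unfolding smooth_ivl_def by (rule smooth_on_coords_power[OF openin_unit_ivl])

lemma smooth_ivl_sum: "(\<And>a. a \<in> A \<Longrightarrow> smooth_ivl \<epsilon> (f a)) \<Longrightarrow> smooth_ivl \<epsilon> (\<lambda>t. \<Sum>a\<in>A. f a t)"
  unfolding smooth_ivl_def by (rule smooth_on_coords_sum[OF openin_unit_ivl])

lemma smooth_ivl_compose:
  assumes "finite I" "openin (powertop_real I) S" "smooth_on_coords I S F"
    and "\<And>t. \<bar>t\<bar> < \<epsilon> \<Longrightarrow> g t \<in> S" "\<And>i. i \<in> I \<Longrightarrow> smooth_ivl \<epsilon> (\<lambda>t. g t i)"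
  shows "smooth_ivl \<epsilon> (\<lambda>t. F (g t))"
  unfolding smooth_ivl_def
  by (rule smooth_on_coords_compose[OF assms(1,2) openin_unit_ivl, where G = "\<lambda>x. g (x ())"])
    (use assms(3-5) in \<open>simp_all add: smooth_ivl_def\<close>)

lemma smooth_on_coords_ivl:
  assumes "openin (powertop_real J) T" "smooth_ivl \<epsilon> f" "smooth_on_coords J T h"
    and "\<And>x. x \<in> T \<Longrightarrow> \<bar>h x\<bar> < \<epsilon>"
  shows "smooth_on_coords J T (\<lambda>x. f (h x))"
  using smooth_on_coords_compose[OF _ openin_unit_ivl assms(1), of "\<lambda>x (_ :: unit). h x" \<epsilon> "\<lambda>x. f (x ())"] assms(2-4)
  unfolding smooth_ivl_def by simp

text \<open>Continuity at 0, in the form that shrinks an interval until a coordinate curve stays in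
  an open set; curves and polynomials are kept inside charts by it.\<close>

lemma smooth_ivl_open_preimage:
  assumes I: "finite I" and S: "openin (powertop_real I) S" and g0: "g 0 \<in> S" and e: "\<epsilon> > 0"
    and ext: "\<And>t. \<bar>t\<bar> < \<epsilon> \<Longrightarrow> g t \<in> extensional I"
    and g: "\<And>i. i \<in> I \<Longrightarrow> smooth_ivl \<epsilon> (\<lambda>t. g t i)"
  obtains \<delta> where "0 < \<delta>" "\<delta> \<le> \<epsilon>" "\<And>t. \<bar>t\<bar> < \<delta> \<Longrightarrow> g t \<in> S"
proof -
  have o: "openin (powertop_real (UNIV :: unit set)) {x \<in> {x. \<bar>x ()\<bar> < \<epsilon>}. g (x ()) \<in> S}"
    by (rule openin_preimage_coords[OF openin_unit_ivl S]) (use ext g in \<open>simp_all add: smooth_ivl_def\<close>)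
  have "(\<lambda>_. 0) \<in> {x \<in> {x. \<bar>x ()\<bar> < \<epsilon>}. g (x ()) \<in> S}" using g0 e by simp
  from openin_powertop_unit_0[OF o this] obtain \<delta> where d: "\<delta> > 0"
    "\<And>t. \<bar>t\<bar> < \<delta> \<Longrightarrow> g t \<in> S" by auto
  show ?thesis
  proof (rule that[of "min \<delta> \<epsilon>"])
    fix t :: real assume "\<bar>t\<bar> < min \<delta> \<epsilon>"
    then show "g t \<in> S" using d(2)[of t] by simp
  qed (use d e in auto)
qed

section \<open>Higher derivatives at a point\<close>

lemma eventually_abs_less: "\<bar>t\<bar> < \<epsilon> \<Longrightarrow> \<forall>\<^sub>F s in nhds t. \<bar>s\<bar> < (\<epsilon>::real)"
  by (rule eventually_nhds_in_open[of "{s. \<bar>s\<bar> < \<epsilon>}", simplified]) (auto intro!: open_Collect_less continuous_intros)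

text \<open>Agreement near \<open>x\<close> is agreement near every point close to \<open>x\<close>,
  so the first derivatives again agree near \<open>x\<close> and the induction continues; agreement
  at \<open>x\<close> alone would not survive one step.\<close>

lemma higher_deriv_cong_eventually:
  fixes f h :: "real \<Rightarrow> real"
  assumes "\<forall>\<^sub>F t in nhds x. f t = h t"
  shows "(deriv ^^ n) f x = (deriv ^^ n) h x"
  using assms
proof (induction n arbitrary: f h)
  case 0 then show ?case using eventually_nhds_x_imp_x by simp
next
  case (Suc n)
  have "\<forall>\<^sub>F s in nhds x. \<forall>\<^sub>F t in nhds s. f t = h t" using Suc.prems by (simp add: eventually_eventually)
  then have "\<forall>\<^sub>F s in nhds x. deriv f s = deriv h s" by eventually_elim (rule deriv_cong_ev, auto)
  then show ?case using Suc.IH by (simp only: funpow_Suc_right o_apply)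
qed

lemma higher_deriv_cong_ivl:
  fixes f h :: "real \<Rightarrow> real"
  assumes "\<And>t. \<bar>t\<bar> < \<epsilon> \<Longrightarrow> f t = h t" "\<bar>x\<bar> < \<epsilon>"
  shows "(deriv ^^ n) f x = (deriv ^^ n) h x"
  by (rule higher_deriv_cong_eventually)
    (rule eventually_mono[OF eventually_abs_less[OF assms(2)]], rule assms(1))

lemma deriv_cong_ivl:
  fixes f h :: "real \<Rightarrow> real"
  assumes "\<And>t. \<bar>t\<bar> < \<epsilon> \<Longrightarrow> f t = h t" "\<bar>x\<bar> < \<epsilon>"
  shows "deriv f x = deriv h x"
  using higher_deriv_cong_ivl[of \<epsilon> f h x 1, OF assms] by simp

text \<open>Iterating \<open>deriv\<close> on a polynomial function is iterating
  \<open>pderiv\<close>, and the constant coefficient of the \<open>b\<close>-th derivative is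
  \<open>fact b\<close> times the \<open>b\<close>-th coefficient. Consequently polynomials in a
  chart realise any prescribed jet coordinates.\<close>

lemma higher_deriv_polynomial_0:
  assumes "b \<le> k"
  shows "(deriv ^^ b) (\<lambda>t::real. \<Sum>c\<le>k. a c * t ^ c) 0 = fact b * a b"
proof -
  define p where "p = (\<Sum>c\<le>k. monom (a c) c)"
  have "deriv (poly q) = poly (pderiv q)" for q :: "real poly"
    by (rule ext, rule DERIV_imp_deriv, rule poly_DERIV)
  then have "(deriv ^^ b) (poly q) = poly ((pderiv ^^ b) q)" for q :: "real poly"
    by (induction b) auto
  moreover have "(\<lambda>t. \<Sum>c\<le>k. a c * t ^ c) = poly p"
    by (simp add: p_def fun_eq_iff poly_sum poly_monom)
  moreover have "coeff p b = a b"
    using assms by (simp add: p_def coeff_sum)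
  ultimately show ?thesis
    by (simp add: poly_0_coeff_0 coeff_higher_pderiv pochhammer_fact)
qed

section \<open>Contact of functions at the origin\<close>

definition jet_eq :: "nat \<Rightarrow> (real \<Rightarrow> real) \<Rightarrow> (real \<Rightarrow> real) \<Rightarrow> bool" where
  "jet_eq m f h \<longleftrightarrow> (\<forall>a\<le>m. (deriv ^^ a) f 0 = (deriv ^^ a) h 0)"

lemma jet_eq_0: "jet_eq m f h \<Longrightarrow> f 0 = h 0"
  unfolding jet_eq_def by force

lemma jet_eq_mono: "jet_eq m f h \<Longrightarrow> n \<le> m \<Longrightarrow> jet_eq n f h"
  unfolding jet_eq_def by simp

lemma jet_eq_refl: "jet_eq m f f"
  unfolding jet_eq_def by simp

lemma jet_eq_zero: "jet_eq 0 f h \<longleftrightarrow> f 0 = h 0"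
  unfolding jet_eq_def by simp

lemma jet_eq_Suc: "jet_eq (Suc m) f h \<longleftrightarrow> f 0 = h 0 \<and> jet_eq m (deriv f) (deriv h)"
proof -
  have "(deriv ^^ Suc a) f = (deriv ^^ a) (deriv f)" for a and f :: "real \<Rightarrow> real"
    by (simp only: funpow_Suc_right o_apply)
  then show ?thesis unfolding jet_eq_def
    by (metis Suc_le_mono funpow_0 le0 not0_implies_Suc)
qed

lemma jet_eq_cong:
  assumes "\<And>t. \<bar>t\<bar> < \<epsilon> \<Longrightarrow> f t = f' t" "\<And>t. \<bar>t\<bar> < \<epsilon> \<Longrightarrow> h t = h' t" "\<epsilon> > 0"
  shows "jet_eq m f h \<longleftrightarrow> jet_eq m f' h'"
proof -
  have "(deriv ^^ a) f 0 = (deriv ^^ a) f' 0" "(deriv ^^ a) h 0 = (deriv ^^ a) h' 0" for a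
    using higher_deriv_cong_ivl[of \<epsilon> f f' 0 a] higher_deriv_cong_ivl[of \<epsilon> h h' 0 a] assms by auto
  then show ?thesis unfolding jet_eq_def by simp
qed

lemma deriv_add_ivl:
  assumes "smooth_ivl \<epsilon> f" "smooth_ivl \<epsilon> h" "\<bar>t\<bar> < \<epsilon>"
  shows "deriv (\<lambda>t. f t + h t) t = deriv f t + deriv h t"
  by (rule DERIV_imp_deriv, rule DERIV_add[OF smooth_ivl_DERIV[OF assms(1,3)] smooth_ivl_DERIV[OF assms(2,3)]])

lemma deriv_mult_ivl:
  assumes "smooth_ivl \<epsilon> f" "smooth_ivl \<epsilon> h" "\<bar>t\<bar> < \<epsilon>"
  shows "deriv (\<lambda>t. f t * h t) t = deriv f t * h t + f t * deriv h t"
  by (rule DERIV_imp_deriv, rule DERIV_cong[OF DERIV_mult[OF smooth_ivl_DERIV[OF assms(1,3)] smooth_ivl_DERIV[OF assms(2,3)]]])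
    simp

lemma jet_eq_add:
  assumes "\<epsilon> > 0"
  shows "smooth_ivl \<epsilon> f \<Longrightarrow> smooth_ivl \<epsilon> f' \<Longrightarrow> smooth_ivl \<epsilon> h \<Longrightarrow> smooth_ivl \<epsilon> h' \<Longrightarrow>
    jet_eq m f f' \<Longrightarrow> jet_eq m h h' \<Longrightarrow> jet_eq m (\<lambda>t. f t + h t) (\<lambda>t. f' t + h' t)"
proof (induction m arbitrary: f f' h h')
  case 0 then show ?case by (simp add: jet_eq_zero)
next
  case (Suc m)
  have "jet_eq m (\<lambda>t. deriv f t + deriv h t) (\<lambda>t. deriv f' t + deriv h' t)"
    using Suc by (intro Suc.IH smooth_ivl_deriv) (auto simp: jet_eq_Suc)
  then have "jet_eq m (deriv (\<lambda>t. f t + h t)) (deriv (\<lambda>t. f' t + h' t))"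
    by (subst jet_eq_cong[OF deriv_add_ivl deriv_add_ivl assms]) (use Suc.prems in auto)
  then show ?case using Suc.prems by (simp add: jet_eq_Suc)
qed

lemma jet_eq_mult:
  assumes "\<epsilon> > 0"
  shows "smooth_ivl \<epsilon> f \<Longrightarrow> smooth_ivl \<epsilon> f' \<Longrightarrow> smooth_ivl \<epsilon> h \<Longrightarrow> smooth_ivl \<epsilon> h' \<Longrightarrow>
    jet_eq m f f' \<Longrightarrow> jet_eq m h h' \<Longrightarrow> jet_eq m (\<lambda>t. f t * h t) (\<lambda>t. f' t * h' t)"
proof (induction m arbitrary: f f' h h')
  case 0 then show ?case by (simp add: jet_eq_zero)
next
  case (Suc m)
  have "jet_eq m (\<lambda>t. deriv f t * h t + f t * deriv h t) (\<lambda>t. deriv f' t * h' t + f' t * deriv h' t)"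
    using Suc by (intro jet_eq_add[OF assms] Suc.IH smooth_ivl_mult smooth_ivl_deriv)
      (auto simp: jet_eq_Suc intro: jet_eq_mono[of "Suc m"])
  then have "jet_eq m (deriv (\<lambda>t. f t * h t)) (deriv (\<lambda>t. f' t * h' t))"
    by (subst jet_eq_cong[OF deriv_mult_ivl deriv_mult_ivl assms]) (use Suc.prems in auto)
  then show ?case using Suc.prems by (simp add: jet_eq_Suc)
qed

lemma jet_eq_sum:
  assumes "\<epsilon> > 0"
    and "\<And>a. a \<in> A \<Longrightarrow> smooth_ivl \<epsilon> (f a)" "\<And>a. a \<in> A \<Longrightarrow> smooth_ivl \<epsilon> (f' a)"
    and "\<And>a. a \<in> A \<Longrightarrow> jet_eq m (f a) (f' a)"
  shows "jet_eq m (\<lambda>t. \<Sum>a\<in>A. f a t) (\<lambda>t. \<Sum>a\<in>A. f' a t)"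
  using assms(2-4)
proof (induction A rule: infinite_finite_induct)
  case (insert a A)
  then have "jet_eq m (\<lambda>t. f a t + (\<Sum>a\<in>A. f a t)) (\<lambda>t. f' a t + (\<Sum>a\<in>A. f' a t))"
    by (intro jet_eq_add[OF assms(1)] smooth_ivl_sum) auto
  then show ?case using insert.hyps by simp
qed (simp_all add: jet_eq_refl)

lemma deriv_compose_ivl:
  assumes "finite I" "openin (powertop_real I) S" "smooth_on_coords I S F"
    and "\<And>t. \<bar>t\<bar> < \<epsilon> \<Longrightarrow> g t \<in> S" "\<And>i. i \<in> I \<Longrightarrow> smooth_ivl \<epsilon> (\<lambda>t. g t i)" "\<bar>t\<bar> < \<epsilon>"
  shows "deriv (\<lambda>t. F (g t)) t = (\<Sum>i\<in>I. partial i F (g t) * deriv (\<lambda>t. g t i) t)"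
proof (rule DERIV_imp_deriv, rule chain_rule_smooth[OF assms(1-3)])
  show "\<forall>\<^sub>F t in nhds t. g t \<in> extensional I"
    by (rule eventually_mono[OF eventually_abs_less[OF assms(6)]])
      (use assms(4) openin_powertop_subset[OF assms(2)] in blast)
  show "((\<lambda>t. g t i) has_real_derivative deriv (\<lambda>t. g t i) t) (at t)" if "i \<in> I" for i
    using smooth_ivl_DERIV[OF assms(5)[OF that] assms(6)] .
qed (use assms(4,6) in auto)

text \<open>One differentiation replaces \<open>F\<close> by its partial derivatives and keeps the
  curves, so an induction over the order for all smooth \<open>F\<close> at once avoids a formula
  for the higher derivatives of a composite.\<close>

lemma jet_eq_compose:
  assumes e: "\<epsilon> > 0" and I: "finite I" and S: "openin (powertop_real I) S"
    and c: "\<And>t. \<bar>t\<bar> < \<epsilon> \<Longrightarrow> c t \<in> S" "\<And>i. i \<in> I \<Longrightarrow> smooth_ivl \<epsilon> (\<lambda>t. c t i)"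
    and d: "\<And>t. \<bar>t\<bar> < \<epsilon> \<Longrightarrow> d t \<in> S" "\<And>i. i \<in> I \<Longrightarrow> smooth_ivl \<epsilon> (\<lambda>t. d t i)"
  shows "smooth_on_coords I S F \<Longrightarrow> (\<And>i. i \<in> I \<Longrightarrow> jet_eq m (\<lambda>t. c t i) (\<lambda>t. d t i)) \<Longrightarrow>
    jet_eq m (\<lambda>t. F (c t)) (\<lambda>t. F (d t))"
proof (induction m arbitrary: F)
  \<comment> \<open>Contact gives equality at the indices in \<open>I\<close>; outside
    \<open>I\<close> both points have the default value, as members of \<open>S\<close> are
    extensional.\<close>
  have cd: "c 0 = d 0" if "\<And>i. i \<in> I \<Longrightarrow> jet_eq m (\<lambda>t. c t i) (\<lambda>t. d t i)" for m
    using that[THEN jet_eq_0] c(1)[of 0] d(1)[of 0] e openin_powertop_subset[OF S]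
    by (intro extensionalityI[of _ I]) auto
  {
    case 0 then show ?case using cd[OF 0(2)] by (simp add: jet_eq_zero)
  next
    case (Suc m)
    have "jet_eq m (\<lambda>t. \<Sum>i\<in>I. partial i F (c t) * deriv (\<lambda>t. c t i) t) (\<lambda>t. \<Sum>i\<in>I. partial i F (d t) * deriv (\<lambda>t. d t i) t)"
    proof (intro jet_eq_sum[OF e] jet_eq_mult[OF e] smooth_ivl_mult smooth_ivl_deriv c d)
      fix i assume i: "i \<in> I"
      have p: "smooth_on_coords I S (partial i F)" using Suc.prems(1) i by (rule smooth_on_coords_partial)
      show "smooth_ivl \<epsilon> (\<lambda>t. partial i F (c t))" "smooth_ivl \<epsilon> (\<lambda>t. partial i F (d t))"
        by (rule smooth_ivl_compose[OF I S p], use c d in auto)+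
      then show "smooth_ivl \<epsilon> (\<lambda>t. partial i F (c t))" "smooth_ivl \<epsilon> (\<lambda>t. partial i F (d t))" .
      show "jet_eq m (\<lambda>t. partial i F (c t)) (\<lambda>t. partial i F (d t))"
        by (rule Suc.IH[OF p]) (use Suc.prems(2) jet_eq_mono in force)
      show "jet_eq m (deriv (\<lambda>t. c t i)) (deriv (\<lambda>t. d t i))"
        using Suc.prems(2)[OF i] by (simp add: jet_eq_Suc)
    qed
    then have "jet_eq m (deriv (\<lambda>t. F (c t))) (deriv (\<lambda>t. F (d t)))"
      by (subst jet_eq_cong[OF deriv_compose_ivl[OF I S Suc.prems(1) c] deriv_compose_ivl[OF I S Suc.prems(1) d] e]) auto
    then show ?case using cd[OF Suc.prems(2)] by (simp add: jet_eq_Suc)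
  }
qed

section \<open>Atlases and smooth maps\<close>

text \<open>Hausdorffness and second countability are left out so that \<open>jet_mfd M k\<close> and its tangent bundle
  qualify as well.\<close>

locale atlas =
  fixes M :: "('p, 'i) mfd"
  assumes finite_index: "finite (index M)"
    and points_eq: "(\<Union>(U, \<phi>)\<in>charts M. U) = points M"
    and chart_inj: "(U, \<phi>) \<in> charts M \<Longrightarrow> inj_on \<phi> U"
    and chart_open: "(U, \<phi>) \<in> charts M \<Longrightarrow> openin (powertop_real (index M)) (\<phi> ` U)"
    and overlap_open: "(U, \<phi>) \<in> charts M \<Longrightarrow> (V, \<psi>) \<in> charts M \<Longrightarrow>
      openin (powertop_real (index M)) (\<phi> ` (U \<inter> V))"
    and transition_smooth: "(U, \<phi>) \<in> charts M \<Longrightarrow> (V, \<psi>) \<in> charts M \<Longrightarrow> j \<in> index M \<Longrightarrow>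
      smooth_on_coords (index M) (\<phi> ` (U \<inter> V)) (\<lambda>x. \<psi> (inv_into U \<phi> x) j)"

lemma smooth_manifold_imp_atlas: "smooth_manifold M \<Longrightarrow> atlas M"
  unfolding smooth_manifold_def by unfold_locales (simp_all, fast+)

context atlas begin

lemma chart_subset_points: "(U, \<phi>) \<in> charts M \<Longrightarrow> U \<subseteq> points M"
  using points_eq by blast

lemma obtain_chart:
  assumes "p \<in> points M" obtains U \<phi> where "(U, \<phi>) \<in> charts M" "p \<in> U"
  using assms points_eq by blast

lemma chart_inv [simp]: "(U, \<phi>) \<in> charts M \<Longrightarrow> p \<in> U \<Longrightarrow> inv_into U \<phi> (\<phi> p) = p"
  using chart_inj by simp

lemma chart_extensional: "(U, \<phi>) \<in> charts M \<Longrightarrow> p \<in> U \<Longrightarrow> \<phi> p \<in> extensional (index M)"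
  using openin_powertop_subset[OF chart_open] by blast

lemma chart_inj_eq: "(U, \<phi>) \<in> charts M \<Longrightarrow> p \<in> U \<Longrightarrow> q \<in> U \<Longrightarrow> \<phi> p = \<phi> q \<Longrightarrow> p = q"
  using chart_inj by (meson inj_onD)

lemma openin_iff: "openin (mfd_topology M) W \<longleftrightarrow> W \<subseteq> points M \<and>
     (\<forall>(U, \<phi>)\<in>charts M. openin (powertop_real (index M)) (\<phi> ` (W \<inter> U)))"
  by (rule openin_mfd_topology) (rule chart_inj)

lemma openin_chart_image:
  "openin (mfd_topology M) W \<Longrightarrow> (U, \<phi>) \<in> charts M \<Longrightarrow> openin (powertop_real (index M)) (\<phi> ` (W \<inter> U))"
  unfolding openin_iff by blast

text \<open>In any other chart the image of \<open>W\<close> is the preimage, under a transition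
  map, of its image in the given chart, and transition maps are continuous.\<close>

lemma chart_subset_openin:
  assumes U: "(U, \<phi>) \<in> charts M" and W: "W \<subseteq> U" "openin (powertop_real (index M)) (\<phi> ` W)"
  shows "openin (mfd_topology M) W"
  unfolding openin_iff
proof (intro conjI ballI)
  show "W \<subseteq> points M" using W chart_subset_points[OF U] by blast
  have "openin (powertop_real (index M)) (\<psi> ` (W \<inter> V))" if V: "(V, \<psi>) \<in> charts M" for V \<psi>
  proof -
    have "openin (powertop_real (index M)) {y \<in> \<psi> ` (V \<inter> U). \<phi> (inv_into V \<psi> y) \<in> \<phi> ` W}"
    proof (rule openin_preimage_coords[OF overlap_open[OF V U] W(2)])
      show "\<phi> (inv_into V \<psi> y) \<in> extensional (index M)" if "y \<in> \<psi> ` (V \<inter> U)" for y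
        using that V U chart_extensional[OF U] by auto
      show "smooth_on_coords (index M) (\<psi> ` (V \<inter> U)) (\<lambda>y. \<phi> (inv_into V \<psi> y) j)" if "j \<in> index M" for j
        using transition_smooth[OF V U that] .
    qed
    moreover have "{y \<in> \<psi> ` (V \<inter> U). \<phi> (inv_into V \<psi> y) \<in> \<phi> ` W} = \<psi> ` (W \<inter> V)"
      using V W(1) chart_inj_eq[OF U] by (auto simp: image_iff) (metis IntI chart_inv subset_iff)+
    ultimately show ?thesis by simp
  qed
  then show "case x of (V, \<psi>) \<Rightarrow> openin (powertop_real (index M)) (\<psi> ` (W \<inter> V))" if "x \<in> charts M" for x
    using that by auto
qed

lemma chart_openin: "(U, \<phi>) \<in> charts M \<Longrightarrow> openin (mfd_topology M) U"
  using chart_subset_openin chart_open by blast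

end

text \<open>The definition of smoothness supplies some pair of charts at each point. Transition maps
  on the source and then on the target carry the coordinate expression to any prescribed pair, on a
  smaller neighbourhood.\<close>

lemma smooth_map_on_charts:
  assumes M: "atlas M" and N: "atlas N" and f: "smooth_map_on M N A f" and p: "p \<in> A"
    and U: "(U, \<phi>) \<in> charts M" "p \<in> U" and V: "(V, \<psi>) \<in> charts N" "f p \<in> V"
  obtains W where "openin (mfd_topology M) W" "p \<in> W" "W \<subseteq> A \<inter> U" "f ` W \<subseteq> V"
    "openin (powertop_real (index M)) (\<phi> ` W)"
    "\<And>j. j \<in> index N \<Longrightarrow> smooth_on_coords (index M) (\<phi> ` W) (\<lambda>x. \<psi> (f (inv_into U \<phi> x)) j)"
proof -
  interpret M: atlas M by (rule M)
  interpret N: atlas N by (rule N)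
  from f p obtain U' \<phi>' V' \<psi>' W' where U': "(U', \<phi>') \<in> charts M" and V': "(V', \<psi>') \<in> charts N"
    and W': "openin (mfd_topology M) W'" "p \<in> W'" "W' \<subseteq> A \<inter> U'" "f ` W' \<subseteq> V'"
    and sm: "\<And>j. j \<in> index N \<Longrightarrow> smooth_on_coords (index M) (\<phi>' ` W') (\<lambda>x. \<psi>' (f (inv_into U' \<phi>' x)) j)"
    unfolding smooth_map_on_def by fast
  define T0 where "T0 = \<phi> ` (W' \<inter> U)"
  have T0: "openin (powertop_real (index M)) T0" unfolding T0_def by (rule M.openin_chart_image[OF W'(1) U(1)])
  have W'im: "openin (powertop_real (index M)) (\<phi>' ` W')"
    using M.openin_chart_image[OF W'(1) U'] W'(3) by (simp add: Int_absorb2)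
  define G where "G x = \<psi>' (f (inv_into U \<phi> x))" for x
  have G: "smooth_on_coords (index M) T0 (\<lambda>x. G x j)" if j: "j \<in> index N" for j
  proof -
    have "smooth_on_coords (index M) T0 (\<lambda>x. \<psi>' (f (inv_into U' \<phi>' (\<phi>' (inv_into U \<phi> x)))) j)"
    proof (rule smooth_on_coords_compose[OF M.finite_index W'im T0 _ sm[OF j]])
      show "\<phi>' (inv_into U \<phi> y) \<in> \<phi>' ` W'" if "y \<in> T0" for y using that U(1) by (auto simp: T0_def)
      show "smooth_on_coords (index M) T0 (\<lambda>y. \<phi>' (inv_into U \<phi> y) i)" if "i \<in> index M" for i
        by (rule smooth_on_coords_subset[OF M.transition_smooth[OF U(1) U' that]])
          (use W'(3) in \<open>auto simp: T0_def\<close>)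
    qed
    then show ?thesis
    proof (rule smooth_on_coords_cong[OF T0])
      fix x assume "x \<in> T0"
      then obtain q where q: "q \<in> W'" "q \<in> U" "x = \<phi> q" by (auto simp: T0_def)
      then have "q \<in> U'" using W'(3) by blast
      then show "\<psi>' (f (inv_into U' \<phi>' (\<phi>' (inv_into U \<phi> x)))) j = G x j"
        using q U(1) U' by (simp add: G_def)
    qed
  qed
  have Gext: "G x \<in> extensional (index N)" if "x \<in> T0" for x
    using that U(1) W'(4) N.chart_extensional[OF V'] by (auto simp: T0_def G_def)
  \<comment> \<open>The points of \<open>W'\<close> in both source charts that are mapped into
    \<open>V\<close>; their chart image is the preimage under \<open>G\<close> of the overlap of the
    target charts, hence open.\<close>
  define W where "W = {q \<in> W' \<inter> U. f q \<in> V}"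
  have eq: "\<phi> ` W = {x \<in> T0. G x \<in> \<psi>' ` (V' \<inter> V)}"
  proof (intro set_eqI iffI)
    fix x assume "x \<in> \<phi> ` W"
    then show "x \<in> {x \<in> T0. G x \<in> \<psi>' ` (V' \<inter> V)}"
      using U(1) W'(4) by (auto simp: W_def T0_def G_def)
  next
    fix x assume x: "x \<in> {x \<in> T0. G x \<in> \<psi>' ` (V' \<inter> V)}"
    then obtain q where q: "q \<in> W'" "q \<in> U" "x = \<phi> q" by (auto simp: T0_def)
    obtain r where r: "r \<in> V'" "r \<in> V" "\<psi>' (f q) = \<psi>' r"
      using x q U(1) by (auto simp: G_def)
    have "f q = r" using N.chart_inj_eq[OF V' _ r(1) r(3)] q W'(4) by blast
    then show "x \<in> \<phi> ` W" using q r by (auto simp: W_def)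
  qed
  have op: "openin (powertop_real (index M)) (\<phi> ` W)"
    unfolding eq by (rule openin_preimage_coords[OF T0 N.overlap_open[OF V' V(1)] Gext G])
  show ?thesis
  proof
    show "openin (mfd_topology M) W"
      by (rule M.chart_subset_openin[OF U(1) _ op]) (auto simp: W_def)
    show "p \<in> W" "W \<subseteq> A \<inter> U" "f ` W \<subseteq> V" using W' U V by (auto simp: W_def)
    show "openin (powertop_real (index M)) (\<phi> ` W)" by (rule op)
    fix j assume j: "j \<in> index N"
    have "smooth_on_coords (index M) (\<phi> ` W) (\<lambda>x. \<psi> (inv_into V' \<psi>' (G x)) j)"
    proof (rule smooth_on_coords_compose[OF N.finite_index N.overlap_open[OF V' V(1)] op _ N.transition_smooth[OF V' V(1) j]])
      show "G y \<in> \<psi>' ` (V' \<inter> V)" if "y \<in> \<phi> ` W" for y using that unfolding eq by blast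
      show "smooth_on_coords (index M) (\<phi> ` W) (\<lambda>y. G y i)" if "i \<in> index N" for i
        by (rule smooth_on_coords_subset[OF G[OF that]]) (auto simp: eq)
    qed
    then show "smooth_on_coords (index M) (\<phi> ` W) (\<lambda>x. \<psi> (f (inv_into U \<phi> x)) j)"
    proof (rule smooth_on_coords_cong[OF op])
      fix x assume "x \<in> \<phi> ` W"
      then obtain q where q: "q \<in> W'" "q \<in> U" "x = \<phi> q" by (auto simp: W_def)
      then show "\<psi> (inv_into V' \<psi>' (G x)) j = \<psi> (f (inv_into U \<phi> x)) j"
        using U(1) V' W'(4) by (auto simp: G_def image_subset_iff)
    qed
  qed
qed

section \<open>Coordinate spaces as manifolds\<close>

lemma inv_into_id: "x \<in> A \<Longrightarrow> inv_into A (\<lambda>x. x) x = x"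
  by (rule inv_into_f_f) auto

lemma coord_space_sel [simp]:
  "points (coord_space I) = extensional I" "index (coord_space I) = I"
  "charts (coord_space I) = {(extensional I, \<lambda>x. x)}"
  by (simp_all add: coord_space_def)

lemma openin_extensional: "openin (powertop_real I) (extensional I)"
  using openin_topspace[of "powertop_real I"] by simp

lemma atlas_coord_space:
  assumes "finite I" shows "atlas (coord_space I)"
proof
  fix U V :: "('a \<Rightarrow> real) set" and \<phi> \<psi> j
  assume "(U, \<phi>) \<in> charts (coord_space I)" "(V, \<psi>) \<in> charts (coord_space I)" "j \<in> index (coord_space I)"
  then have e: "U = extensional I" "V = extensional I" "\<phi> = (\<lambda>x. x)" "\<psi> = (\<lambda>x. x)" "j \<in> I" by auto
  have "smooth_on_coords I (extensional I) (\<lambda>x. inv_into (extensional I) (\<lambda>x. x) x j)"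
    by (rule smooth_on_coords_cong[OF openin_extensional smooth_on_coords_proj[OF e(5)]])
      (simp add: inv_into_id)
  then show "smooth_on_coords (index (coord_space I)) (\<phi> ` (U \<inter> V)) (\<lambda>x. \<psi> (inv_into U \<phi> x) j)"
    using e by simp
qed (use assms openin_extensional in auto)

lemma openin_coord_space: "openin (mfd_topology (coord_space I)) W \<longleftrightarrow> openin (powertop_real I) W"
proof -
  have "openin (mfd_topology (coord_space I)) W \<longleftrightarrow> W \<subseteq> extensional I \<and> openin (powertop_real I) (W \<inter> extensional I)"
    by (subst openin_mfd_topology) auto
  then show ?thesis using openin_powertop_subset[of I W] by (auto simp: Int_absorb2)
qed

text \<open>Strips off the identity chart of the coordinate space, whose inverse
  \<open>inv_into\<close> is controlled only on \<open>extensional J\<close>; curves and families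
  then become plain smooth functions of their parameters.\<close>

lemma (in atlas) smooth_map_from_coords:
  assumes J: "finite J" and f: "smooth_map_on (coord_space J) M A f" "y \<in> A" "A \<subseteq> extensional J"
    and U: "(U, \<phi>) \<in> charts M" "f y \<in> U"
  obtains W where "openin (powertop_real J) W" "y \<in> W" "W \<subseteq> A" "f ` W \<subseteq> U"
    "\<And>j. j \<in> index M \<Longrightarrow> smooth_on_coords J W (\<lambda>x. \<phi> (f x) j)"
proof -
  have "y \<in> extensional J" using f by blast
  then obtain W where W: "openin (mfd_topology (coord_space J)) W" "y \<in> W" "W \<subseteq> A \<inter> extensional J" "f ` W \<subseteq> U"
    "\<And>j. j \<in> index M \<Longrightarrow> smooth_on_coords J ((\<lambda>x. x) ` W) (\<lambda>x. \<phi> (f (inv_into (extensional J) (\<lambda>x. x) x)) j)"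
    using smooth_map_on_charts[of "coord_space J" M A f y "extensional J" "\<lambda>x. x" U \<phi>]
      atlas_coord_space[OF J] atlas_axioms f(1,2) U
    by (simp del: image_ident) metis
  have op: "openin (powertop_real J) W" using W(1) by (simp add: openin_coord_space)
  have "smooth_on_coords J W (\<lambda>x. \<phi> (f x) j)" if "j \<in> index M" for j
  proof (rule smooth_on_coords_cong[OF op])
    show "smooth_on_coords J W (\<lambda>x. \<phi> (f (inv_into (extensional J) (\<lambda>x. x) x)) j)"
      using W(5)[OF that] by simp
    show "\<phi> (f (inv_into (extensional J) (\<lambda>x. x) x)) j = \<phi> (f x) j" if "x \<in> W" for x
      using that W(3) by (subst inv_into_id) auto
  qed
  then show ?thesis using that op W by blast
qed

lemma (in atlas) smooth_map_from_coordsI: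
  assumes "openin (powertop_real J) A" "(U, \<phi>) \<in> charts M" "f ` A \<subseteq> U"
    and sm: "\<And>j. j \<in> index M \<Longrightarrow> smooth_on_coords J A (\<lambda>x. \<phi> (f x) j)"
  shows "smooth_map_on (coord_space J) M A f"
  unfolding smooth_map_on_def
proof (intro ballI conjI)
  fix p assume p: "p \<in> A"
  show "f p \<in> points M" using assms p chart_subset_points by blast
  have A: "A \<subseteq> extensional J" using openin_powertop_subset[OF assms(1)] .
  have "smooth_on_coords J A (\<lambda>x. \<phi> (f (inv_into (extensional J) (\<lambda>x. x) x)) j)" if "j \<in> index M" for j
    by (rule smooth_on_coords_cong[OF assms(1) sm[OF that]]) (use A in \<open>simp add: inv_into_id subset_iff\<close>)
  then show "\<exists>(U, \<phi>)\<in>charts (coord_space J). \<exists>(V, \<psi>)\<in>charts M. \<exists>W.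
        openin (mfd_topology (coord_space J)) W \<and> p \<in> W \<and> W \<subseteq> A \<inter> U \<and> f ` W \<subseteq> V \<and>
        (\<forall>j\<in>index M. smooth_on_coords (index (coord_space J)) (\<phi> ` W) (\<lambda>x. \<psi> (f (inv_into U \<phi> x)) j))"
    using p A assms(1-3) by (force simp: openin_coord_space intro!: bexI[of _ "(U, \<phi>)"] exI[of _ A])
qed

section \<open>Curves inside a single chart\<close>

context atlas begin

text \<open>\<open>smooth_curve\<close> offers a chart at each point of the curve. Confinement to
  one chart over a symmetric interval makes the coordinate calculus available at all small times, as
  iterated derivatives require.\<close>

definition curve_in :: "'p set \<Rightarrow> ('p \<Rightarrow> 'i \<Rightarrow> real) \<Rightarrow> real \<Rightarrow> (real \<Rightarrow> 'p) \<Rightarrow> bool" where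
  "curve_in U \<phi> \<epsilon> c \<longleftrightarrow> \<epsilon> > 0 \<and> (\<forall>t. \<bar>t\<bar> < \<epsilon> \<longrightarrow> c t \<in> U) \<and> (\<forall>i\<in>index M. smooth_ivl \<epsilon> (\<lambda>t. \<phi> (c t) i))"

lemma curve_in_0: "curve_in U \<phi> \<epsilon> c \<Longrightarrow> c 0 \<in> U"
  unfolding curve_in_def by simp

lemma smooth_curve_chart:
  assumes c: "smooth_curve M c" and U: "(U, \<phi>) \<in> charts M" "c 0 \<in> U"
  obtains \<epsilon> where "curve_in U \<phi> \<epsilon> c"
proof -
  obtain e where e: "e > 0" "smooth_map_on (coord_space (UNIV :: unit set)) M {x. \<bar>x ()\<bar> < e} (\<lambda>x. c (x ()))"
    using c unfolding smooth_curve_def by blast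
  obtain W where W: "openin (powertop_real (UNIV :: unit set)) W" "(\<lambda>_. 0) \<in> W" "(\<lambda>x. c (x ())) ` W \<subseteq> U"
    "\<And>j. j \<in> index M \<Longrightarrow> smooth_on_coords UNIV W (\<lambda>x. \<phi> (c (x ())) j)"
    using smooth_map_from_coords[of UNIV "{x. \<bar>x ()\<bar> < e}" "\<lambda>x. c (x ())" "\<lambda>_. 0" U \<phi>] e U
    by (simp add: extensional_def) metis
  obtain d where d: "d > 0" "\<And>t. \<bar>t\<bar> < d \<Longrightarrow> (\<lambda>_. t) \<in> W"
    using openin_powertop_unit_0[OF W(1,2)] by blast
  have sub: "{x :: unit \<Rightarrow> real. \<bar>x ()\<bar> < d} \<subseteq> W"
  proof
    fix x :: "unit \<Rightarrow> real" assume "x \<in> {x. \<bar>x ()\<bar> < d}"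
    moreover have "x = (\<lambda>_. x ())" by auto
    ultimately show "x \<in> W" using d(2)[of "x ()"] by auto
  qed
  have "curve_in U \<phi> d c"
    unfolding curve_in_def smooth_ivl_def
  proof (intro conjI allI impI ballI)
    show "c t \<in> U" if "\<bar>t\<bar> < d" for t using d(2)[OF that] W(3) by force
    show "smooth_on_coords UNIV {x. \<bar>x ()\<bar> < d} (\<lambda>x. \<phi> (c (x ())) i)" if "i \<in> index M" for i
      using smooth_on_coords_subset[OF W(4)[OF that] sub] .
  qed (rule d)
  then show ?thesis by (rule that)
qed

lemma curve_in_smooth_curve:
  assumes "(U, \<phi>) \<in> charts M" "curve_in U \<phi> \<epsilon> c"
  shows "smooth_curve M c"
  unfolding smooth_curve_def
  using assms by (intro exI[of _ \<epsilon>] conjI smooth_map_from_coordsI[OF openin_unit_ivl assms(1)])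
    (auto simp: curve_in_def smooth_ivl_def)

lemma smooth_curve_points: "smooth_curve M c \<Longrightarrow> c 0 \<in> points M"
  unfolding smooth_curve_def smooth_map_on_def by force

lemma obtain_curve_chart:
  assumes "smooth_curve M c"
  obtains U \<phi> \<epsilon> where "(U, \<phi>) \<in> charts M" "curve_in U \<phi> \<epsilon> c"
  using obtain_chart[OF smooth_curve_points[OF assms]] smooth_curve_chart[OF assms] by metis

lemma curve_in_shrink:
  assumes c: "curve_in U \<phi> \<epsilon> c" and U: "(U, \<phi>) \<in> charts M"
    and V: "V \<subseteq> U" "openin (powertop_real (index M)) (\<phi> ` V)" "c 0 \<in> V"
  obtains \<delta> where "0 < \<delta>" "\<delta> \<le> \<epsilon>" "\<And>t. \<bar>t\<bar> < \<delta> \<Longrightarrow> c t \<in> V"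
proof -
  have c': "\<epsilon> > 0" "\<And>t. \<bar>t\<bar> < \<epsilon> \<Longrightarrow> c t \<in> U" "\<And>i. i \<in> index M \<Longrightarrow> smooth_ivl \<epsilon> (\<lambda>t. \<phi> (c t) i)"
    using c by (auto simp: curve_in_def)
  have e: "\<phi> (c t) \<in> extensional (index M)" if "\<bar>t\<bar> < \<epsilon>" for t
    using chart_extensional[OF U c'(2)[OF that]] .
  have "\<phi> (c 0) \<in> \<phi> ` V" using V(3) by blast
  from smooth_ivl_open_preimage[where g = "\<lambda>t. \<phi> (c t)", OF finite_index V(2) this c'(1) e c'(3)]
  obtain \<delta> where d: "0 < \<delta>" "\<delta> \<le> \<epsilon>" "\<And>t. \<bar>t\<bar> < \<delta> \<Longrightarrow> \<phi> (c t) \<in> \<phi> ` V" by blast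
  have "c t \<in> V" if "\<bar>t\<bar> < \<delta>" for t
  proof -
    from d(3)[OF that] obtain v where v: "v \<in> V" "\<phi> (c t) = \<phi> v" by blast
    have "c t \<in> U" using c'(2)[of t] that d(2) by linarith
    then have "c t = v" using chart_inj_eq[OF U _ _ v(2)] v(1) V(1) by blast
    then show ?thesis using v by simp
  qed
  then show ?thesis using that d by blast
qed

lemma curve_transition:
  assumes c: "curve_in U \<phi> \<epsilon> c" and U: "(U, \<phi>) \<in> charts M" and V: "(V, \<psi>) \<in> charts M" "c 0 \<in> V"
  obtains \<delta> where "0 < \<delta>" "\<delta> \<le> \<epsilon>" "\<And>t. \<bar>t\<bar> < \<delta> \<Longrightarrow> c t \<in> U \<inter> V"
    "\<And>t. \<bar>t\<bar> < \<delta> \<Longrightarrow> \<phi> (c t) \<in> \<phi> ` (U \<inter> V)"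
    "\<And>t j. \<bar>t\<bar> < \<delta> \<Longrightarrow> \<psi> (inv_into U \<phi> (\<phi> (c t))) j = \<psi> (c t) j"
proof -
  obtain \<delta> where d: "0 < \<delta>" "\<delta> \<le> \<epsilon>" "\<And>t. \<bar>t\<bar> < \<delta> \<Longrightarrow> c t \<in> U \<inter> V"
    using curve_in_shrink[OF c U _ overlap_open[OF U V(1)]] curve_in_0[OF c] V(2) by blast
  show ?thesis
  proof (rule that[OF d])
    show "\<phi> (c t) \<in> \<phi> ` (U \<inter> V)" if "\<bar>t\<bar> < \<delta>" for t using d(3)[OF that] by blast
    show "\<psi> (inv_into U \<phi> (\<phi> (c t))) j = \<psi> (c t) j" if "\<bar>t\<bar> < \<delta>" for t j
      using d(3)[OF that] U by simp
  qed
qed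

text \<open>Near 0 the \<psi>-coordinates of both curves are the transition map applied to their
  \<phi>-coordinates, and composition with a smooth map preserves contact.\<close>

lemma jet_eq_change_chart:
  assumes U: "(U, \<phi>) \<in> charts M" and V: "(V, \<psi>) \<in> charts M"
    and c: "smooth_curve M c" "c 0 \<in> U" "c 0 \<in> V" and d: "smooth_curve M d" "d 0 = c 0"
    and eq: "\<And>i. i \<in> index M \<Longrightarrow> jet_eq m (\<lambda>t. \<phi> (c t) i) (\<lambda>t. \<phi> (d t) i)" and j: "j \<in> index M"
  shows "jet_eq m (\<lambda>t. \<psi> (c t) j) (\<lambda>t. \<psi> (d t) j)"
proof -
  obtain e1 where e1: "curve_in U \<phi> e1 c" using smooth_curve_chart[OF c(1) U c(2)] by blast
  obtain d1 where d1: "0 < d1" "d1 \<le> e1" "\<And>t. \<bar>t\<bar> < d1 \<Longrightarrow> \<phi> (c t) \<in> \<phi> ` (U \<inter> V)"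
    "\<And>t j. \<bar>t\<bar> < d1 \<Longrightarrow> \<psi> (inv_into U \<phi> (\<phi> (c t))) j = \<psi> (c t) j"
    using curve_transition[OF e1 U V c(3)] by metis
  obtain e2 where e2: "curve_in U \<phi> e2 d" using smooth_curve_chart[OF d(1) U] c(2) d(2) by auto
  obtain d2 where d2: "0 < d2" "d2 \<le> e2" "\<And>t. \<bar>t\<bar> < d2 \<Longrightarrow> \<phi> (d t) \<in> \<phi> ` (U \<inter> V)"
    "\<And>t j. \<bar>t\<bar> < d2 \<Longrightarrow> \<psi> (inv_into U \<phi> (\<phi> (d t))) j = \<psi> (d t) j"
    using curve_transition[OF e2 U V] c(3) d(2) by metis
  define \<epsilon> where "\<epsilon> = min d1 d2"
  have e: "\<epsilon> > 0" "\<epsilon> \<le> d1" "\<epsilon> \<le> d2" "\<epsilon> \<le> e1" "\<epsilon> \<le> e2" using d1 d2 by (auto simp: \<epsilon>_def)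
  have "jet_eq m (\<lambda>t. \<psi> (inv_into U \<phi> (\<phi> (c t))) j) (\<lambda>t. \<psi> (inv_into U \<phi> (\<phi> (d t))) j)"
  proof (rule jet_eq_compose[OF e(1) finite_index overlap_open[OF U V] _ _ _ _ transition_smooth[OF U V j] eq])
    show "\<phi> (c t) \<in> \<phi> ` (U \<inter> V)" "\<phi> (d t) \<in> \<phi> ` (U \<inter> V)" if "\<bar>t\<bar> < \<epsilon>" for t
      using d1(3)[of t] d2(3)[of t] that e by auto
    show "smooth_ivl \<epsilon> (\<lambda>t. \<phi> (c t) i)" "smooth_ivl \<epsilon> (\<lambda>t. \<phi> (d t) i)" if "i \<in> index M" for i
      using e1 e2 that smooth_ivl_mono e by (auto simp: curve_in_def)
  qed
  then show ?thesis
    using d1(4) d2(4) e by (subst (asm) jet_eq_cong[where \<epsilon> = \<epsilon>]) auto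
qed

end

section \<open>Jets of curves\<close>

text \<open>The coordinate \<open>None\<close> plays the role of time:
  \<open>case_option 0 y\<close> is the point with parameters \<open>y\<close> at time 0, so what is
  smooth in time and parameters jointly may be evaluated at time 0.\<close>

lemma smooth_on_coords_slice:
  assumes P: "finite P" and T: "openin (powertop_real (insert None (Some ` P))) T"
    and H: "smooth_on_coords (insert None (Some ` P)) T H"
  shows "openin (powertop_real P) {y \<in> extensional P. case_option 0 y \<in> T}"
    and "smooth_on_coords P {y \<in> extensional P. case_option 0 y \<in> T} (\<lambda>y. H (case_option 0 y))"
proof -
  have c: "smooth_on_coords P S (\<lambda>y. case_option 0 y i)" if "i \<in> insert None (Some ` P)" for i S
    using that by (auto intro: smooth_on_coords_const smooth_on_coords_proj)
  show o: "openin (powertop_real P) {y \<in> extensional P. case_option 0 y \<in> T}"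
  proof (rule openin_preimage_coords[OF openin_extensional T _ c])
    fix y :: "'a \<Rightarrow> real" assume "y \<in> extensional P"
    then show "case_option 0 y \<in> extensional (insert None (Some ` P))"
      by (auto simp: extensional_def split: option.split)
  qed
  show "smooth_on_coords P {y \<in> extensional P. case_option 0 y \<in> T} (\<lambda>y. H (case_option 0 y))"
    by (rule smooth_on_coords_compose[OF _ T o _ H c]) (use P in auto)
qed

section \<open>Jets, their representatives and their coordinates\<close>

context atlas begin

text \<open>\<open>jet\<close> compares curves in all charts at the base point; since contact is
  preserved by a change of chart, a single chart decides whether two classes coincide.\<close>

lemma jet_cong:
  assumes c: "smooth_curve M c" and d: "smooth_curve M d" "d 0 = c 0"
    and U: "(U, \<phi>) \<in> charts M" "c 0 \<in> U"
    and eq: "\<And>i. i \<in> index M \<Longrightarrow> jet_eq k (\<lambda>t. \<phi> (c t) i) (\<lambda>t. \<phi> (d t) i)"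
  shows "jet M k c = jet M k d"
proof -
  have E: "(deriv ^^ a) (\<lambda>t. \<psi> (c t) j) 0 = (deriv ^^ a) (\<lambda>t. \<psi> (d t) j) 0"
    if "(V, \<psi>) \<in> charts M" "c 0 \<in> V" "j \<in> index M" "a \<le> k" for V \<psi> j a
    using jet_eq_change_chart[OF U(1) that(1) c U(2) that(2) d eq that(3)] that(4) unfolding jet_eq_def by blast
  have "(\<forall>(V, \<psi>)\<in>charts M. c 0 \<in> V \<longrightarrow> (\<forall>i\<in>index M. \<forall>\<alpha>\<le>k.
        (deriv ^^ \<alpha>) (\<lambda>t. \<psi> (x t) i) 0 = (deriv ^^ \<alpha>) (\<lambda>t. \<psi> (c t) i) 0)) \<longleftrightarrow>
      (\<forall>(V, \<psi>)\<in>charts M. c 0 \<in> V \<longrightarrow> (\<forall>i\<in>index M. \<forall>\<alpha>\<le>k.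
        (deriv ^^ \<alpha>) (\<lambda>t. \<psi> (x t) i) 0 = (deriv ^^ \<alpha>) (\<lambda>t. \<psi> (d t) i) 0))" for x
    by (intro ball_cong refl) (clarsimp simp: E)
  then show ?thesis unfolding jet_def d(2) by simp
qed

lemma self_mem_jet: "smooth_curve M q \<Longrightarrow> q \<in> jet M k q"
  by (simp add: jet_def)

text \<open>The control of the arbitrary choice \<open>rep\<close> starts here: its base point and
  its derivatives up to order \<open>k\<close> are those of \<open>q\<close>, whichever curve was
  picked.\<close>

lemma rep_mem_jet: "smooth_curve M q \<Longrightarrow> rep (jet M k q) \<in> jet M k q"
  unfolding rep_def using self_mem_jet someI_ex[of "\<lambda>c. c \<in> jet M k q"] by blast

lemma rep_jet_smooth: "smooth_curve M q \<Longrightarrow> smooth_curve M (rep (jet M k q))"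
  using rep_mem_jet[of q k] by (simp add: jet_def)

lemma rep_jet_0: "smooth_curve M q \<Longrightarrow> rep (jet M k q) 0 = q 0"
  using rep_mem_jet[of q k] by (simp add: jet_def)

lemma foot_jet: "smooth_curve M q \<Longrightarrow> foot (jet M k q) = q 0"
  by (simp add: foot_def rep_jet_0)

lemma rep_jet_eq:
  assumes "smooth_curve M q" "(U, \<phi>) \<in> charts M" "q 0 \<in> U" "i \<in> index M"
  shows "jet_eq k (\<lambda>t. \<phi> (rep (jet M k q) t) i) (\<lambda>t. \<phi> (q t) i)"
  using rep_mem_jet[OF assms(1), of k] assms(2-4) unfolding jet_def jet_eq_def by blast

lemma jet_rep: "smooth_curve M q \<Longrightarrow> jet M k (rep (jet M k q)) = jet M k q"
proof -
  assume q: "smooth_curve M q"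
  obtain U \<phi> \<epsilon> where U: "(U, \<phi>) \<in> charts M" "curve_in U \<phi> \<epsilon> q" using obtain_curve_chart[OF q] .
  show ?thesis
    by (rule jet_cong[OF rep_jet_smooth[OF q] q _ U(1)])
      (use rep_jet_0[OF q] curve_in_0[OF U(2)] rep_jet_eq[OF q U(1)] in auto)
qed

lemma jet_mfd_sel [simp]:
  "points (jet_mfd M k) = jet M k ` {q. smooth_curve M q}"
  "index (jet_mfd M k) = {..k} \<times> index M"
  "charts (jet_mfd M k) = (\<lambda>(U, \<phi>). ({u \<in> jet M k ` {q. smooth_curve M q}. foot u \<in> U}, jet_coord M k \<phi>)) ` charts M"
  by (simp_all add: jet_mfd_def)

lemma jet_pointsD:
  assumes "u \<in> points (jet_mfd M k)"
  shows "smooth_curve M (rep u)" "jet M k (rep u) = u" "foot u = rep u 0" "foot u \<in> points M"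
  using assms rep_jet_smooth jet_rep smooth_curve_points by (auto simp: foot_def)

lemma jet_in_points: "smooth_curve M q \<Longrightarrow> jet M k q \<in> points (jet_mfd M k)"
  by auto

lemma jet_coord_extensional: "jet_coord M k \<phi> u \<in> extensional ({..k} \<times> index M)"
  by (simp add: jet_coord_def)

lemma jet_coord_jet:
  assumes "smooth_curve M q" "(U, \<phi>) \<in> charts M" "q 0 \<in> U" "i \<in> index M" "b \<le> k"
  shows "jet_coord M k \<phi> (jet M k q) (b, i) = (deriv ^^ b) (\<lambda>t. \<phi> (q t) i) 0 / fact b"
  using rep_jet_eq[OF assms(1-4), of k] assms(4,5) by (simp add: jet_coord_def jet_eq_def)

lemma jet_coord_0:
  assumes "u \<in> points (jet_mfd M k)" "i \<in> index M"
  shows "jet_coord M k \<phi> u (0, i) = \<phi> (foot u) i"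
  using assms by (simp add: jet_coord_def foot_def)

text \<open>Coordinates of order 0 determine the base point; equality of the others is then contact
  in one chart.\<close>

lemma jet_coord_inj:
  assumes u: "u \<in> points (jet_mfd M k)" and v: "v \<in> points (jet_mfd M k)"
    and U: "(U, \<phi>) \<in> charts M" "foot u \<in> U" "foot v \<in> U"
    and eq: "\<And>i b. i \<in> index M \<Longrightarrow> b \<le> k \<Longrightarrow> jet_coord M k \<phi> u (b, i) = jet_coord M k \<phi> v (b, i)"
  shows "u = v"
proof -
  have "\<phi> (foot u) = \<phi> (foot v)"
  proof (rule extensionalityI)
    show "\<phi> (foot u) i = \<phi> (foot v) i" if "i \<in> index M" for i
      using eq[OF that, of 0] jet_coord_0[OF u that, of \<phi>] jet_coord_0[OF v that, of \<phi>] by simp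
  qed (use chart_extensional U in auto)
  then have f: "foot u = foot v" using chart_inj_eq U by blast
  have "jet M k (rep u) = jet M k (rep v)"
  proof (rule jet_cong[OF jet_pointsD(1)[OF u] jet_pointsD(1)[OF v] _ U(1)])
    show "rep v 0 = rep u 0" "rep u 0 \<in> U" using f U(2) by (auto simp: foot_def)
    show "jet_eq k (\<lambda>t. \<phi> (rep u t) i) (\<lambda>t. \<phi> (rep v t) i)" if "i \<in> index M" for i
      using eq[OF that] that by (simp add: jet_eq_def jet_coord_def)
  qed
  then show ?thesis using jet_pointsD(2) u v by simp
qed

section \<open>Polynomial curves and the charts of the jet manifold\<close>

definition base_coords :: "(nat \<times> 'i \<Rightarrow> real) \<Rightarrow> 'i \<Rightarrow> real" where
  "base_coords y = (\<lambda>i\<in>index M. y (0, i))"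

definition poly_coords :: "nat \<Rightarrow> (nat \<times> 'i \<Rightarrow> real) \<Rightarrow> real \<Rightarrow> 'i \<Rightarrow> real" where
  "poly_coords k y t = (\<lambda>i\<in>index M. \<Sum>b\<le>k. y (b, i) * t ^ b)"

text \<open>Its jet inverts the jet chart at \<open>y\<close>, so it replaces the arbitrary
  \<open>rep\<close> by a representative that depends smoothly on the jet coordinates. Where the
  polynomial leaves the chart the value is junk; only small \<open>t\<close> matter.\<close>

definition poly_curve :: "'p set \<Rightarrow> ('p \<Rightarrow> 'i \<Rightarrow> real) \<Rightarrow> nat \<Rightarrow> (nat \<times> 'i \<Rightarrow> real) \<Rightarrow> real \<Rightarrow> 'p" where
  "poly_curve U \<phi> k y t = inv_into U \<phi> (poly_coords k y t)"

lemma base_coords_extensional [simp]: "base_coords y \<in> extensional (index M)"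
  unfolding base_coords_def by (rule restrict_extensional)

lemma poly_coords_extensional [simp]: "poly_coords k y t \<in> extensional (index M)"
  unfolding poly_coords_def by (rule restrict_extensional)

lemma poly_coords_0: "poly_coords k y 0 = base_coords y"
proof -
  have "(\<Sum>b\<le>k. y (b, i) * 0 ^ b) = y (0, i)" for i
    by (simp add: power_0_left if_distrib sum.delta cong: if_cong)
  then show ?thesis by (simp add: poly_coords_def base_coords_def)
qed

lemma poly_curve_in:
  assumes U: "(U, \<phi>) \<in> charts M" and y: "base_coords y \<in> \<phi> ` U"
  obtains \<epsilon> where "curve_in U \<phi> \<epsilon> (poly_curve U \<phi> k y)"
    "\<And>t. \<bar>t\<bar> < \<epsilon> \<Longrightarrow> \<phi> (poly_curve U \<phi> k y t) = poly_coords k y t"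
proof -
  have sm: "smooth_ivl \<epsilon> (\<lambda>t. poly_coords k y t i)" if "i \<in> index M" for i \<epsilon>
    using that by (simp add: poly_coords_def)
      (intro smooth_ivl_sum smooth_ivl_mult smooth_ivl_power smooth_ivl_const smooth_ivl_id)
  have "poly_coords k y 0 \<in> \<phi> ` U" using y by (simp add: poly_coords_0)
  from smooth_ivl_open_preimage[where g = "poly_coords k y", OF finite_index chart_open[OF U] this
      zero_less_one poly_coords_extensional sm]
  obtain \<delta> where d: "0 < \<delta>" "\<delta> \<le> 1" "\<And>t. \<bar>t\<bar> < \<delta> \<Longrightarrow> poly_coords k y t \<in> \<phi> ` U" by blast
  have eq: "\<phi> (poly_curve U \<phi> k y t) = poly_coords k y t" "poly_curve U \<phi> k y t \<in> U" if "\<bar>t\<bar> < \<delta>" for t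
    using d(3)[OF that] U by (auto simp: poly_curve_def)
  have "curve_in U \<phi> \<delta> (poly_curve U \<phi> k y)"
    unfolding curve_in_def
  proof (intro conjI allI impI ballI)
    show "smooth_ivl \<delta> (\<lambda>t. \<phi> (poly_curve U \<phi> k y t) i)" if "i \<in> index M" for i
      by (rule smooth_ivl_cong[OF sm[OF that]]) (use eq in auto)
  qed (use d eq in auto)
  then show ?thesis using that eq by blast
qed

lemma poly_curve_smooth:
  assumes "(U, \<phi>) \<in> charts M" "base_coords y \<in> \<phi> ` U"
  shows "smooth_curve M (poly_curve U \<phi> k y)"
  using poly_curve_in[OF assms] curve_in_smooth_curve[OF assms(1)] by blast

lemma poly_curve_0:
  assumes "(U, \<phi>) \<in> charts M" "base_coords y \<in> \<phi> ` U"
  shows "\<phi> (poly_curve U \<phi> k y 0) = base_coords y" "poly_curve U \<phi> k y 0 \<in> U"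
  using assms by (auto simp: poly_curve_def poly_coords_0)

lemma jet_coord_poly_curve:
  assumes U: "(U, \<phi>) \<in> charts M" and y: "base_coords y \<in> \<phi> ` U" and i: "i \<in> index M" "b \<le> k"
  shows "jet_coord M k \<phi> (jet M k (poly_curve U \<phi> k y)) (b, i) = y (b, i)"
proof -
  obtain \<epsilon> where e: "curve_in U \<phi> \<epsilon> (poly_curve U \<phi> k y)"
    "\<And>t. \<bar>t\<bar> < \<epsilon> \<Longrightarrow> \<phi> (poly_curve U \<phi> k y t) = poly_coords k y t" using poly_curve_in[OF U y, of k] by blast
  have "(deriv ^^ b) (\<lambda>t. \<phi> (poly_curve U \<phi> k y t) i) 0 = (deriv ^^ b) (\<lambda>t. \<Sum>b\<le>k. y (b, i) * t ^ b) 0"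
    by (rule higher_deriv_cong_ivl[where \<epsilon> = \<epsilon>]) (use e i in \<open>auto simp: curve_in_def poly_coords_def\<close>)
  then show ?thesis
    using jet_coord_jet[OF poly_curve_smooth[OF U y] U poly_curve_0(2)[OF U y] i]
      higher_deriv_polynomial_0[OF i(2), of "\<lambda>b. y (b, i)"] by simp
qed

lemma base_coords_jet_coord:
  assumes "u \<in> points (jet_mfd M k)" "(U, \<phi>) \<in> charts M" "foot u \<in> U"
  shows "base_coords (jet_coord M k \<phi> u) = \<phi> (foot u)"
proof (rule extensionalityI)
  show "base_coords (jet_coord M k \<phi> u) i = \<phi> (foot u) i" if "i \<in> index M" for i
    using that jet_coord_0[OF assms(1) that] by (simp add: base_coords_def)
qed (use chart_extensional[OF assms(2,3)] in \<open>auto simp: base_coords_def\<close>)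

text \<open>Coordinates of positive order are unconstrained, every choice being realised by a
  polynomial curve; the image of a jet chart is thus a cylinder over the image of the chart
  below.\<close>

lemma jet_chart_image:
  assumes U: "(U, \<phi>) \<in> charts M" and W: "W \<subseteq> U"
  shows "jet_coord M k \<phi> ` {u \<in> points (jet_mfd M k). foot u \<in> W} =
    {y \<in> extensional ({..k} \<times> index M). base_coords y \<in> \<phi> ` W}" (is "?L = ?R")
proof (intro equalityI subsetI)
  fix y assume "y \<in> ?L"
  then obtain u where u: "u \<in> points (jet_mfd M k)" "foot u \<in> W" "y = jet_coord M k \<phi> u" by blast
  then show "y \<in> ?R"
    using base_coords_jet_coord[OF u(1) U] W jet_coord_extensional by auto
next
  fix y assume y: "y \<in> ?R"
  then have yU: "base_coords y \<in> \<phi> ` U" using W by blast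
  define u where "u = jet M k (poly_curve U \<phi> k y)"
  have up: "u \<in> points (jet_mfd M k)" unfolding u_def by (rule jet_in_points[OF poly_curve_smooth[OF U yU]])
  have f: "foot u = poly_curve U \<phi> k y 0" unfolding u_def by (rule foot_jet[OF poly_curve_smooth[OF U yU]])
  obtain w where w: "w \<in> W" "base_coords y = \<phi> w" using y by blast
  have "foot u = w" using poly_curve_0[OF U yU] w W chart_inj_eq[OF U] f by auto
  moreover have "jet_coord M k \<phi> u = y"
  proof (rule extensionalityI[OF jet_coord_extensional])
    show "y \<in> extensional ({..k} \<times> index M)" using y by blast
    fix z assume "z \<in> {..k} \<times> index M"
    then show "jet_coord M k \<phi> u z = y z"
      using jet_coord_poly_curve[OF U yU] by (auto simp: u_def)
  qed
  ultimately show "y \<in> ?L" using up w by blast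
qed

lemma smooth_base_coords: "i \<in> index M \<Longrightarrow> smooth_on_coords ({..k} \<times> index M) S (\<lambda>y. base_coords y i)"
  by (simp add: base_coords_def smooth_on_coords_proj)

lemma openin_jet_chart_image:
  assumes "openin (powertop_real (index M)) S"
  shows "openin (powertop_real ({..k} \<times> index M)) {y \<in> extensional ({..k} \<times> index M). base_coords y \<in> S}"
  by (rule openin_preimage_coords[OF openin_extensional assms _ smooth_base_coords])
    simp_all

text \<open>Higher \<open>t\<close>-derivatives at \<open>0\<close> depend smoothly on parameters: adjoin \<open>t\<close> as the coordinate \<open>None\<close>,
  differentiate, and restrict to \<open>t = 0\<close>.\<close>

lemma jet_transition_smooth:
  assumes U: "(U, \<phi>) \<in> charts M" and V: "(V, \<psi>) \<in> charts M" and j: "j \<in> index M"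
  shows "smooth_on_coords ({..k} \<times> index M) {y \<in> extensional ({..k} \<times> index M). base_coords y \<in> \<phi> ` (U \<inter> V)}
    (\<lambda>y. (deriv ^^ b) (\<lambda>t. \<psi> (poly_curve U \<phi> k y t) j) 0)"
proof -
  define P where "P = {..k} \<times> index M"
  define J where "J = insert None (Some ` P)"
  have fin: "finite P" "finite J" using finite_index by (auto simp: P_def J_def)
  define G where "G x = poly_coords k (\<lambda>z. x (Some z)) (x None)" for x
  have G: "smooth_on_coords J S (\<lambda>x. G x i)" if "i \<in> index M" "openin (powertop_real J) S" for i S
    using that unfolding G_def poly_coords_def
    by (simp, intro smooth_on_coords_sum smooth_on_coords_mult smooth_on_coords_power smooth_on_coords_proj)
      (auto simp: J_def P_def)
  define T where "T = {x \<in> extensional J. G x \<in> \<phi> ` (U \<inter> V)}"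
  have T: "openin (powertop_real J) T" unfolding T_def
    by (rule openin_preimage_coords[OF openin_extensional overlap_open[OF U V] _ G[OF _ openin_extensional]])
      (simp_all add: G_def)
  define F where "F x = \<psi> (inv_into U \<phi> (G x)) j" for x
  have "smooth_on_coords J T F" unfolding F_def
    by (rule smooth_on_coords_compose[OF finite_index overlap_open[OF U V] T _ transition_smooth[OF U V j] G[OF _ T]])
      (auto simp: T_def)
  then have "smooth_on_coords J T ((partial None ^^ b) F)"
    by (rule smooth_on_coords_partial_funpow) (simp add: J_def)
  from smooth_on_coords_slice(2)[OF fin(1) T[unfolded J_def] this[unfolded J_def]]
  have "smooth_on_coords P {y \<in> extensional P. case_option 0 y \<in> T} (\<lambda>y. (partial None ^^ b) F (case_option 0 y))" .
  moreover have "(partial None ^^ b) F (case_option 0 y) = (deriv ^^ b) (\<lambda>t. \<psi> (poly_curve U \<phi> k y t) j) 0" for y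
    unfolding partial_funpow by (simp add: F_def G_def poly_curve_def)
  moreover have "{y \<in> extensional P. case_option 0 y \<in> T} = {y \<in> extensional P. base_coords y \<in> \<phi> ` (U \<inter> V)}"
  proof -
    have "case_option 0 y \<in> extensional J" if "y \<in> extensional P" for y :: "nat \<times> 'i \<Rightarrow> real"
      using that by (auto simp: extensional_def J_def split: option.split)
    then show ?thesis by (auto simp: T_def G_def poly_coords_0)
  qed
  ultimately show ?thesis by (simp add: P_def)
qed

lemma jet_chart_inj:
  assumes U: "(U, \<phi>) \<in> charts M"
  shows "inj_on (jet_coord M k \<phi>) {u \<in> points (jet_mfd M k). foot u \<in> U}"
  by (rule inj_onI, rule jet_coord_inj[OF _ _ U]) auto

lemma jet_chart_inv:
  assumes U: "(U, \<phi>) \<in> charts M" and y: "y \<in> extensional ({..k} \<times> index M)" "base_coords y \<in> \<phi> ` U"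
  shows "inv_into {u \<in> points (jet_mfd M k). foot u \<in> U} (jet_coord M k \<phi>) y = jet M k (poly_curve U \<phi> k y)"
proof -
  have s: "smooth_curve M (poly_curve U \<phi> k y)" by (rule poly_curve_smooth[OF U y(2)])
  have e: "jet_coord M k \<phi> (jet M k (poly_curve U \<phi> k y)) = y"
  proof (rule extensionalityI[OF jet_coord_extensional y(1)])
    fix z assume "z \<in> {..k} \<times> index M"
    then show "jet_coord M k \<phi> (jet M k (poly_curve U \<phi> k y)) z = y z"
      using jet_coord_poly_curve[OF U y(2)] by auto
  qed
  have "jet M k (poly_curve U \<phi> k y) \<in> {u \<in> points (jet_mfd M k). foot u \<in> U}"
    using jet_in_points[OF s] foot_jet[OF s] poly_curve_0[OF U y(2)] by simp
  from inv_into_f_f[OF jet_chart_inj[OF U] this] show ?thesis unfolding e .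
qed

text \<open>To invert a jet chart is to pass to the polynomial curve, so a transition map reads off
  the normalised derivatives of this curve in the other chart; \<open>jet_transition_smooth\<close>
  makes them smooth.\<close>

lemma atlas_jet_mfd: "atlas (jet_mfd M k)"
proof -
  let ?D = "\<lambda>U. {u \<in> points (jet_mfd M k). foot u \<in> U}"
  have ch: "charts (jet_mfd M k) = (\<lambda>(U, \<phi>). (?D U, jet_coord M k \<phi>)) ` charts M" by simp
  have open1: "openin (powertop_real (index (jet_mfd M k))) (jet_coord M k \<phi> ` (?D U \<inter> ?D V))"
    if U: "(U, \<phi>) \<in> charts M" and V: "(V, \<psi>) \<in> charts M" for U \<phi> V \<psi>
  proof -
    have "?D U \<inter> ?D V = ?D (U \<inter> V)" by auto
    then show ?thesis
      using jet_chart_image[OF U, of "U \<inter> V" k] openin_jet_chart_image[OF overlap_open[OF U V], of k] by simp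
  qed
  have smooth1: "smooth_on_coords (index (jet_mfd M k)) (jet_coord M k \<phi> ` (?D U \<inter> ?D V))
      (\<lambda>x. jet_coord M k \<psi> (inv_into (?D U) (jet_coord M k \<phi>) x) z)"
    if U: "(U, \<phi>) \<in> charts M" and V: "(V, \<psi>) \<in> charts M" and z: "z \<in> index (jet_mfd M k)" for U \<phi> V \<psi> z
  proof -
    obtain b j where z': "z = (b, j)" "b \<le> k" "j \<in> index M" using z by auto
    have im: "jet_coord M k \<phi> ` (?D U \<inter> ?D V) = {y \<in> extensional ({..k} \<times> index M). base_coords y \<in> \<phi> ` (U \<inter> V)}"
    proof -
      have "?D U \<inter> ?D V = ?D (U \<inter> V)" by auto
      then show ?thesis using jet_chart_image[OF U, of "U \<inter> V" k] by simp
    qed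
    note op = openin_jet_chart_image[OF overlap_open[OF U V], of k]
    have "smooth_on_coords ({..k} \<times> index M) {y \<in> extensional ({..k} \<times> index M). base_coords y \<in> \<phi> ` (U \<inter> V)}
       (\<lambda>y. (1 / fact b) * (deriv ^^ b) (\<lambda>t. \<psi> (poly_curve U \<phi> k y t) j) 0)"
      by (intro smooth_on_coords_mult[OF op] smooth_on_coords_const jet_transition_smooth[OF U V z'(3)])
    then have "smooth_on_coords ({..k} \<times> index M) {y \<in> extensional ({..k} \<times> index M). base_coords y \<in> \<phi> ` (U \<inter> V)}
       (\<lambda>x. jet_coord M k \<psi> (inv_into (?D U) (jet_coord M k \<phi>) x) z)"
    proof (rule smooth_on_coords_cong[OF op])
      fix y assume y: "y \<in> {y \<in> extensional ({..k} \<times> index M). base_coords y \<in> \<phi> ` (U \<inter> V)}"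
      then have yU: "y \<in> extensional ({..k} \<times> index M)" "base_coords y \<in> \<phi> ` U" by auto
      obtain w where w: "w \<in> U" "w \<in> V" "base_coords y = \<phi> w" using y by blast
      have "poly_curve U \<phi> k y 0 = w" using poly_curve_0[OF U yU(2)] w chart_inj_eq[OF U] by metis
      then have "poly_curve U \<phi> k y 0 \<in> V" using w by simp
      from jet_coord_jet[OF poly_curve_smooth[OF U yU(2)] V this z'(3,2)]
      show "(1 / fact b) * (deriv ^^ b) (\<lambda>t. \<psi> (poly_curve U \<phi> k y t) j) 0 =
        jet_coord M k \<psi> (inv_into (?D U) (jet_coord M k \<phi>) y) z"
        unfolding jet_chart_inv[OF U yU] z'(1) by simp
    qed
    then show ?thesis unfolding im by simp
  qed
  show ?thesis
  proof
    show "finite (index (jet_mfd M k))" using finite_index by simp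
    show "(\<Union>(U, \<phi>)\<in>charts (jet_mfd M k). U) = points (jet_mfd M k)"
    proof (intro equalityI subsetI)
      fix u assume u: "u \<in> points (jet_mfd M k)"
      obtain U \<phi> where "(U, \<phi>) \<in> charts M" "foot u \<in> U" using obtain_chart[OF jet_pointsD(4)[OF u]] .
      then have "(?D U, jet_coord M k \<phi>) \<in> charts (jet_mfd M k)" "u \<in> ?D U" using u unfolding ch by auto
      then show "u \<in> (\<Union>(U, \<phi>)\<in>charts (jet_mfd M k). U)" by blast
    qed auto
  next
    fix U' \<phi>' assume "(U', \<phi>') \<in> charts (jet_mfd M k)"
    then obtain U \<phi> where U: "(U, \<phi>) \<in> charts M" "U' = ?D U" "\<phi>' = jet_coord M k \<phi>" unfolding ch by auto
    show "inj_on \<phi>' U'" unfolding U(2,3) by (rule jet_chart_inj[OF U(1)])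
    show "openin (powertop_real (index (jet_mfd M k))) (\<phi>' ` U')"
      unfolding U(2,3) using open1[OF U(1) U(1)] by simp
    fix V' \<psi>' assume "(V', \<psi>') \<in> charts (jet_mfd M k)"
    then obtain V \<psi> where V: "(V, \<psi>) \<in> charts M" "V' = ?D V" "\<psi>' = jet_coord M k \<psi>" unfolding ch by auto
    show "openin (powertop_real (index (jet_mfd M k))) (\<phi>' ` (U' \<inter> V'))"
      unfolding U(2,3) V(2,3) by (rule open1[OF U(1) V(1)])
    show "smooth_on_coords (index (jet_mfd M k)) (\<phi>' ` (U' \<inter> V')) (\<lambda>x. \<psi>' (inv_into U' \<phi>' x) z)"
      if "z \<in> index (jet_mfd M k)" for z
      unfolding U(2,3) V(2,3) by (rule smooth1[OF U(1) V(1) that])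
  qed
qed

end

section \<open>Tangent vectors and vector fields\<close>

context atlas begin

lemma tangent_spaceD:
  assumes "v \<in> tangent_space M p"
  shows "v \<in> points (TB M)" "foot v = p" "smooth_curve M (rep v)" "rep v 0 = p" "jet M 1 (rep v) = v" "p \<in> points M"
  using assms jet_pointsD[of v 1] by (simp_all add: tangent_space_def)

lemma tangent_spaceI: "v \<in> points (TB M) \<Longrightarrow> foot v = p \<Longrightarrow> v \<in> tangent_space M p"
  by (simp add: tangent_space_def)

lemma jet_in_tangent_space: "smooth_curve M q \<Longrightarrow> q 0 = p \<Longrightarrow> jet M 1 q \<in> tangent_space M p"
  using jet_in_points[of q 1] foot_jet[of q 1] by (intro tangent_spaceI) simp_all

lemma jet_coord_1: "i \<in> index M \<Longrightarrow> jet_coord M 1 \<phi> v (1, i) = tcomp \<phi> v i"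
  by (simp add: jet_coord_def tcomp_def)

lemma tcomp_jet:
  assumes "smooth_curve M q" "(U, \<phi>) \<in> charts M" "q 0 \<in> U" "i \<in> index M"
  shows "tcomp \<phi> (jet M 1 q) i = deriv (\<lambda>t. \<phi> (q t) i) 0"
  using jet_coord_jet[OF assms, of 1 1] jet_coord_1[OF assms(4), of \<phi> "jet M 1 q"] by simp

text \<open>A tangent vector is a 1-jet whose coordinates of order 0 are fixed by its foot point, so
  those of order 1 decide.\<close>

lemma tangent_eqI:
  assumes v: "v \<in> tangent_space M p" and w: "w \<in> tangent_space M p" and U: "(U, \<phi>) \<in> charts M" "p \<in> U"
    and eq: "\<And>i. i \<in> index M \<Longrightarrow> tcomp \<phi> v i = tcomp \<phi> w i"
  shows "v = w"
proof (rule jet_coord_inj[OF tangent_spaceD(1)[OF v] tangent_spaceD(1)[OF w] U(1)])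
  show "foot v \<in> U" "foot w \<in> U" using tangent_spaceD(2)[OF v] tangent_spaceD(2)[OF w] U(2) by simp_all
  fix i and b :: nat assume i: "i \<in> index M" and "b \<le> 1"
  then consider "b = 0" | "b = 1" by linarith
  then show "jet_coord M 1 \<phi> v (b, i) = jet_coord M 1 \<phi> w (b, i)"
  proof cases
    case 1
    then show ?thesis
      using jet_coord_0[OF tangent_spaceD(1)[OF v] i, of \<phi>] jet_coord_0[OF tangent_spaceD(1)[OF w] i, of \<phi>]
        tangent_spaceD(2)[OF v] tangent_spaceD(2)[OF w] by simp
  next
    case 2
    then show ?thesis using jet_coord_1[OF i] eq[OF i] by simp
  qed
qed

text \<open>The Jacobian of the change from \<phi> to \<psi> at \<open>p\<close>, with
  \<open>i\<close> the old and \<open>j\<close> the new index.\<close>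

definition transition_partial :: "'p set \<Rightarrow> ('p \<Rightarrow> 'i \<Rightarrow> real) \<Rightarrow> ('p \<Rightarrow> 'i \<Rightarrow> real) \<Rightarrow> 'i \<Rightarrow> 'i \<Rightarrow> 'p \<Rightarrow> real" where
  "transition_partial U \<phi> \<psi> i j p = partial i (\<lambda>x. \<psi> (inv_into U \<phi> x) j) (\<phi> p)"

lemma DERIV_along_curve:
  assumes U: "(U, \<phi>) \<in> charts M" and q: "curve_in U \<phi> \<epsilon> q" and W: "openin (powertop_real (index M)) S" "\<phi> (q t) \<in> S"
    and F: "smooth_on_coords (index M) S F" and t: "\<bar>t\<bar> < \<epsilon>"
  shows "((\<lambda>t. F (\<phi> (q t))) has_real_derivative
    (\<Sum>i\<in>index M. partial i F (\<phi> (q t)) * deriv (\<lambda>t. \<phi> (q t) i) t)) (at t)"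
proof (rule chain_rule_smooth[where f = F and g = "\<lambda>t. \<phi> (q t)", OF finite_index W(1) F W(2)])
  show "\<forall>\<^sub>F t in nhds t. \<phi> (q t) \<in> extensional (index M)"
    by (rule eventually_mono[OF eventually_abs_less[OF t]])
      (use q chart_extensional[OF U] in \<open>auto simp: curve_in_def\<close>)
  show "((\<lambda>t. \<phi> (q t) i) has_real_derivative deriv (\<lambda>t. \<phi> (q t) i) t) (at t)" if "i \<in> index M" for i
    using q that t smooth_ivl_DERIV by (auto simp: curve_in_def)
qed

lemma tcomp_change_chart:
  assumes v: "v \<in> tangent_space M p" and U: "(U, \<phi>) \<in> charts M" "p \<in> U" and V: "(V, \<psi>) \<in> charts M" "p \<in> V"
    and j: "j \<in> index M"
  shows "tcomp \<psi> v j = (\<Sum>i\<in>index M. transition_partial U \<phi> \<psi> i j p * tcomp \<phi> v i)"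
proof -
  note vD = tangent_spaceD[OF v]
  have r0: "rep v 0 \<in> U" "rep v 0 \<in> V" using vD U V by auto
  obtain \<epsilon> where e: "curve_in U \<phi> \<epsilon> (rep v)" using smooth_curve_chart[OF vD(3) U(1) r0(1)] .
  from curve_transition[OF e U(1) V(1) r0(2)] obtain \<delta> where d: "0 < \<delta>" "\<delta> \<le> \<epsilon>"
    "\<And>t. \<bar>t\<bar> < \<delta> \<Longrightarrow> \<phi> (rep v t) \<in> \<phi> ` (U \<inter> V)"
    "\<And>t j. \<bar>t\<bar> < \<delta> \<Longrightarrow> \<psi> (inv_into U \<phi> (\<phi> (rep v t))) j = \<psi> (rep v t) j" by metis
  have "((\<lambda>t. \<psi> (inv_into U \<phi> (\<phi> (rep v t))) j) has_real_derivative
      (\<Sum>i\<in>index M. transition_partial U \<phi> \<psi> i j p * tcomp \<phi> v i)) (at 0)"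
    using DERIV_along_curve[OF U(1) e overlap_open[OF U(1) V(1)] d(3) transition_smooth[OF U(1) V(1) j], of 0] d(1,2) vD(4)
    by (simp add: transition_partial_def tcomp_def)
  then have "deriv (\<lambda>t. \<psi> (inv_into U \<phi> (\<phi> (rep v t))) j) 0 = (\<Sum>i\<in>index M. transition_partial U \<phi> \<psi> i j p * tcomp \<phi> v i)"
    by (rule DERIV_imp_deriv)
  moreover have "deriv (\<lambda>t. \<psi> (inv_into U \<phi> (\<phi> (rep v t))) j) 0 = deriv (\<lambda>t. \<psi> (rep v t) j) 0"
    by (rule deriv_cong_ivl[where \<epsilon> = \<delta>]) (use d in auto)
  ultimately show ?thesis by (simp add: tcomp_def)
qed

text \<open>The vector at \<open>p\<close> with components \<open>a\<close>, obtained as the 1-jet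
  of a straight line in the chart.\<close>

definition tvec :: "'p set \<Rightarrow> ('p \<Rightarrow> 'i \<Rightarrow> real) \<Rightarrow> 'p \<Rightarrow> ('i \<Rightarrow> real) \<Rightarrow> (real \<Rightarrow> 'p) set" where
  "tvec U \<phi> p a = jet M 1 (poly_curve U \<phi> 1 (\<lambda>(b, i). if b = 0 then \<phi> p i else a i))"

lemma base_coords_chart:
  assumes "(U, \<phi>) \<in> charts M" "p \<in> U"
  shows "base_coords (\<lambda>(b, i). if b = 0 then \<phi> p i else a i) = \<phi> p"
  by (rule extensionalityI[OF base_coords_extensional chart_extensional[OF assms]]) (simp add: base_coords_def)

lemma
  assumes U: "(U, \<phi>) \<in> charts M" "p \<in> U"
  shows tvec_in_tangent_space: "tvec U \<phi> p a \<in> tangent_space M p"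
    and tcomp_tvec: "i \<in> index M \<Longrightarrow> tcomp \<phi> (tvec U \<phi> p a) i = a i"
proof -
  let ?y = "\<lambda>(b, i). if b = (0::nat) then \<phi> p i else a i"
  note b = base_coords_chart[OF U, of a]
  have y: "base_coords ?y \<in> \<phi> ` U" using b U(2) by simp
  have "\<phi> (poly_curve U \<phi> 1 ?y 0) = \<phi> p" unfolding poly_curve_0(1)[OF U(1) y] by (rule b)
  then have "poly_curve U \<phi> 1 ?y 0 = p" by (rule chart_inj_eq[OF U(1) poly_curve_0(2)[OF U(1) y] U(2)])
  then show "tvec U \<phi> p a \<in> tangent_space M p"
    unfolding tvec_def by (intro jet_in_tangent_space poly_curve_smooth[OF U(1) y])
  show "i \<in> index M \<Longrightarrow> tcomp \<phi> (tvec U \<phi> p a) i = a i"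
    using jet_coord_poly_curve[OF U(1) y, of i 1 1] jet_coord_1[of i \<phi> "tvec U \<phi> p a"] by (simp add: tvec_def)
qed

text \<open>\<open>tadd\<close>, \<open>tscale\<close> and \<open>cov_deriv_along\<close> describe a
  vector by its components in every chart at once. If the prescribed components come from those in
  one chart by the Jacobian, the vector built in that chart has all of them, and it is the only
  one.\<close>

lemma tangent_vector_ex1:
  assumes U: "(U, \<phi>) \<in> charts M" "p \<in> U"
    and a: "\<And>V \<psi> j. (V, \<psi>) \<in> charts M \<Longrightarrow> p \<in> V \<Longrightarrow> j \<in> index M \<Longrightarrow>
      a V \<psi> j = (\<Sum>i\<in>index M. transition_partial U \<phi> \<psi> i j p * a U \<phi> i)"
  shows "\<exists>!z. z \<in> tangent_space M p \<and> (\<forall>(V, \<psi>)\<in>charts M. p \<in> V \<longrightarrow> (\<forall>j\<in>index M. tcomp \<psi> z j = a V \<psi> j))"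
proof (rule ex1I)
  let ?z = "tvec U \<phi> p (a U \<phi>)"
  have z: "?z \<in> tangent_space M p" by (rule tvec_in_tangent_space[OF U])
  have "tcomp \<psi> ?z j = a V \<psi> j" if "(V, \<psi>) \<in> charts M" "p \<in> V" "j \<in> index M" for V \<psi> j
    using tcomp_change_chart[OF z U that] a[OF that] tcomp_tvec[OF U] by simp
  then show "?z \<in> tangent_space M p \<and> (\<forall>(V, \<psi>)\<in>charts M. p \<in> V \<longrightarrow> (\<forall>j\<in>index M. tcomp \<psi> ?z j = a V \<psi> j))"
    using z by auto
  fix w assume w: "w \<in> tangent_space M p \<and> (\<forall>(V, \<psi>)\<in>charts M. p \<in> V \<longrightarrow> (\<forall>j\<in>index M. tcomp \<psi> w j = a V \<psi> j))"
  show "w = ?z"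
    by (rule tangent_eqI[OF _ z U]) (use w U tcomp_tvec[OF U] in auto)
qed

lemma tangent_chart: 
  assumes "v \<in> tangent_space M p" obtains U \<phi> where "(U, \<phi>) \<in> charts M" "p \<in> U"
  using obtain_chart[OF tangent_spaceD(6)[OF assms]] .

lemma
  assumes v: "v \<in> tangent_space M p" and w: "w \<in> tangent_space M p"
  shows tadd_in_tangent_space: "tadd M v w \<in> tangent_space M p"
    and tcomp_tadd: "(U, \<phi>) \<in> charts M \<Longrightarrow> p \<in> U \<Longrightarrow> i \<in> index M \<Longrightarrow>
      tcomp \<phi> (tadd M v w) i = tcomp \<phi> v i + tcomp \<phi> w i"
proof -
  obtain A \<alpha> where A: "(A, \<alpha>) \<in> charts M" "p \<in> A" using tangent_chart[OF v] .
  have "\<exists>!z. z \<in> tangent_space M p \<and> (\<forall>(V, \<psi>)\<in>charts M. p \<in> V \<longrightarrow> (\<forall>j\<in>index M. tcomp \<psi> z j =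
      (\<lambda>(V :: 'p set) \<psi> j. tcomp \<psi> v j + tcomp \<psi> w j) V \<psi> j))"
    by (rule tangent_vector_ex1[OF A])
      (simp add: tcomp_change_chart[OF v A] tcomp_change_chart[OF w A] sum.distrib distrib_left)
  from theI'[OF this]
  have *: "tadd M v w \<in> tangent_space M p \<and> (\<forall>(V, \<psi>)\<in>charts M. p \<in> V \<longrightarrow> (\<forall>j\<in>index M. tcomp \<psi> (tadd M v w) j =
      tcomp \<psi> v j + tcomp \<psi> w j))"
    unfolding tadd_def tangent_spaceD(2)[OF v] .
  then show "tadd M v w \<in> tangent_space M p" ..
  show "(U, \<phi>) \<in> charts M \<Longrightarrow> p \<in> U \<Longrightarrow> i \<in> index M \<Longrightarrow> tcomp \<phi> (tadd M v w) i = tcomp \<phi> v i + tcomp \<phi> w i"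
    using * by blast
qed

lemma
  assumes v: "v \<in> tangent_space M p"
  shows tscale_in_tangent_space: "tscale M r v \<in> tangent_space M p"
    and tcomp_tscale: "(U, \<phi>) \<in> charts M \<Longrightarrow> p \<in> U \<Longrightarrow> i \<in> index M \<Longrightarrow>
      tcomp \<phi> (tscale M r v) i = r * tcomp \<phi> v i"
proof -
  obtain A \<alpha> where A: "(A, \<alpha>) \<in> charts M" "p \<in> A" using tangent_chart[OF v] .
  have "\<exists>!z. z \<in> tangent_space M p \<and> (\<forall>(V, \<psi>)\<in>charts M. p \<in> V \<longrightarrow> (\<forall>j\<in>index M. tcomp \<psi> z j =
      (\<lambda>(V :: 'p set) \<psi> j. r * tcomp \<psi> v j) V \<psi> j))"
    by (rule tangent_vector_ex1[OF A])
      (simp add: tcomp_change_chart[OF v A] sum_distrib_left mult_ac)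
  from theI'[OF this]
  have *: "tscale M r v \<in> tangent_space M p \<and> (\<forall>(V, \<psi>)\<in>charts M. p \<in> V \<longrightarrow> (\<forall>j\<in>index M. tcomp \<psi> (tscale M r v) j =
      r * tcomp \<psi> v j))"
    unfolding tscale_def tangent_spaceD(2)[OF v] .
  then show "tscale M r v \<in> tangent_space M p" ..
  show "(U, \<phi>) \<in> charts M \<Longrightarrow> p \<in> U \<Longrightarrow> i \<in> index M \<Longrightarrow> tcomp \<phi> (tscale M r v) i = r * tcomp \<phi> v i"
    using * by blast
qed

section \<open>Coordinate vector fields\<close>

lemma coord_field_eq_tvec:
  assumes U: "(U, \<phi>) \<in> charts M" "p \<in> U" and i: "i \<in> index M"
  shows "coord_field M U \<phi> i p = tvec U \<phi> p (\<lambda>j. if j = i then 1 else 0)"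
proof -
  have "poly_coords 1 (\<lambda>(b, j). if b = 0 then \<phi> p j else if j = i then 1 else 0) t = (\<phi> p)(i := \<phi> p i + t)" for t
  proof (rule extensionalityI[OF poly_coords_extensional])
    show "(\<phi> p)(i := \<phi> p i + t) \<in> extensional (index M)"
      using chart_extensional[OF U] i by (auto simp: extensional_def)
  qed (simp add: poly_coords_def)
  then have "poly_curve U \<phi> 1 (\<lambda>(b, j). if b = 0 then \<phi> p j else if j = i then 1 else 0) =
      (\<lambda>t. inv_into U \<phi> ((\<phi> p)(i := \<phi> p i + t)))"
    by (intro ext) (simp only: poly_curve_def)
  then show ?thesis by (simp only: coord_field_def tvec_def)
qed

lemma coord_field_in_tangent_space:
  "(U, \<phi>) \<in> charts M \<Longrightarrow> p \<in> U \<Longrightarrow> i \<in> index M \<Longrightarrow> coord_field M U \<phi> i p \<in> tangent_space M p"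
  by (simp add: coord_field_eq_tvec tvec_in_tangent_space)

lemma tcomp_coord_field:
  "(U, \<phi>) \<in> charts M \<Longrightarrow> p \<in> U \<Longrightarrow> i \<in> index M \<Longrightarrow> j \<in> index M \<Longrightarrow>
    tcomp \<phi> (coord_field M U \<phi> i p) j = (if j = i then 1 else 0)"
  by (simp add: coord_field_eq_tvec tcomp_tvec)

lemma tcomp_coord_field_change:
  assumes U: "(U, \<phi>) \<in> charts M" "p \<in> U" and V: "(V, \<psi>) \<in> charts M" "p \<in> V"
    and i: "i \<in> index M" and j: "j \<in> index M"
  shows "tcomp \<psi> (coord_field M U \<phi> i p) j = transition_partial U \<phi> \<psi> i j p"
  using tcomp_change_chart[OF coord_field_in_tangent_space[OF U i] U V j] finite_index i
  by (simp add: tcomp_coord_field[OF U i] if_distrib sum.delta cong: if_cong)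

section \<open>Fields, functions and linear maps in charts\<close>

lemma jet_chart_mem: "(U, \<phi>) \<in> charts M \<Longrightarrow> ({u \<in> points (jet_mfd M k). foot u \<in> U}, jet_coord M k \<phi>) \<in> charts (jet_mfd M k)"
  by force

text \<open>Of the two blocks of coordinates on \<open>TB M\<close>, the first is the foot point,
  which for a field is the identity in the chart; only the components remain to be checked.\<close>

lemma vector_field_onI:
  assumes W: "openin (mfd_topology M) W" "W \<subseteq> U" and U: "(U, \<phi>) \<in> charts M"
    and X: "\<And>p. p \<in> W \<Longrightarrow> X p \<in> tangent_space M p"
    and sm: "\<And>j. j \<in> index M \<Longrightarrow> smooth_on_coords (index M) (\<phi> ` W) (\<lambda>x. tcomp \<phi> (X (inv_into U \<phi> x)) j)"
  shows "vector_field_on M W X"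
  unfolding vector_field_on_def smooth_map_on_def
proof (intro conjI ballI)
  fix p assume p: "p \<in> W"
  show "X p \<in> tangent_space M p" by (rule X[OF p])
  then show "X p \<in> points (TB M)" by (rule tangent_spaceD)
  let ?D = "{u \<in> points (TB M). foot u \<in> U}"
  have op: "openin (powertop_real (index M)) (\<phi> ` W)" using openin_chart_image[OF W(1) U] W(2) by (simp add: Int_absorb2)
  have XW: "X ` W \<subseteq> ?D"
  proof (rule image_subsetI)
    fix q assume q: "q \<in> W"
    have "foot (X q) \<in> U" unfolding tangent_spaceD(2)[OF X[OF q]] using q W(2) by (rule subsetD[rotated])
    with tangent_spaceD(1)[OF X[OF q]] show "X q \<in> ?D" by (intro CollectI conjI)
  qed
  have "smooth_on_coords (index M) (\<phi> ` W) (\<lambda>x. jet_coord M 1 \<phi> (X (inv_into U \<phi> x)) z)" if z: "z \<in> index (TB M)" for z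
  proof -
    obtain b j where bj: "z = (b, j)" "b \<le> 1" "j \<in> index M" using z by auto
    then consider "b = 0" | "b = 1" by linarith
    then show ?thesis
    proof cases
      case 1
      show ?thesis
      proof (rule smooth_on_coords_cong[OF op smooth_on_coords_proj[OF bj(3)]])
        fix x assume "x \<in> \<phi> ` W"
        then obtain q where q: "q \<in> W" "x = \<phi> q" by blast
        then show "x j = jet_coord M 1 \<phi> (X (inv_into U \<phi> x)) z"
          using bj(1) 1 jet_coord_0[OF tangent_spaceD(1)[OF X[OF q(1)]] bj(3)] tangent_spaceD(2)[OF X[OF q(1)]] U W(2)
          by (simp add: subset_iff del: jet_mfd_sel)
      qed
    next
      case 2
      then show ?thesis using sm[OF bj(3)] bj(1) jet_coord_1[OF bj(3)] by simp
    qed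
  qed
  then have "\<exists>W'. openin (mfd_topology M) W' \<and> p \<in> W' \<and> W' \<subseteq> W \<inter> U \<and> X ` W' \<subseteq> ?D \<and>
      (\<forall>j\<in>index (TB M). smooth_on_coords (index M) (\<phi> ` W') (\<lambda>x. jet_coord M 1 \<phi> (X (inv_into U \<phi> x)) j))"
    using W XW p by (intro exI[of _ W]) (simp del: jet_mfd_sel)
  then show "\<exists>(U, \<phi>)\<in>charts M. \<exists>(V, \<psi>)\<in>charts (TB M). \<exists>W'. openin (mfd_topology M) W' \<and>
      p \<in> W' \<and> W' \<subseteq> W \<inter> U \<and> X ` W' \<subseteq> V \<and>
      (\<forall>j\<in>index (TB M). smooth_on_coords (index M) (\<phi> ` W') (\<lambda>x. \<psi> (X (inv_into U \<phi> x)) j))"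
    using jet_chart_mem[OF U, of 1]
    by (intro bexI[of _ "(U, \<phi>)"] case_prodI bexI[of _ "(?D, jet_coord M 1 \<phi>)"] U)
qed

text \<open>A field is smooth near each point in some charts; \<open>smooth_map_on_charts\<close>
  moves this to \<phi>, and \<open>smooth_on_coords_local\<close> glues the local
  statements.\<close>

lemma vector_field_onD:
  assumes X: "vector_field_on M W X" and W: "openin (mfd_topology M) W" "W \<subseteq> U" and U: "(U, \<phi>) \<in> charts M"
    and j: "j \<in> index M"
  shows "smooth_on_coords (index M) (\<phi> ` W) (\<lambda>x. tcomp \<phi> (X (inv_into U \<phi> x)) j)"
proof (rule smooth_on_coords_local)
  show "openin (powertop_real (index M)) (\<phi> ` W)" using openin_chart_image[OF W(1) U] W(2) by (simp add: Int_absorb2)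
  fix x assume "x \<in> \<phi> ` W"
  then obtain p where p: "p \<in> W" "x = \<phi> p" by blast
  have Xp: "X p \<in> tangent_space M p" "smooth_map_on M (TB M) W X" using X p by (auto simp: vector_field_on_def)
  have XD: "X p \<in> {u \<in> points (TB M). foot u \<in> U}" using tangent_spaceD[OF Xp(1)] p W by auto
  have pU: "p \<in> U" using p(1) W(2) by blast
  obtain W' where W': "p \<in> W'" "W' \<subseteq> W \<inter> U" "openin (powertop_real (index M)) (\<phi> ` W')"
    "\<And>j. j \<in> index (TB M) \<Longrightarrow> smooth_on_coords (index M) (\<phi> ` W') (\<lambda>x. jet_coord M 1 \<phi> (X (inv_into U \<phi> x)) j)"
  proof (rule smooth_map_on_charts[where f = X and p = p,
        OF atlas_axioms atlas_jet_mfd Xp(2) p(1) U pU jet_chart_mem[OF U] XD], goal_cases)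
    case (1 W') then show ?case by (intro 1(1))
  qed
  have "smooth_on_coords (index M) (\<phi> ` W') (\<lambda>x. tcomp \<phi> (X (inv_into U \<phi> x)) j)"
    using W'(4)[of "(1, j)"] j jet_coord_1[OF j] by simp
  then show "\<exists>T. openin (powertop_real (index M)) T \<and> x \<in> T \<and> T \<subseteq> \<phi> ` W \<and>
      smooth_on_coords (index M) T (\<lambda>x. tcomp \<phi> (X (inv_into U \<phi> x)) j)"
    using W' p by (intro exI[of _ "\<phi> ` W'"]) auto
qed

lemma smooth_fun_onI:
  assumes W: "openin (mfd_topology M) W" "W \<subseteq> U" and U: "(U, \<phi>) \<in> charts M"
    and sm: "smooth_on_coords (index M) (\<phi> ` W) (\<lambda>x. f (inv_into U \<phi> x))"
  shows "smooth_fun_on M W f"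
  unfolding smooth_fun_on_def smooth_map_on_def
proof (intro ballI conjI)
  fix p assume p: "p \<in> W"
  show "(\<lambda>_. f p) \<in> points (coord_space (UNIV :: unit set))" by (simp add: extensional_def)
  have "\<exists>W'. openin (mfd_topology M) W' \<and> p \<in> W' \<and> W' \<subseteq> W \<inter> U \<and> (\<lambda>p (_ :: unit). f p) ` W' \<subseteq> extensional UNIV \<and>
      (\<forall>j\<in>index (coord_space (UNIV :: unit set)). smooth_on_coords (index M) (\<phi> ` W') (\<lambda>x. f (inv_into U \<phi> x)))"
    using W p sm by (intro exI[of _ W]) (auto simp: extensional_def)
  then show "\<exists>(U, \<phi>)\<in>charts M. \<exists>(V, \<psi>)\<in>charts (coord_space (UNIV :: unit set)). \<exists>W'. openin (mfd_topology M) W' \<and>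
      p \<in> W' \<and> W' \<subseteq> W \<inter> U \<and> (\<lambda>p _. f p) ` W' \<subseteq> V \<and>
      (\<forall>j\<in>index (coord_space (UNIV :: unit set)). smooth_on_coords (index M) (\<phi> ` W') (\<lambda>x. \<psi> ((\<lambda>p _. f p) (inv_into U \<phi> x)) j))"
    by (intro bexI[of _ "(U, \<phi>)"] case_prodI bexI[of _ "(extensional UNIV, \<lambda>x. x)"] U) simp_all
qed

lemma dir_deriv_chart:
  assumes v: "v \<in> tangent_space M p" and U: "(U, \<phi>) \<in> charts M" "p \<in> U"
    and S: "openin (powertop_real (index M)) S" "\<phi> p \<in> S" and F: "smooth_on_coords (index M) S F"
  shows "dir_deriv v (\<lambda>q. F (\<phi> q)) = (\<Sum>i\<in>index M. partial i F (\<phi> p) * tcomp \<phi> v i)"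
proof -
  note vD = tangent_spaceD[OF v]
  have "rep v 0 \<in> U" using vD U by simp
  then obtain \<epsilon> where e: "curve_in U \<phi> \<epsilon> (rep v)" using smooth_curve_chart[OF vD(3) U(1)] by blast
  then have "\<bar>0\<bar> < \<epsilon>" by (simp add: curve_in_def)
  from DERIV_imp_deriv[OF DERIV_along_curve[OF U(1) e S(1) _ F this]] vD(4) S(2)
  show ?thesis by (simp add: dir_deriv_def tcomp_def)
qed

text \<open>The basis expansion is built by hand from \<open>tadd\<close> and \<open>tscale\<close>:
  \<open>w B\<close> keeps the components of \<open>v\<close> in \<open>B\<close>, and the induction
  adds one coordinate vector at a time.\<close>

lemma tlinear_expand:
  assumes L: "tlinear M p M r L" and U: "(U, \<phi>) \<in> charts M" "p \<in> U" and V: "(V, \<psi>) \<in> charts M" "r \<in> V"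
    and v: "v \<in> tangent_space M p" and c: "c \<in> index M"
  shows "tcomp \<psi> (L v) c = (\<Sum>a\<in>index M. tcomp \<phi> v a * tcomp \<psi> (L (coord_field M U \<phi> a p)) c)"
proof -
  define w where "w B = tvec U \<phi> p (\<lambda>a. if a \<in> B then tcomp \<phi> v a else 0)" for B
  have w: "w B \<in> tangent_space M p" "\<And>a. a \<in> index M \<Longrightarrow> tcomp \<phi> (w B) a = (if a \<in> B then tcomp \<phi> v a else 0)" for B
    unfolding w_def by (simp_all add: tvec_in_tangent_space[OF U] tcomp_tvec[OF U])
  have L1: "\<And>v. v \<in> tangent_space M p \<Longrightarrow> L v \<in> tangent_space M r"
    and L2: "\<And>v w. v \<in> tangent_space M p \<Longrightarrow> w \<in> tangent_space M p \<Longrightarrow> L (tadd M v w) = tadd M (L v) (L w)"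
    and L3: "\<And>a v. v \<in> tangent_space M p \<Longrightarrow> L (tscale M a v) = tscale M a (L v)"
    using L unfolding tlinear_def by blast+
  have "B \<subseteq> index M \<Longrightarrow> tcomp \<psi> (L (w B)) c = (\<Sum>a\<in>B. tcomp \<phi> v a * tcomp \<psi> (L (coord_field M U \<phi> a p)) c)" if "finite B" for B
    using that
  proof (induction B)
    case empty
    \<comment> \<open>The zero vector is recognised as its own multiple by 0, a property that
      homogeneity carries through \<open>L\<close>.\<close>
    have "w {} = tscale M 0 (w {})"
      by (rule tangent_eqI[OF w(1) tscale_in_tangent_space[OF w(1)] U]) (simp add: w tcomp_tscale[OF w(1) U])
    then have "L (w {}) = tscale M 0 (L (w {}))" using L3[OF w(1), of 0 "{}"] by simp
    then show ?case using tcomp_tscale[OF L1[OF w(1)] V c, of 0 "{}"] by simp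
  next
    case (insert b B)
    then have b: "b \<in> index M" by simp
    note cf = coord_field_in_tangent_space[OF U b]
    have "w (insert b B) = tadd M (w B) (tscale M (tcomp \<phi> v b) (coord_field M U \<phi> b p))"
      using insert.hyps
      by (intro tangent_eqI[OF w(1) tadd_in_tangent_space[OF w(1) tscale_in_tangent_space[OF cf]] U])
        (simp add: w tcomp_tadd[OF w(1) tscale_in_tangent_space[OF cf] U] tcomp_tscale[OF cf U] tcomp_coord_field[OF U b])
    then have "L (w (insert b B)) = tadd M (L (w B)) (tscale M (tcomp \<phi> v b) (L (coord_field M U \<phi> b p)))"
      using L2[OF w(1) tscale_in_tangent_space[OF cf]] L3[OF cf] by simp
    then show ?case
      using insert tcomp_tadd[OF L1[OF w(1)] tscale_in_tangent_space[OF L1[OF cf]] V c] tcomp_tscale[OF L1[OF cf] V c]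
      by simp
  qed
  moreover have "w (index M) = v"
    by (rule tangent_eqI[OF w(1) v U]) (simp add: w)
  ultimately show ?thesis using finite_index by force
qed

text \<open>One chart of the target decides, because vectors at \<open>q\<close> are determined by
  their components in it.\<close>

lemma tlinearI:
  fixes N :: "('q, 'j) mfd"
  assumes N: "atlas N" and q: "q \<in> points N"
    and L: "\<And>v. v \<in> tangent_space M p \<Longrightarrow> L v \<in> tangent_space N q"
    and V: "(V, \<psi>) \<in> charts N" "q \<in> V"
    and add: "\<And>v w j. v \<in> tangent_space M p \<Longrightarrow> w \<in> tangent_space M p \<Longrightarrow> j \<in> index N \<Longrightarrow>
      tcomp \<psi> (L (tadd M v w)) j = tcomp \<psi> (L v) j + tcomp \<psi> (L w) j"
    and scale: "\<And>r v j. v \<in> tangent_space M p \<Longrightarrow> j \<in> index N \<Longrightarrow> tcomp \<psi> (L (tscale M r v)) j = r * tcomp \<psi> (L v) j"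
  shows "tlinear M p N q L"
proof -
  interpret N: atlas N by (rule N)
  show ?thesis
    unfolding tlinear_def
  proof (intro conjI ballI allI)
    fix v w assume v: "v \<in> tangent_space M p" and w: "w \<in> tangent_space M p"
    show "L (tadd M v w) = tadd N (L v) (L w)"
      by (rule N.tangent_eqI[OF L[OF tadd_in_tangent_space[OF v w]] N.tadd_in_tangent_space[OF L[OF v] L[OF w]] V])
        (simp add: add[OF v w] N.tcomp_tadd[OF L[OF v] L[OF w] V])
  next
    fix r v assume v: "v \<in> tangent_space M p"
    show "L (tscale M r v) = tscale N r (L v)"
      by (rule N.tangent_eqI[OF L[OF tscale_in_tangent_space[OF v]] N.tscale_in_tangent_space[OF L[OF v]] V])
        (simp add: scale[OF v] N.tcomp_tscale[OF L[OF v] V])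
  qed (rule L)
qed

end

section \<open>Affine connections in charts\<close>

text \<open>The algebra behind the invariance of the covariant derivative. \<open>P\<close> is the
  row of the Jacobian for the chosen new index, \<open>H\<close> its second derivatives,
  \<open>Q\<close> the full Jacobian, \<open>G\<close> and \<open>G'\<close> the old and new
  Christoffel symbols, \<open>c\<close> the velocity, \<open>V\<close> and \<open>V'\<close> the
  components and their derivatives. By the transformation law \<open>T\<close>, the second
  derivatives that arise from differentiating the Jacobian along the curve are absorbed.\<close>

lemma covariant_derivative_change_of_frame:
  fixes V V' c P :: "'i \<Rightarrow> real" and G :: "'i \<Rightarrow> 'i \<Rightarrow> 'i \<Rightarrow> real" and H Q G' :: "'i \<Rightarrow> 'i \<Rightarrow> real"
  assumes T: "\<And>i l. i \<in> I \<Longrightarrow> l \<in> I \<Longrightarrow>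
    (\<Sum>m\<in>I. P m * G i l m) = H i l + (\<Sum>b\<in>I. Q l b * (\<Sum>a\<in>I. Q i a * G' a b))"
  shows "(\<Sum>l\<in>I. (\<Sum>i\<in>I. H i l * c i) * V l + P l * V' l) +
      (\<Sum>a\<in>I. \<Sum>b\<in>I. G' a b * (\<Sum>i\<in>I. Q i a * c i) * (\<Sum>l\<in>I. Q l b * V l)) =
    (\<Sum>m\<in>I. P m * (V' m + (\<Sum>i\<in>I. \<Sum>l\<in>I. G i l m * c i * V l)))"
proof -
  have A: "(\<Sum>m\<in>I. P m * (\<Sum>i\<in>I. \<Sum>l\<in>I. G i l m * c i * V l)) =
      (\<Sum>i\<in>I. \<Sum>l\<in>I. (\<Sum>m\<in>I. P m * G i l m) * c i * V l)"
  proof -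
    have "(\<Sum>m\<in>I. P m * (\<Sum>i\<in>I. \<Sum>l\<in>I. G i l m * c i * V l)) =
        (\<Sum>m\<in>I. \<Sum>i\<in>I. \<Sum>l\<in>I. P m * G i l m * c i * V l)"
      by (simp add: sum_distrib_left mult_ac)
    also have "\<dots> = (\<Sum>i\<in>I. \<Sum>m\<in>I. \<Sum>l\<in>I. P m * G i l m * c i * V l)" by (rule sum.swap)
    also have "\<dots> = (\<Sum>i\<in>I. \<Sum>l\<in>I. \<Sum>m\<in>I. P m * G i l m * c i * V l)"
      by (rule sum.cong[OF refl]) (rule sum.swap)
    finally show ?thesis by (simp add: sum_distrib_right)
  qed
  let ?t = "\<lambda>a b i l. G' a b * Q i a * c i * Q l b * V l"
  have "(\<Sum>a\<in>I. \<Sum>b\<in>I. G' a b * (\<Sum>i\<in>I. Q i a * c i) * (\<Sum>l\<in>I. Q l b * V l)) =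
      (\<Sum>a\<in>I. \<Sum>b\<in>I. \<Sum>i\<in>I. \<Sum>l\<in>I. ?t a b i l)"
    by (simp add: sum_distrib_left sum_distrib_right mult_ac)
  also have "\<dots> = (\<Sum>a\<in>I. \<Sum>i\<in>I. \<Sum>b\<in>I. \<Sum>l\<in>I. ?t a b i l)"
    by (rule sum.cong[OF refl]) (rule sum.swap)
  also have "\<dots> = (\<Sum>i\<in>I. \<Sum>a\<in>I. \<Sum>b\<in>I. \<Sum>l\<in>I. ?t a b i l)" by (rule sum.swap)
  also have "\<dots> = (\<Sum>i\<in>I. \<Sum>a\<in>I. \<Sum>l\<in>I. \<Sum>b\<in>I. ?t a b i l)"
    by (rule sum.cong[OF refl], rule sum.cong[OF refl], rule sum.swap)
  also have "\<dots> = (\<Sum>i\<in>I. \<Sum>l\<in>I. \<Sum>a\<in>I. \<Sum>b\<in>I. ?t a b i l)"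
    by (rule sum.cong[OF refl], rule sum.swap)
  also have "\<dots> = (\<Sum>i\<in>I. \<Sum>l\<in>I. \<Sum>b\<in>I. \<Sum>a\<in>I. ?t a b i l)"
    by (rule sum.cong[OF refl], rule sum.cong[OF refl], rule sum.swap)
  also have "\<dots> = (\<Sum>i\<in>I. \<Sum>l\<in>I. (\<Sum>b\<in>I. Q l b * (\<Sum>a\<in>I. Q i a * G' a b)) * c i * V l)"
    by (simp add: sum_distrib_left sum_distrib_right mult_ac)
  finally have B: "(\<Sum>a\<in>I. \<Sum>b\<in>I. G' a b * (\<Sum>i\<in>I. Q i a * c i) * (\<Sum>l\<in>I. Q l b * V l)) =
    (\<Sum>i\<in>I. \<Sum>l\<in>I. (\<Sum>b\<in>I. Q l b * (\<Sum>a\<in>I. Q i a * G' a b)) * c i * V l)" .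
  have C: "(\<Sum>l\<in>I. (\<Sum>i\<in>I. H i l * c i) * V l) = (\<Sum>i\<in>I. \<Sum>l\<in>I. H i l * c i * V l)"
    unfolding sum_distrib_right by (rule sum.swap)
  have "(\<Sum>i\<in>I. \<Sum>l\<in>I. (\<Sum>m\<in>I. P m * G i l m) * c i * V l) =
      (\<Sum>i\<in>I. \<Sum>l\<in>I. H i l * c i * V l + (\<Sum>b\<in>I. Q l b * (\<Sum>a\<in>I. Q i a * G' a b)) * c i * V l)"
    by (intro sum.cong refl) (simp add: T distrib_right)
  then show ?thesis
    by (simp only: distrib_left sum.distrib A B C)
qed

lemma deriv_shift: "deriv (\<lambda>r. f (t + r)) 0 = deriv f (t :: real)"
  unfolding deriv_def using DERIV_shift[of f _ 0 t] by (simp add: add.commute)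

lemma smooth_ivl_shift:
  assumes "smooth_ivl \<epsilon> f"
  shows "smooth_ivl (\<epsilon> - \<bar>t\<bar>) (\<lambda>r. f (t + r))"
  unfolding smooth_ivl_def
  by (rule smooth_on_coords_ivl[OF openin_unit_ivl assms])
    (auto intro!: smooth_on_coords_add[OF openin_unit_ivl] smooth_on_coords_const smooth_on_coords_proj)

section \<open>Velocities of curves and fields on parts of a chart\<close>

context atlas begin

text \<open>Jets look only at time 0, so the velocity at time \<open>t\<close> is that of the
  shifted curve, for which the radius \<open>\<epsilon> - \<bar>t\<bar>\<close> is left.\<close>

lemma curve_in_shift:
  assumes "curve_in U \<phi> \<epsilon> c" "\<bar>t\<bar> < \<epsilon>"
  shows "curve_in U \<phi> (\<epsilon> - \<bar>t\<bar>) (\<lambda>r. c (t + r))"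
  unfolding curve_in_def
proof (intro conjI allI impI ballI)
  show "smooth_ivl (\<epsilon> - \<bar>t\<bar>) (\<lambda>r. \<phi> (c (t + r)) i)" if "i \<in> index M" for i
    using assms(1) that by (intro smooth_ivl_shift) (simp add: curve_in_def)
  show "c (t + r) \<in> U" if "\<bar>r\<bar> < \<epsilon> - \<bar>t\<bar>" for r
    using assms(1) that by (simp add: curve_in_def)
qed (use assms in simp)

lemma
  assumes c: "curve_in U \<phi> \<epsilon> c" "\<bar>t\<bar> < \<epsilon>" and U: "(U, \<phi>) \<in> charts M"
  shows velocity_in_tangent_space: "velocity M c t \<in> tangent_space M (c t)"
    and tcomp_velocity: "i \<in> index M \<Longrightarrow> tcomp \<phi> (velocity M c t) i = deriv (\<lambda>r. \<phi> (c r) i) t"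
proof -
  note s = curve_in_smooth_curve[OF U curve_in_shift[OF c]]
  show "velocity M c t \<in> tangent_space M (c t)"
    unfolding velocity_def by (rule jet_in_tangent_space[OF s]) simp
  have ct: "c (t + 0) \<in> U" using curve_in_0[OF curve_in_shift[OF c]] .
  show "i \<in> index M \<Longrightarrow> tcomp \<phi> (velocity M c t) i = deriv (\<lambda>r. \<phi> (c r) i) t"
    unfolding velocity_def using tcomp_jet[OF s U ct] deriv_shift[of "\<lambda>r. \<phi> (c r) i" t] by simp
qed

lemma curve_eventually_in:
  assumes c: "curve_in U \<phi> \<epsilon> c" "\<bar>t\<bar> < \<epsilon>" and U: "(U, \<phi>) \<in> charts M" and V: "(V, \<psi>) \<in> charts M" "c t \<in> V"
  shows "\<forall>\<^sub>F r in nhds t. c r \<in> U \<inter> V"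
proof -
  have c0: "c (t + 0) \<in> V" using V(2) by simp
  from curve_transition[OF curve_in_shift[OF c] U V(1) c0]
  obtain \<delta> where d: "\<delta> > 0" "\<And>r. \<bar>r\<bar> < \<delta> \<Longrightarrow> c (t + r) \<in> U \<inter> V" by metis
  have "c r \<in> U \<inter> V" if "dist r t < \<delta>" for r
    using d(2)[of "r - t"] that by (simp add: dist_real_def)
  then show ?thesis using d(1) unfolding eventually_nhds_metric by blast
qed

text \<open>The locality axiom of a connection compares two vector fields, so an expression that is
  known to agree with a field on \<open>W\<close> must first be recognised as a field
  itself.\<close>

lemma vector_field_on_cong:
  assumes X: "vector_field_on M W X" and W: "openin (mfd_topology M) W" "W \<subseteq> U" and U: "(U, \<phi>) \<in> charts M"
    and eq: "\<And>q. q \<in> W \<Longrightarrow> X q = Y q"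
  shows "vector_field_on M W Y"
proof (rule vector_field_onI[OF W U])
  show "Y p \<in> tangent_space M p" if "p \<in> W" for p using X eq[OF that] that by (auto simp: vector_field_on_def)
  fix j assume j: "j \<in> index M"
  show "smooth_on_coords (index M) (\<phi> ` W) (\<lambda>x. tcomp \<phi> (Y (inv_into U \<phi> x)) j)"
  proof (rule smooth_on_coords_cong[OF _ vector_field_onD[OF X W U j]])
    show "openin (powertop_real (index M)) (\<phi> ` W)" using openin_chart_image[OF W(1) U] W(2) by (simp add: Int_absorb2)
    show "tcomp \<phi> (X (inv_into U \<phi> x)) j = tcomp \<phi> (Y (inv_into U \<phi> x)) j" if "x \<in> \<phi> ` W" for x
      using that eq U W(2) by (auto simp: subset_iff)
  qed
qed

lemma coord_field_vector_field:
  assumes U: "(U, \<phi>) \<in> charts M" and i: "i \<in> index M" and W: "openin (mfd_topology M) W" "W \<subseteq> U"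
  shows "vector_field_on M W (coord_field M U \<phi> i)"
proof (rule vector_field_onI[OF W U])
  have op: "openin (powertop_real (index M)) (\<phi> ` W)" using openin_chart_image[OF W(1) U] W(2) by (simp add: Int_absorb2)
  show "coord_field M U \<phi> i p \<in> tangent_space M p" if "p \<in> W" for p
    using coord_field_in_tangent_space[OF U _ i] that W(2) by blast
  show "smooth_on_coords (index M) (\<phi> ` W) (\<lambda>x. tcomp \<phi> (coord_field M U \<phi> i (inv_into U \<phi> x)) j)" if j: "j \<in> index M" for j
    by (rule smooth_on_coords_cong[OF op smooth_on_coords_const[of _ _ "if j = i then 1 else 0"]])
      (use tcomp_coord_field[OF U _ i j] U W(2) in \<open>auto simp: subset_iff\<close>)
qed

end

section \<open>Connections and Christoffel symbols\<close>

locale affine_atlas = atlas M for M :: "('p, 'i) mfd" +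
  fixes nab :: "(real \<Rightarrow> 'p) set \<Rightarrow> ('p \<Rightarrow> (real \<Rightarrow> 'p) set) \<Rightarrow> (real \<Rightarrow> 'p) set"
  assumes affine: "affine_connection M nab"
begin

lemmas affine_on = affine[unfolded affine_connection_def, THEN spec, THEN mp]

lemma nab_tlinear:
  assumes "openin (mfd_topology M) W" "vector_field_on M W Y" "p \<in> W"
  shows "tlinear M p M p (\<lambda>v. nab v Y)"
  by (rule affine_on[OF assms(1), THEN conjunct1, THEN spec, THEN spec, THEN mp, OF conjI[OF assms(2,3)]])

lemma nab_in_tangent_space:
  assumes "openin (mfd_topology M) W" "vector_field_on M W Y" "p \<in> W" "v \<in> tangent_space M p"
  shows "nab v Y \<in> tangent_space M p"
  using nab_tlinear[OF assms(1-3)] assms(4) unfolding tlinear_def by blast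

lemma nab_tadd:
  assumes "openin (mfd_topology M) W" "vector_field_on M W Y" "vector_field_on M W Z" "p \<in> W" "v \<in> tangent_space M p"
  shows "nab v (\<lambda>q. tadd M (Y q) (Z q)) = tadd M (nab v Y) (nab v Z)"
  by (rule affine_on[OF assms(1), THEN conjunct2, THEN conjunct1, THEN spec, THEN spec, THEN spec, THEN mp,
        OF conjI[OF assms(2) conjI[OF assms(3,4)]], THEN bspec, OF assms(5)])

lemma nab_tscale:
  assumes "openin (mfd_topology M) W" "smooth_fun_on M W f" "vector_field_on M W Y" "p \<in> W" "v \<in> tangent_space M p"
  shows "nab v (\<lambda>q. tscale M (f q) (Y q)) =
    tadd M (tscale M (dir_deriv v f) (Y p)) (tscale M (f p) (nab v Y))"
  by (rule affine_on[OF assms(1), THEN conjunct2, THEN conjunct2, THEN conjunct1, THEN spec, THEN spec, THEN spec, THEN mp,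
        OF conjI[OF assms(2) conjI[OF assms(3,4)]], THEN bspec, OF assms(5)])

lemma nab_cong:
  assumes "openin (mfd_topology M) W" "vector_field_on M W Y" "vector_field_on M W Z"
    "\<And>q. q \<in> W \<Longrightarrow> Y q = Z q" "p \<in> W" "v \<in> tangent_space M p"
  shows "nab v Y = nab v Z"
proof -
  have "\<forall>q\<in>W. Y q = Z q" using assms(4) by blast
  from affine_on[OF assms(1), THEN conjunct2, THEN conjunct2, THEN conjunct2, THEN conjunct1, THEN spec, THEN spec,
      THEN spec, THEN mp, OF conjI[OF assms(2) conjI[OF assms(3) conjI[OF this assms(5)]]], THEN bspec, OF assms(6)]
  show ?thesis .
qed

lemma nab_vector_field:
  assumes "openin (mfd_topology M) W" "vector_field_on M W X" "vector_field_on M W Y"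
  shows "vector_field_on M W (\<lambda>p. nab (X p) Y)"
  by (rule affine_on[OF assms(1), THEN conjunct2, THEN conjunct2, THEN conjunct2, THEN conjunct2, THEN spec, THEN spec,
        THEN mp, OF conjI[OF assms(2,3)]])

lemma christoffel_smooth:
  assumes U: "(U, \<phi>) \<in> charts M" and "i \<in> index M" "j \<in> index M" "l \<in> index M"
  shows "smooth_on_coords (index M) (\<phi> ` U) (\<lambda>x. christoffel M nab U \<phi> i j l (inv_into U \<phi> x))"
  unfolding christoffel_def
  using vector_field_onD[OF nab_vector_field[OF chart_openin[OF U] coord_field_vector_field[OF U assms(2)]
    coord_field_vector_field[OF U assms(3)]] chart_openin[OF U] order_refl U assms(4)] chart_openin[OF U] by simp

text \<open>The Leibniz rule for a field with component functions \<open>f b\<close> in a coordinate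
  frame. The axioms treat sums of two fields and single function multiples, so one frame field is
  added at a time; the subset \<open>B\<close> serves this induction.\<close>

lemma nab_frame_expand:
  assumes V: "(V, \<psi>) \<in> charts M" and W: "openin (mfd_topology M) W" "W \<subseteq> V" and p: "p \<in> W"
    and v: "v \<in> tangent_space M p" and c: "c \<in> index M"
    and f: "\<And>b. b \<in> index M \<Longrightarrow> smooth_on_coords (index M) (\<psi> ` W) (\<lambda>x. f b (inv_into V \<psi> x))"
    and B: "B \<subseteq> index M"
  shows "tcomp \<psi> (nab v (\<lambda>q. tvec V \<psi> q (\<lambda>b. if b \<in> B then f b q else 0))) c =
    (\<Sum>b\<in>B. (if b = c then dir_deriv v (f b) else 0) + f b p * tcomp \<psi> (nab v (coord_field M V \<psi> b)) c)"
proof -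
  define Y where "Y B q = tvec V \<psi> q (\<lambda>b. if b \<in> B then f b q else 0)" for B q
  have WV: "\<And>q. q \<in> W \<Longrightarrow> q \<in> V" using W by blast
  have op: "openin (powertop_real (index M)) (\<psi> ` W)" using openin_chart_image[OF W(1) V] W(2) by (simp add: Int_absorb2)
  have Y: "Y B q \<in> tangent_space M q" "\<And>j. j \<in> index M \<Longrightarrow> tcomp \<psi> (Y B q) j = (if j \<in> B then f j q else 0)"
    if "q \<in> W" for B q
    unfolding Y_def using WV[OF that] by (simp_all add: tvec_in_tangent_space[OF V] tcomp_tvec[OF V])
  have vY: "vector_field_on M W (Y B)" for B
  proof (rule vector_field_onI[OF W V Y(1)])
    fix j assume j: "j \<in> index M"
    have "smooth_on_coords (index M) (\<psi> ` W) (\<lambda>x. if j \<in> B then f j (inv_into V \<psi> x) else 0)"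
      using f[OF j] smooth_on_coords_const by (cases "j \<in> B") auto
    then show "smooth_on_coords (index M) (\<psi> ` W) (\<lambda>x. tcomp \<psi> (Y B (inv_into V \<psi> x)) j)"
      by (rule smooth_on_coords_cong[OF op]) (use Y(2)[OF _ j] V WV in auto)
  qed
  have pV: "p \<in> V" using WV p by blast
  have "B \<subseteq> index M \<Longrightarrow> tcomp \<psi> (nab v (Y B)) c =
    (\<Sum>b\<in>B. (if b = c then dir_deriv v (f b) else 0) + f b p * tcomp \<psi> (nab v (coord_field M V \<psi> b)) c)" if "finite B" for B
    using that
  proof (induction B)
    case empty
    have s: "smooth_fun_on M W (\<lambda>_. 0)" by (rule smooth_fun_onI[OF W V smooth_on_coords_const])
    \<comment> \<open>The zero field is 0 times itself, so the Leibniz rule with the constant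
      function 0 forces the components of its derivative to vanish.\<close>
    have e: "Y {} q = tscale M 0 (Y {} q)" if "q \<in> W" for q
      by (rule tangent_eqI[OF Y(1)[OF that] tscale_in_tangent_space[OF Y(1)[OF that]] V WV[OF that]])
        (simp add: Y(2)[OF that] tcomp_tscale[OF Y(1)[OF that] V WV[OF that]])
    note n = nab_in_tangent_space[OF W(1) vY p v]
    have "nab v (Y {}) = nab v (\<lambda>q. tscale M 0 (Y {} q))"
      by (rule nab_cong[OF W(1) vY vector_field_on_cong[OF vY W V e] e p v])
    also have "\<dots> = tadd M (tscale M (dir_deriv v (\<lambda>_. 0)) (Y {} p)) (tscale M 0 (nab v (Y {})))"
      using nab_tscale[OF W(1) s vY p v] .
    finally have "tcomp \<psi> (nab v (Y {})) c =
        tcomp \<psi> (tadd M (tscale M (dir_deriv v (\<lambda>_. 0)) (Y {} p)) (tscale M 0 (nab v (Y {})))) c" by simp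
    then show ?case
      by (simp add: tcomp_tadd[OF tscale_in_tangent_space[OF Y(1)[OF p]] tscale_in_tangent_space[OF n] V pV c]
        tcomp_tscale[OF n V pV c] tcomp_tscale[OF Y(1)[OF p] V pV c] Y(2)[OF p c])
  next
    case (insert b B)
    then have b: "b \<in> index M" by simp
    define Z where "Z q = tscale M (f b q) (coord_field M V \<psi> b q)" for q
    have cf: "coord_field M V \<psi> b q \<in> tangent_space M q" if "q \<in> W" for q
      by (rule coord_field_in_tangent_space[OF V WV[OF that] b])
    have vcf: "vector_field_on M W (coord_field M V \<psi> b)" by (rule coord_field_vector_field[OF V b W])
    have Z: "Z q \<in> tangent_space M q" "\<And>j. j \<in> index M \<Longrightarrow> tcomp \<psi> (Z q) j = (if j = b then f b q else 0)"
      if "q \<in> W" for q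
      unfolding Z_def
      by (simp_all add: tscale_in_tangent_space[OF cf[OF that]] tcomp_tscale[OF cf[OF that] V WV[OF that]]
          tcomp_coord_field[OF V WV[OF that] b])
    have vZ: "vector_field_on M W Z"
    proof (rule vector_field_onI[OF W V Z(1)])
      fix j assume j: "j \<in> index M"
      have "smooth_on_coords (index M) (\<psi> ` W) (\<lambda>x. if j = b then f b (inv_into V \<psi> x) else 0)"
        using f[OF b] smooth_on_coords_const by (cases "j = b") auto
      then show "smooth_on_coords (index M) (\<psi> ` W) (\<lambda>x. tcomp \<psi> (Z (inv_into V \<psi> x)) j)"
        by (rule smooth_on_coords_cong[OF op]) (use Z(2)[OF _ j] V WV in auto)
    qed
    have e: "Y (insert b B) q = tadd M (Y B q) (Z q)" if "q \<in> W" for q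
      by (rule tangent_eqI[OF Y(1)[OF that] tadd_in_tangent_space[OF Y(1)[OF that] Z(1)[OF that]] V WV[OF that]])
        (use insert.hyps in \<open>simp add: Y(2)[OF that] tcomp_tadd[OF Y(1)[OF that] Z(1)[OF that] V WV[OF that]] Z(2)[OF that]\<close>)
    have sf: "smooth_fun_on M W (f b)" by (rule smooth_fun_onI[OF W V f[OF b]])
    note nY = nab_in_tangent_space[OF W(1) vY p v] and nZ = nab_in_tangent_space[OF W(1) vZ p v]
      and nc = nab_in_tangent_space[OF W(1) vcf p v]
    have "nab v (Y (insert b B)) = nab v (\<lambda>q. tadd M (Y B q) (Z q))"
      by (rule nab_cong[OF W(1) vY vector_field_on_cong[OF vY W V e] e p v])
    also have "\<dots> = tadd M (nab v (Y B)) (nab v Z)" by (rule nab_tadd[OF W(1) vY vZ p v])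
    finally have 1: "tcomp \<psi> (nab v (Y (insert b B))) c = tcomp \<psi> (nab v (Y B)) c + tcomp \<psi> (nab v Z) c"
      using tcomp_tadd[OF nY nZ V pV c] by simp
    have "nab v Z = tadd M (tscale M (dir_deriv v (f b)) (coord_field M V \<psi> b p)) (tscale M (f b p) (nab v (coord_field M V \<psi> b)))"
      unfolding Z_def by (rule nab_tscale[OF W(1) sf vcf p v])
    then have "tcomp \<psi> (nab v Z) c =
        (if b = c then dir_deriv v (f b) else 0) + f b p * tcomp \<psi> (nab v (coord_field M V \<psi> b)) c"
      using tcomp_tadd[OF tscale_in_tangent_space[OF cf[OF p]] tscale_in_tangent_space[OF nc] V pV c]
        tcomp_tscale[OF nc V pV c] tcomp_tscale[OF cf[OF p] V pV c] tcomp_coord_field[OF V pV b c] by auto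
    then show ?case using 1 insert by simp
  qed
  from this[OF finite_subset[OF B finite_index] B] show ?thesis unfolding Y_def .
qed

text \<open>Both sides are the \<open>c\<close>-th \<psi>-component of the derivative of the
  \<open>j\<close>-th coordinate field of \<phi> along the \<open>i\<close>-th one. The left
  converts its \<phi>-components. The right expands the field in the frame of \<psi>, where its
  components are Jacobian entries, and the Leibniz rule then produces the second
  derivatives.\<close>

lemma christoffel_transform:
  assumes U: "(U, \<phi>) \<in> charts M" "p \<in> U" and V: "(V, \<psi>) \<in> charts M" "p \<in> V"
    and i: "i \<in> index M" and j: "j \<in> index M" and c: "c \<in> index M"
  shows "(\<Sum>l\<in>index M. transition_partial U \<phi> \<psi> l c p * christoffel M nab U \<phi> i j l p) =
    partial i (partial j (\<lambda>x. \<psi> (inv_into U \<phi> x) c)) (\<phi> p) +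
    (\<Sum>b\<in>index M. transition_partial U \<phi> \<psi> j b p *
      (\<Sum>a\<in>index M. transition_partial U \<phi> \<psi> i a p * christoffel M nab V \<psi> a b c p))"
proof -
  define W where "W = U \<inter> V"
  have W: "openin (mfd_topology M) W" "W \<subseteq> U" "W \<subseteq> V" "p \<in> W"
    using openin_Int[OF chart_openin[OF U(1)] chart_openin[OF V(1)]] U V by (auto simp: W_def)
  have opU: "openin (powertop_real (index M)) (\<phi> ` W)" using overlap_open[OF U(1) V(1)] by (simp add: W_def)
  have opV: "openin (powertop_real (index M)) (\<psi> ` W)" using overlap_open[OF V(1) U(1)] by (simp add: W_def Int_commute)
  define f where "f b q = partial j (\<lambda>x. \<psi> (inv_into U \<phi> x) b) (\<phi> q)" for b q
  have dF: "smooth_on_coords (index M) (\<phi> ` W) (partial j (\<lambda>x. \<psi> (inv_into U \<phi> x) b))" if "b \<in> index M" for b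
    using smooth_on_coords_partial[OF transition_smooth[OF U(1) V(1) that] j] by (simp add: W_def)
  have f: "smooth_on_coords (index M) (\<psi> ` W) (\<lambda>x. f b (inv_into V \<psi> x))" if b: "b \<in> index M" for b
    unfolding f_def
  proof (rule smooth_on_coords_compose[OF finite_index opU opV _ dF[OF b]])
    show "\<phi> (inv_into V \<psi> y) \<in> \<phi> ` W" if "y \<in> \<psi> ` W" for y using that V(1) by (auto simp: W_def)
    show "smooth_on_coords (index M) (\<psi> ` W) (\<lambda>y. \<phi> (inv_into V \<psi> y) k)" if "k \<in> index M" for k
      using transition_smooth[OF V(1) U(1) that] by (simp add: W_def Int_commute)
  qed
  define v where "v = coord_field M U \<phi> i p"
  have v: "v \<in> tangent_space M p" unfolding v_def by (rule coord_field_in_tangent_space[OF U i])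
  note vcf = coord_field_vector_field[OF U(1) j W(1,2)]
  have e: "coord_field M U \<phi> j q = tvec V \<psi> q (\<lambda>b. if b \<in> index M then f b q else 0)" if "q \<in> W" for q
  proof -
    have q: "q \<in> U" "q \<in> V" using that by (auto simp: W_def)
    show ?thesis
      by (rule tangent_eqI[OF coord_field_in_tangent_space[OF U(1) q(1) j] tvec_in_tangent_space[OF V(1) q(2)] V(1) q(2)])
        (simp add: tcomp_coord_field_change[OF U(1) q(1) V(1) q(2) j] tcomp_tvec[OF V(1) q(2)] transition_partial_def f_def)
  qed
  have "nab v (coord_field M U \<phi> j) = nab v (\<lambda>q. tvec V \<psi> q (\<lambda>b. if b \<in> index M then f b q else 0))"
    by (rule nab_cong[OF W(1) vcf vector_field_on_cong[OF vcf W(1,2) U(1) e] e W(4) v])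
  then have "tcomp \<psi> (nab v (coord_field M U \<phi> j)) c =
     (\<Sum>b\<in>index M. (if b = c then dir_deriv v (f b) else 0) + f b p * tcomp \<psi> (nab v (coord_field M V \<psi> b)) c)"
    using nab_frame_expand[OF V(1) W(1,3,4) v c f order_refl] by simp
  also have "\<dots> = dir_deriv v (f c) + (\<Sum>b\<in>index M. f b p * tcomp \<psi> (nab v (coord_field M V \<psi> b)) c)"
    using finite_index c by (simp add: sum.distrib sum.delta)
  also have "dir_deriv v (f c) = partial i (partial j (\<lambda>x. \<psi> (inv_into U \<phi> x) c)) (\<phi> p)"
  proof -
    have "\<phi> p \<in> \<phi> ` W" using W(4) by blast
    from dir_deriv_chart[OF v U opU this dF[OF c]]
    have "dir_deriv v (f c) = (\<Sum>k\<in>index M. partial k (partial j (\<lambda>x. \<psi> (inv_into U \<phi> x) c)) (\<phi> p) * tcomp \<phi> v k)"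
      by (simp add: f_def[abs_def])
    then show ?thesis using finite_index i
      by (simp add: v_def tcomp_coord_field[OF U i] if_distrib sum.delta cong: if_cong)
  qed
  also have "(\<Sum>b\<in>index M. f b p * tcomp \<psi> (nab v (coord_field M V \<psi> b)) c) =
    (\<Sum>b\<in>index M. transition_partial U \<phi> \<psi> j b p *
      (\<Sum>a\<in>index M. transition_partial U \<phi> \<psi> i a p * christoffel M nab V \<psi> a b c p))"
  proof (rule sum.cong[OF refl])
    fix b assume b: "b \<in> index M"
    note L = nab_tlinear[OF chart_openin[OF V(1)] coord_field_vector_field[OF V(1) b chart_openin[OF V(1)] order_refl] V(2)]
    have "tcomp \<psi> (nab v (coord_field M V \<psi> b)) c =
        (\<Sum>a\<in>index M. tcomp \<psi> v a * tcomp \<psi> (nab (coord_field M V \<psi> a p) (coord_field M V \<psi> b)) c)"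
      by (rule tlinear_expand[OF L V V v c])
    then show "f b p * tcomp \<psi> (nab v (coord_field M V \<psi> b)) c = transition_partial U \<phi> \<psi> j b p *
      (\<Sum>a\<in>index M. transition_partial U \<phi> \<psi> i a p * christoffel M nab V \<psi> a b c p)"
      by (simp add: f_def transition_partial_def christoffel_def v_def
          tcomp_coord_field_change[OF U V i, unfolded transition_partial_def])
  qed
  also have "tcomp \<psi> (nab v (coord_field M U \<phi> j)) c =
      (\<Sum>l\<in>index M. transition_partial U \<phi> \<psi> l c p * christoffel M nab U \<phi> i j l p)"
    unfolding christoffel_def v_def[symmetric]
    by (rule tcomp_change_chart[OF nab_in_tangent_space[OF W(1) vcf W(4) v] U V c])
  finally show ?thesis .
qed

text \<open>The description in \<open>cov_deriv_along\<close> prescribes components in all charts;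
  they belong to one vector because the second derivatives of the transition map, which appear when
  transformed components are differentiated, match the inhomogeneous term in the law of the
  Christoffel symbols.\<close>

lemma
  assumes U: "(U, \<phi>) \<in> charts M" and cu: "curve_in U \<phi> \<epsilon> c" and t: "\<bar>t\<bar> < \<epsilon>"
    and X: "\<And>r. \<bar>r\<bar> < \<epsilon> \<Longrightarrow> X r \<in> tangent_space M (c r)"
    and sm: "\<And>i. i \<in> index M \<Longrightarrow> smooth_ivl \<epsilon> (\<lambda>r. tcomp \<phi> (X r) i)"
  shows cov_deriv_in_tangent_space: "cov_deriv_along M nab c X t \<in> tangent_space M (c t)"
    and tcomp_cov_deriv: "l \<in> index M \<Longrightarrow> tcomp \<phi> (cov_deriv_along M nab c X t) l =
      deriv (\<lambda>r. tcomp \<phi> (X r) l) t + (\<Sum>i\<in>index M. \<Sum>j\<in>index M.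
        christoffel M nab U \<phi> i j l (c t) * deriv (\<lambda>r. \<phi> (c r) i) t * tcomp \<phi> (X t) j)"
proof -
  define a where "a V \<psi> l = deriv (\<lambda>r. tcomp \<psi> (X r) l) t + (\<Sum>i\<in>index M. \<Sum>j\<in>index M.
    christoffel M nab V \<psi> i j l (c t) * tcomp \<psi> (velocity M c t) i * tcomp \<psi> (X t) j)"
    for V :: "'p set" and \<psi> :: "'p \<Rightarrow> 'i \<Rightarrow> real" and l
  have ct: "c t \<in> U" using cu t by (auto simp: curve_in_def)
  note vel = velocity_in_tangent_space[OF cu t U] tcomp_velocity[OF cu t U]
  have tr: "a V \<psi> j = (\<Sum>i\<in>index M. transition_partial U \<phi> \<psi> i j (c t) * a U \<phi> i)"
    if V: "(V, \<psi>) \<in> charts M" "c t \<in> V" and j: "j \<in> index M" for V \<psi> j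
  proof -
    define F where "F x = \<psi> (inv_into U \<phi> x) j" for x
    have F: "smooth_on_coords (index M) (\<phi> ` (U \<inter> V)) F" unfolding F_def by (rule transition_smooth[OF U V(1) j])
    have mem: "\<phi> (c t) \<in> \<phi> ` (U \<inter> V)" using ct V by blast
    have "((\<lambda>r. \<Sum>l\<in>index M. partial l F (\<phi> (c r)) * tcomp \<phi> (X r) l) has_real_derivative
       (\<Sum>l\<in>index M. (\<Sum>i\<in>index M. partial i (partial l F) (\<phi> (c t)) * deriv (\<lambda>r. \<phi> (c r) i) t) * tcomp \<phi> (X t) l +
          partial l F (\<phi> (c t)) * deriv (\<lambda>r. tcomp \<phi> (X r) l) t)) (at t)"
    proof (rule DERIV_sum)
      fix l assume l: "l \<in> index M"
      have d1: "((\<lambda>r. partial l F (\<phi> (c r))) has_real_derivative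
          (\<Sum>i\<in>index M. partial i (partial l F) (\<phi> (c t)) * deriv (\<lambda>r. \<phi> (c r) i) t)) (at t)"
        by (rule DERIV_along_curve[OF U cu overlap_open[OF U V(1)] mem smooth_on_coords_partial[OF F l] t])
      have d2: "((\<lambda>r. tcomp \<phi> (X r) l) has_real_derivative deriv (\<lambda>r. tcomp \<phi> (X r) l) t) (at t)"
        by (rule smooth_ivl_DERIV[OF sm[OF l] t])
      show "((\<lambda>r. partial l F (\<phi> (c r)) * tcomp \<phi> (X r) l) has_real_derivative
          (\<Sum>i\<in>index M. partial i (partial l F) (\<phi> (c t)) * deriv (\<lambda>r. \<phi> (c r) i) t) * tcomp \<phi> (X t) l +
          partial l F (\<phi> (c t)) * deriv (\<lambda>r. tcomp \<phi> (X r) l) t) (at t)"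
        by (rule DERIV_cong[OF DERIV_mult[OF d1 d2]]) simp
    qed
    \<comment> \<open>The curve is known to be in both charts only near \<open>t\<close>, which
      suffices for a derivative at \<open>t\<close>.\<close>
    moreover have "\<forall>\<^sub>F r in nhds t. (\<Sum>l\<in>index M. partial l F (\<phi> (c r)) * tcomp \<phi> (X r) l) = tcomp \<psi> (X r) j"
      using curve_eventually_in[OF cu t U V] eventually_abs_less[OF t]
    proof eventually_elim
      case (elim r)
      then show ?case
        using tcomp_change_chart[OF X U _ V(1) _ j, of r] by (simp add: transition_partial_def F_def[abs_def])
    qed
    ultimately have D: "deriv (\<lambda>r. tcomp \<psi> (X r) j) t =
       (\<Sum>l\<in>index M. (\<Sum>i\<in>index M. partial i (partial l F) (\<phi> (c t)) * deriv (\<lambda>r. \<phi> (c r) i) t) * tcomp \<phi> (X t) l +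
          partial l F (\<phi> (c t)) * deriv (\<lambda>r. tcomp \<phi> (X r) l) t)"
      by (rule DERIV_imp_deriv[OF DERIV_cong_eventually])
    have T: "(\<Sum>m\<in>index M. partial m F (\<phi> (c t)) * christoffel M nab U \<phi> i l m (c t)) =
        partial i (partial l F) (\<phi> (c t)) + (\<Sum>b\<in>index M. transition_partial U \<phi> \<psi> l b (c t) *
          (\<Sum>a\<in>index M. transition_partial U \<phi> \<psi> i a (c t) * christoffel M nab V \<psi> a b j (c t)))"
      if "i \<in> index M" "l \<in> index M" for i l
      using christoffel_transform[OF U ct V that j] by (simp add: transition_partial_def F_def[abs_def])
    have "a V \<psi> j = (\<Sum>l\<in>index M. (\<Sum>i\<in>index M. partial i (partial l F) (\<phi> (c t)) * deriv (\<lambda>r. \<phi> (c r) i) t) * tcomp \<phi> (X t) l +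
          partial l F (\<phi> (c t)) * deriv (\<lambda>r. tcomp \<phi> (X r) l) t) +
        (\<Sum>a\<in>index M. \<Sum>b\<in>index M. christoffel M nab V \<psi> a b j (c t) *
          (\<Sum>i\<in>index M. transition_partial U \<phi> \<psi> i a (c t) * deriv (\<lambda>r. \<phi> (c r) i) t) *
          (\<Sum>l\<in>index M. transition_partial U \<phi> \<psi> l b (c t) * tcomp \<phi> (X t) l))"
      unfolding a_def D
      by (simp add: tcomp_change_chart[OF vel(1) U ct V] tcomp_change_chart[OF X[OF t] U ct V] vel(2))
    also have "\<dots> = (\<Sum>m\<in>index M. partial m F (\<phi> (c t)) * (deriv (\<lambda>r. tcomp \<phi> (X r) m) t +
        (\<Sum>i\<in>index M. \<Sum>l\<in>index M. christoffel M nab U \<phi> i l m (c t) * deriv (\<lambda>r. \<phi> (c r) i) t * tcomp \<phi> (X t) l)))"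
      by (rule covariant_derivative_change_of_frame[OF T])
    also have "\<dots> = (\<Sum>i\<in>index M. transition_partial U \<phi> \<psi> i j (c t) * a U \<phi> i)"
      by (intro sum.cong refl) (simp add: a_def transition_partial_def F_def[abs_def] vel(2))
    finally show ?thesis .
  qed
  from theI'[OF tangent_vector_ex1[where a = a, OF U ct tr]]
  have *: "cov_deriv_along M nab c X t \<in> tangent_space M (c t) \<and>
    (\<forall>(V, \<psi>)\<in>charts M. c t \<in> V \<longrightarrow> (\<forall>l\<in>index M. tcomp \<psi> (cov_deriv_along M nab c X t) l = a V \<psi> l))"
    unfolding cov_deriv_along_def a_def .
  then show "cov_deriv_along M nab c X t \<in> tangent_space M (c t)" ..
  have "tcomp \<phi> (cov_deriv_along M nab c X t) l = a U \<phi> l" if "l \<in> index M"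
    using * U ct that by blast
  then show "l \<in> index M \<Longrightarrow> tcomp \<phi> (cov_deriv_along M nab c X t) l =
      deriv (\<lambda>r. tcomp \<phi> (X r) l) t + (\<Sum>i\<in>index M. \<Sum>j\<in>index M.
        christoffel M nab U \<phi> i j l (c t) * deriv (\<lambda>r. \<phi> (c r) i) t * tcomp \<phi> (X t) j)"
    by (simp add: a_def vel(2))
qed

end

section \<open>Families of curves\<close>

lemma openin_powertop_bool_0:
  assumes W: "openin (powertop_real (UNIV :: bool set)) W" and z: "(\<lambda>_. 0) \<in> W"
  shows "\<exists>\<delta>>0. {x. \<bar>x False\<bar> < \<delta> \<and> \<bar>x True\<bar> < \<delta>} \<subseteq> W"
proof -
  have "\<exists>\<delta>>0. \<forall>x'\<in>extensional UNIV. (\<forall>i\<in>UNIV. \<bar>x' i - 0\<bar> < \<delta>) \<longrightarrow> x' \<in> W"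
    using openin_powertop_iff[THEN iffD1, OF finite W, THEN conjunct2, THEN bspec, OF z] .
  then obtain \<delta> where "\<delta> > 0 \<and> (\<forall>x'\<in>extensional (UNIV :: bool set). (\<forall>i\<in>UNIV. \<bar>x' i - 0\<bar> < \<delta>) \<longrightarrow> x' \<in> W)" ..
  then have "\<delta> > 0" "x \<in> W" if "\<bar>x False\<bar> < \<delta>" "\<bar>x True\<bar> < \<delta>" for x
    using that by (simp_all add: extensional_def) (metis (full_types))
  then show ?thesis
    using \<open>\<delta> > 0 \<and> _\<close> by (intro exI[of _ \<delta>]) auto
qed

abbreviation square :: "real \<Rightarrow> (bool \<Rightarrow> real) set" where
  "square \<epsilon> \<equiv> {x. \<bar>x False\<bar> < \<epsilon> \<and> \<bar>x True\<bar> < \<epsilon>}"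

abbreviation pt :: "real \<Rightarrow> real \<Rightarrow> bool \<Rightarrow> real" where
  "pt s t \<equiv> (\<lambda>z. if z then t else s)"

lemma pt_upd [simp]: "(pt s t)(True := r) = pt s r" "(pt s t)(False := r) = pt r t"
  by auto

lemma smooth_ivl_pt: "smooth_ivl \<epsilon> (\<lambda>t. pt s t i)" "smooth_ivl \<epsilon> (\<lambda>s. pt s t i)"
  by (cases i; simp add: smooth_ivl_const smooth_ivl_id)+

lemma smooth_ivl_section:
  assumes "smooth_on_coords UNIV (square \<epsilon>) F"
  shows "\<bar>s\<bar> < \<epsilon> \<Longrightarrow> smooth_ivl \<epsilon> (\<lambda>t. F (pt s t))"
    and "\<bar>t\<bar> < \<epsilon> \<Longrightarrow> smooth_ivl \<epsilon> (\<lambda>s. F (pt s t))"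
proof -
  show "smooth_ivl \<epsilon> (\<lambda>t. F (pt s t))" if "\<bar>s\<bar> < \<epsilon>"
    by (rule smooth_ivl_compose[where g = "\<lambda>t. pt s t", OF finite openin_bool_box assms])
      (use that smooth_ivl_pt in auto)
  show "smooth_ivl \<epsilon> (\<lambda>s. F (pt s t))" if "\<bar>t\<bar> < \<epsilon>"
    by (rule smooth_ivl_compose[where g = "\<lambda>s. pt s t", OF finite openin_bool_box assms])
      (use that smooth_ivl_pt in auto)
qed

section \<open>Families in a chart and their variation fields\<close>

context atlas begin

definition family_in :: "'p set \<Rightarrow> ('p \<Rightarrow> 'i \<Rightarrow> real) \<Rightarrow> real \<Rightarrow> (real \<Rightarrow> real \<Rightarrow> 'p) \<Rightarrow> bool" where
  "family_in U \<phi> \<epsilon> \<gamma> \<longleftrightarrow> \<epsilon> > 0 \<and> (\<forall>s t. \<bar>s\<bar> < \<epsilon> \<longrightarrow> \<bar>t\<bar> < \<epsilon> \<longrightarrow> \<gamma> s t \<in> U) \<and>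
    (\<forall>i\<in>index M. smooth_on_coords UNIV (square \<epsilon>) (\<lambda>x. \<phi> (\<gamma> (x False) (x True)) i))"

lemma family_in_pos: "family_in U \<phi> \<epsilon> \<gamma> \<Longrightarrow> \<epsilon> > 0"
  by (simp add: family_in_def)

lemma family_in_mono: "family_in U \<phi> \<epsilon> \<gamma> \<Longrightarrow> 0 < \<delta> \<Longrightarrow> \<delta> \<le> \<epsilon> \<Longrightarrow> family_in U \<phi> \<delta> \<gamma>"
  unfolding family_in_def by (auto intro: smooth_on_coords_subset[of UNIV "square \<epsilon>"])

lemma smooth_family_chart:
  assumes g: "smooth_family M \<gamma>" and U: "(U, \<phi>) \<in> charts M" "\<gamma> 0 0 \<in> U"
  obtains \<epsilon> where "family_in U \<phi> \<epsilon> \<gamma>"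
proof -
  obtain e where e: "e > 0" "smooth_map_on (coord_space (UNIV :: bool set)) M (square e) (\<lambda>x. \<gamma> (x False) (x True))"
    using g unfolding smooth_family_def by blast
  obtain W where W: "openin (powertop_real (UNIV :: bool set)) W" "(\<lambda>_. 0) \<in> W" "(\<lambda>x. \<gamma> (x False) (x True)) ` W \<subseteq> U"
    "\<And>j. j \<in> index M \<Longrightarrow> smooth_on_coords UNIV W (\<lambda>x. \<phi> (\<gamma> (x False) (x True)) j)"
  proof (rule smooth_map_from_coords[of UNIV "square e" "\<lambda>x. \<gamma> (x False) (x True)" "\<lambda>_. 0" U \<phi>,
        OF finite e(2) _ _ U(1)], goal_cases)
    case 1 then show ?case using e(1) by simp
  next
    case 2 then show ?case by (simp add: extensional_def)
  next
    case 3 then show ?case using U(2) by simp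
  next
    case (4 W) then show ?case by (intro 4(1))
  qed
  obtain d where d: "d > 0" "square d \<subseteq> W"
    using openin_powertop_bool_0[OF W(1,2)] by blast
  have "family_in U \<phi> d \<gamma>"
    unfolding family_in_def
  proof (intro conjI allI impI ballI)
    show "\<gamma> s t \<in> U" if "\<bar>s\<bar> < d" "\<bar>t\<bar> < d" for s t
    proof -
      have "pt s t \<in> W" using d(2) that by auto
      from subsetD[OF W(3) imageI[OF this]] show ?thesis by simp
    qed
    show "smooth_on_coords UNIV (square d) (\<lambda>x. \<phi> (\<gamma> (x False) (x True)) i)" if "i \<in> index M" for i
      using smooth_on_coords_subset[OF W(4)[OF that] d(2)] .
  qed (rule d)
  then show ?thesis by (rule that)
qed

lemma family_in_smooth_family:
  assumes "(U, \<phi>) \<in> charts M" "family_in U \<phi> \<epsilon> \<gamma>"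
  shows "smooth_family M \<gamma>"
  unfolding smooth_family_def
  using assms by (intro exI[of _ \<epsilon>] conjI smooth_map_from_coordsI[OF openin_bool_box assms(1)])
    (auto simp: family_in_def)

lemma family_in_curves:
  assumes "family_in U \<phi> \<epsilon> \<gamma>"
  shows "\<bar>s\<bar> < \<epsilon> \<Longrightarrow> curve_in U \<phi> \<epsilon> (\<gamma> s)" and "\<bar>t\<bar> < \<epsilon> \<Longrightarrow> curve_in U \<phi> \<epsilon> (\<lambda>s. \<gamma> s t)"
proof -
  have sm: "smooth_on_coords UNIV (square \<epsilon>) (\<lambda>x. \<phi> (\<gamma> (x False) (x True)) i)" if "i \<in> index M" for i
    using assms that by (simp add: family_in_def)
  show "curve_in U \<phi> \<epsilon> (\<gamma> s)" if "\<bar>s\<bar> < \<epsilon>"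
    using assms that smooth_ivl_section(1)[OF sm that] by (simp add: curve_in_def family_in_def)
  show "curve_in U \<phi> \<epsilon> (\<lambda>s. \<gamma> s t)" if "\<bar>t\<bar> < \<epsilon>"
    using assms that smooth_ivl_section(2)[OF sm that] by (simp add: curve_in_def family_in_def)
qed

definition variation :: "(real \<Rightarrow> real \<Rightarrow> 'p) \<Rightarrow> real \<Rightarrow> (real \<Rightarrow> 'p) set" where
  "variation \<gamma> t = velocity M (\<lambda>s. \<gamma> s t) 0"

lemma
  assumes f: "family_in U \<phi> \<epsilon> \<gamma>" and U: "(U, \<phi>) \<in> charts M" and t: "\<bar>t\<bar> < \<epsilon>"
  shows variation_in_tangent_space: "variation \<gamma> t \<in> tangent_space M (\<gamma> 0 t)"
    and tcomp_variation: "i \<in> index M \<Longrightarrow> tcomp \<phi> (variation \<gamma> t) i = deriv (\<lambda>s. \<phi> (\<gamma> s t) i) 0"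
  unfolding variation_def
  using velocity_in_tangent_space[OF family_in_curves(2)[OF f t] _ U, of 0]
    tcomp_velocity[OF family_in_curves(2)[OF f t] _ U, of 0] family_in_pos[OF f] by simp_all

lemma tcomp_variation_partial:
  assumes f: "family_in U \<phi> \<epsilon> \<gamma>" and U: "(U, \<phi>) \<in> charts M" and t: "\<bar>t\<bar> < \<epsilon>" and i: "i \<in> index M"
  shows "tcomp \<phi> (variation \<gamma> t) i = partial False (\<lambda>x. \<phi> (\<gamma> (x False) (x True)) i) (pt 0 t)"
  unfolding tcomp_variation[OF f U t i] by (simp add: partial_def)

lemma smooth_variation:
  assumes f: "family_in U \<phi> \<epsilon> \<gamma>" and U: "(U, \<phi>) \<in> charts M" and i: "i \<in> index M"
  shows "smooth_ivl \<epsilon> (\<lambda>t. tcomp \<phi> (variation \<gamma> t) i)"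
proof -
  have "smooth_on_coords UNIV (square \<epsilon>) (partial False (\<lambda>x. \<phi> (\<gamma> (x False) (x True)) i))"
    using f i by (intro smooth_on_coords_partial) (auto simp: family_in_def)
  from smooth_ivl_section(1)[OF this, of 0] family_in_pos[OF f]
  have "smooth_ivl \<epsilon> (\<lambda>t. partial False (\<lambda>x. \<phi> (\<gamma> (x False) (x True)) i) (pt 0 t))" by simp
  then show ?thesis
    by (rule smooth_ivl_cong) (simp add: tcomp_variation_partial[OF f U _ i])
qed

section \<open>The velocity of the curve of jets\<close>

definition jet_velocity :: "nat \<Rightarrow> (real \<Rightarrow> real \<Rightarrow> 'p) \<Rightarrow> (real \<Rightarrow> (real \<Rightarrow> 'p) set) set" where
  "jet_velocity k \<gamma> = velocity (jet_mfd M k) (\<lambda>s. jet M k (\<gamma> s)) 0"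

lemma
  assumes f: "family_in U \<phi> \<epsilon> \<gamma>" and U: "(U, \<phi>) \<in> charts M"
  shows jet_velocity_in_tangent_space: "jet_velocity k \<gamma> \<in> tangent_space (jet_mfd M k) (jet M k (\<gamma> 0))"
    and tcomp_jet_velocity: "i \<in> index M \<Longrightarrow> b \<le> k \<Longrightarrow> tcomp (jet_coord M k \<phi>) (jet_velocity k \<gamma>) (b, i) =
      (deriv ^^ b) (\<lambda>t. tcomp \<phi> (variation \<gamma> t) i) 0 / fact b"
proof -
  interpret N: atlas "jet_mfd M k" by (rule atlas_jet_mfd)
  let ?D = "{u \<in> points (jet_mfd M k). foot u \<in> U}"
  note D = jet_chart_mem[OF U, of k]
  note pos = family_in_pos[OF f]
  define F where "F i x = \<phi> (\<gamma> (x False) (x True)) i" for i x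
  have F: "smooth_on_coords UNIV (square \<epsilon>) (F i)" if "i \<in> index M" for i
    using f that by (simp add: family_in_def F_def[abs_def])
  have sc: "smooth_curve M (\<gamma> s)" "\<gamma> s 0 \<in> U" if "\<bar>s\<bar> < \<epsilon>" for s
    using curve_in_smooth_curve[OF U family_in_curves(1)[OF f that]] curve_in_0[OF family_in_curves(1)[OF f that]] .
  have jc: "jet_coord M k \<phi> (jet M k (\<gamma> s)) (b, i) = (partial True ^^ b) (F i) (pt s 0) / fact b"
    if "\<bar>s\<bar> < \<epsilon>" "i \<in> index M" "b \<le> k" for s b i
    using jet_coord_jet[OF sc(1)[OF that(1)] U sc(2)[OF that(1)] that(2,3)]
    unfolding partial_funpow by (simp add: F_def)
  \<comment> \<open>In the jet chart the coordinates of the curve of jets are iterated t-derivatives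
    of a smooth function of two variables, restricted to t = 0; hence the curve is smooth.\<close>
  have ci: "N.curve_in ?D (jet_coord M k \<phi>) \<epsilon> (\<lambda>s. jet M k (\<gamma> s))"
    unfolding N.curve_in_def
  proof (intro conjI allI impI ballI)
    show "jet M k (\<gamma> s) \<in> ?D" if "\<bar>s\<bar> < \<epsilon>" for s
      using jet_in_points[OF sc(1)[OF that], of k] foot_jet[OF sc(1)[OF that], of k] sc(2)[OF that] by simp
    fix z assume "z \<in> index (jet_mfd M k)"
    then obtain b i where z: "z = (b, i)" "b \<le> k" "i \<in> index M" by auto
    have "smooth_ivl \<epsilon> (\<lambda>s. (1 / fact b) * (partial True ^^ b) (F i) (pt s 0))"
      by (intro smooth_ivl_mult smooth_ivl_const smooth_ivl_section(2) smooth_on_coords_partial_funpow F z) (use pos in auto)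
    then show "smooth_ivl \<epsilon> (\<lambda>s. jet_coord M k \<phi> (jet M k (\<gamma> s)) z)"
      by (rule smooth_ivl_cong) (simp add: z(1) jc[OF _ z(3,2)])
  qed (rule pos)
  have 0: "\<bar>0\<bar> < \<epsilon>" using pos by simp
  show "jet_velocity k \<gamma> \<in> tangent_space (jet_mfd M k) (jet M k (\<gamma> 0))"
    unfolding jet_velocity_def by (rule N.velocity_in_tangent_space[OF ci 0 D])
  show "tcomp (jet_coord M k \<phi>) (jet_velocity k \<gamma>) (b, i) = (deriv ^^ b) (\<lambda>t. tcomp \<phi> (variation \<gamma> t) i) 0 / fact b"
    if i: "i \<in> index M" and b: "b \<le> k"
  proof -
    have "tcomp (jet_coord M k \<phi>) (jet_velocity k \<gamma>) (b, i) = deriv (\<lambda>s. jet_coord M k \<phi> (jet M k (\<gamma> s)) (b, i)) 0"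
      unfolding jet_velocity_def using N.tcomp_velocity[OF ci 0 D, of "(b, i)"] i b by simp
    also have "\<dots> = deriv (\<lambda>s. (1 / fact b) * (partial True ^^ b) (F i) (pt s 0)) 0"
      by (rule deriv_cong_ivl[OF _ 0]) (simp add: jc[OF _ i b])
    also have "\<dots> = (1 / fact b) * deriv (\<lambda>s. (partial True ^^ b) (F i) (pt s 0)) 0"
      using smooth_ivl_section(2)[OF smooth_on_coords_partial_funpow[OF F[OF i]], of True 0 b] pos
      by (intro DERIV_imp_deriv DERIV_cmult smooth_ivl_DERIV[of \<epsilon>]) auto
    also have "deriv (\<lambda>s. (partial True ^^ b) (F i) (pt s 0)) 0 = partial False ((partial True ^^ b) (F i)) (pt 0 0)"
      by (simp only: partial_def[of False] pt_upd if_False)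
    also have "\<dots> = (partial True ^^ b) (partial False (F i)) (pt 0 0)"
      by (rule partial_funpow_commute[OF finite openin_bool_box F[OF i]]) (use pos in auto)
    also have "\<dots> = (deriv ^^ b) (\<lambda>t. partial False (F i) (pt 0 t)) 0"
      by (simp only: partial_funpow[where j = True] pt_upd if_True)
    also have "\<dots> = (deriv ^^ b) (\<lambda>t. tcomp \<phi> (variation \<gamma> t) i) 0"
      by (rule higher_deriv_cong_ivl[OF _ 0]) (simp add: tcomp_variation_partial[OF f U _ i] F_def[abs_def])
    finally show ?thesis by simp
  qed
qed

text \<open>The straight line \<open>y + s v\<close> in the jet chart, with each of its points
  replaced by the polynomial curve that has these coordinates.\<close>

definition poly_family :: "'p set \<Rightarrow> ('p \<Rightarrow> 'i \<Rightarrow> real) \<Rightarrow> nat \<Rightarrow> (nat \<times> 'i \<Rightarrow> real) \<Rightarrow> (nat \<times> 'i \<Rightarrow> real) \<Rightarrow> real \<Rightarrow> real \<Rightarrow> 'p" where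
  "poly_family U \<phi> k y v s = poly_curve U \<phi> k (\<lambda>z. y z + s * v z)"

lemma poly_family_in:
  assumes U: "(U, \<phi>) \<in> charts M" and y: "base_coords y \<in> \<phi> ` U"
  obtains \<epsilon> where "family_in U \<phi> \<epsilon> (poly_family U \<phi> k y v)"
    "\<And>s t. \<bar>s\<bar> < \<epsilon> \<Longrightarrow> \<bar>t\<bar> < \<epsilon> \<Longrightarrow> \<phi> (poly_family U \<phi> k y v s t) = poly_coords k (\<lambda>z. y z + s * v z) t"
proof -
  define G where "G x = poly_coords k (\<lambda>z. y z + x False * v z) (x True)" for x
  have op: "openin (powertop_real (UNIV :: bool set)) UNIV" using openin_extensional[of "UNIV :: bool set"] by (simp add: extensional_def)
  have G: "smooth_on_coords (UNIV :: bool set) S (\<lambda>x. G x i)" if "i \<in> index M" "openin (powertop_real (UNIV :: bool set)) S" for i S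
    using that unfolding G_def poly_coords_def
    by (simp, intro smooth_on_coords_sum smooth_on_coords_mult smooth_on_coords_add smooth_on_coords_power
        smooth_on_coords_proj smooth_on_coords_const) auto
  have "openin (powertop_real (UNIV :: bool set)) {x \<in> UNIV. G x \<in> \<phi> ` U}"
    by (rule openin_preimage_coords[OF op chart_open[OF U] _ G[OF _ op]]) (simp_all add: G_def)
  moreover have "(\<lambda>_. 0) \<in> {x \<in> UNIV. G x \<in> \<phi> ` U}" using y by (simp add: G_def poly_coords_0)
  ultimately obtain \<epsilon> where e: "\<epsilon> > 0" "square \<epsilon> \<subseteq> {x \<in> UNIV. G x \<in> \<phi> ` U}"
    using openin_powertop_bool_0 by blast
  have m: "poly_coords k (\<lambda>z. y z + s * v z) t \<in> \<phi> ` U" if "\<bar>s\<bar> < \<epsilon>" "\<bar>t\<bar> < \<epsilon>" for s t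
  proof -
    have "pt s t \<in> square \<epsilon>" using that by simp
    from subsetD[OF e(2) this] show ?thesis by (simp add: G_def)
  qed
  have eq: "\<phi> (poly_family U \<phi> k y v s t) = poly_coords k (\<lambda>z. y z + s * v z) t" "poly_family U \<phi> k y v s t \<in> U"
    if "\<bar>s\<bar> < \<epsilon>" "\<bar>t\<bar> < \<epsilon>" for s t
    using m[OF that] U by (auto simp: poly_family_def poly_curve_def)
  have "family_in U \<phi> \<epsilon> (poly_family U \<phi> k y v)"
    unfolding family_in_def
  proof (intro conjI allI impI ballI)
    show "smooth_on_coords UNIV (square \<epsilon>) (\<lambda>x. \<phi> (poly_family U \<phi> k y v (x False) (x True)) i)" if "i \<in> index M" for i
      by (rule smooth_on_coords_cong[OF openin_bool_box G[OF that openin_bool_box]]) (use eq in \<open>simp add: G_def\<close>)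
  qed (use e eq in auto)
  then show ?thesis using that eq by blast
qed

lemma tcomp_variation_poly_family:
  assumes U: "(U, \<phi>) \<in> charts M" and f: "family_in U \<phi> \<epsilon> (poly_family U \<phi> k y v)"
    and eq: "\<And>s t. \<bar>s\<bar> < \<epsilon> \<Longrightarrow> \<bar>t\<bar> < \<epsilon> \<Longrightarrow> \<phi> (poly_family U \<phi> k y v s t) = poly_coords k (\<lambda>z. y z + s * v z) t"
    and t: "\<bar>t\<bar> < \<epsilon>" and i: "i \<in> index M"
  shows "tcomp \<phi> (variation (poly_family U \<phi> k y v) t) i = poly_coords k v t i"
proof -
  have 0: "\<bar>0\<bar> < \<epsilon>" using family_in_pos[OF f] by simp
  have "tcomp \<phi> (variation (poly_family U \<phi> k y v) t) i = deriv (\<lambda>s. \<phi> (poly_family U \<phi> k y v s t) i) 0"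
    by (rule tcomp_variation[OF f U t i])
  also have "\<dots> = deriv (\<lambda>s. \<Sum>b\<le>k. (y (b, i) + s * v (b, i)) * t ^ b) 0"
    by (rule deriv_cong_ivl[OF _ 0]) (use eq t i in \<open>simp add: poly_coords_def\<close>)
  also have "\<dots> = (\<Sum>b\<le>k. v (b, i) * t ^ b)"
    by (rule DERIV_imp_deriv) (auto intro!: derivative_eq_intros)
  finally show ?thesis using i by (simp add: poly_coords_def)
qed

text \<open>The variation field is the polynomial with coefficients \<open>v\<close>, so its
  normalised derivatives at 0 are the components of \<open>X\<close>.\<close>

lemma poly_family_adapted:
  assumes U: "(U, \<phi>) \<in> charts M" and X: "X \<in> points (TB (jet_mfd M k))" and foot: "foot (foot X) \<in> U"
  shows "adapted M k X (poly_family U \<phi> k (jet_coord M k \<phi> (foot X)) (tcomp (jet_coord M k \<phi>) X))"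
proof -
  interpret N: atlas "jet_mfd M k" by (rule atlas_jet_mfd)
  define u where "u = foot X"
  have XT: "X \<in> tangent_space (jet_mfd M k) u" unfolding u_def by (rule N.tangent_spaceI[OF X refl])
  have u: "u \<in> points (jet_mfd M k)" by (rule N.tangent_spaceD(6)[OF XT])
  define y where "y = jet_coord M k \<phi> u"
  define v where "v = tcomp (jet_coord M k \<phi>) X"
  have uU: "foot u \<in> U" using foot by (simp add: u_def)
  have y: "base_coords y \<in> \<phi> ` U" using base_coords_jet_coord[OF u U uU] uU by (simp add: y_def)
  let ?g = "poly_family U \<phi> k y v"
  obtain \<epsilon> where f: "family_in U \<phi> \<epsilon> ?g"
    and eq: "\<And>s t. \<bar>s\<bar> < \<epsilon> \<Longrightarrow> \<bar>t\<bar> < \<epsilon> \<Longrightarrow> \<phi> (?g s t) = poly_coords k (\<lambda>z. y z + s * v z) t"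
    using poly_family_in[OF U y, of k v] by blast
  have g0: "?g 0 = poly_curve U \<phi> k y" by (simp add: poly_family_def)
  note s = poly_curve_smooth[OF U y, of k]
  have j: "jet M k (?g 0) = u"
    unfolding g0
  proof (rule jet_coord_inj[OF jet_in_points[OF s] u U _ uU])
    show "foot (jet M k (poly_curve U \<phi> k y)) \<in> U" using foot_jet[OF s] poly_curve_0(2)[OF U y] by simp
    show "jet_coord M k \<phi> (jet M k (poly_curve U \<phi> k y)) (b, i) = jet_coord M k \<phi> u (b, i)"
      if "i \<in> index M" "b \<le> k" for i b
      using jet_coord_poly_curve[OF U y that] by (simp add: y_def)
  qed
  have "jet_velocity k ?g = X"
  proof (rule N.tangent_eqI[OF _ XT jet_chart_mem[OF U, of k]])
    show "jet_velocity k ?g \<in> tangent_space (jet_mfd M k) u"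
      using jet_velocity_in_tangent_space[OF f U, of k] unfolding j .
    show "u \<in> {u \<in> points (jet_mfd M k). foot u \<in> U}" using u uU by simp
    fix z assume "z \<in> index (jet_mfd M k)"
    then obtain b i where z: "z = (b, i)" "b \<le> k" "i \<in> index M" by auto
    have "(deriv ^^ b) (\<lambda>t. tcomp \<phi> (variation ?g t) i) 0 = (deriv ^^ b) (\<lambda>t. \<Sum>b\<le>k. v (b, i) * t ^ b) 0"
      by (rule higher_deriv_cong_ivl[where \<epsilon> = \<epsilon>])
        (use tcomp_variation_poly_family[OF U f eq _ z(3)] family_in_pos[OF f] z in \<open>simp_all add: poly_coords_def\<close>)
    then show "tcomp (jet_coord M k \<phi>) (jet_velocity k ?g) z = tcomp (jet_coord M k \<phi>) X z"
      using tcomp_jet_velocity[OF f U z(3,2)] higher_deriv_polynomial_0[OF z(2), of "\<lambda>b. v (b, i)"]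
      by (simp add: z(1) v_def)
  qed
  then show ?thesis
    using family_in_smooth_family[OF U f] j unfolding adapted_def
    by (simp add: jet_velocity_def y_def v_def u_def)
qed

section \<open>Adapted families\<close>

lemma adaptedD:
  assumes "adapted M k X \<gamma>"
  shows "smooth_family M \<gamma>" "jet M k (\<gamma> 0) = foot X" "jet_velocity k \<gamma> = X"
  using assms by (simp_all add: adapted_def jet_velocity_def)

lemma smooth_family_0_mem: "smooth_family M \<gamma> \<Longrightarrow> \<gamma> 0 0 \<in> points M"
  unfolding smooth_family_def smooth_map_on_def by fastforce

lemma obtain_family_chart:
  assumes "smooth_family M \<gamma>"
  obtains U \<phi> \<epsilon> where "(U, \<phi>) \<in> charts M" "family_in U \<phi> \<epsilon> \<gamma>"
  using obtain_chart[OF smooth_family_0_mem[OF assms]] smooth_family_chart[OF assms] by metis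

text \<open>A smooth family is adapted, at every order, to the velocity that it generates there; one
  family can therefore be used at several orders at once.\<close>

lemma smooth_family_adapted:
  assumes "smooth_family M \<gamma>"
  shows "adapted M k (jet_velocity k \<gamma>) \<gamma>" "jet_velocity k \<gamma> \<in> points (TB (jet_mfd M k))"
    "foot (jet_velocity k \<gamma>) = jet M k (\<gamma> 0)" "foot (foot (jet_velocity k \<gamma>)) = \<gamma> 0 0"
proof -
  interpret N: atlas "jet_mfd M k" by (rule atlas_jet_mfd)
  obtain U \<phi> \<epsilon> where U: "(U, \<phi>) \<in> charts M" "family_in U \<phi> \<epsilon> \<gamma>" using obtain_family_chart[OF assms] .
  note v = jet_velocity_in_tangent_space[OF U(2,1), of k]
  show "jet_velocity k \<gamma> \<in> points (TB (jet_mfd M k))" by (rule N.tangent_spaceD(1)[OF v])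
  show f: "foot (jet_velocity k \<gamma>) = jet M k (\<gamma> 0)" by (rule N.tangent_spaceD(2)[OF v])
  show "adapted M k (jet_velocity k \<gamma>) \<gamma>" using assms f by (simp add: adapted_def jet_velocity_def)
  have "\<bar>0\<bar> < \<epsilon>" using family_in_pos[OF U(2)] by simp
  then show "foot (foot (jet_velocity k \<gamma>)) = \<gamma> 0 0"
    unfolding f by (intro foot_jet curve_in_smooth_curve[OF U(1) family_in_curves(1)[OF U(2)]])
qed

lemma adapted_exists:
  assumes X: "X \<in> points (TB (jet_mfd M k))"
  obtains \<gamma> where "adapted M k X \<gamma>"
proof -
  interpret N: atlas "jet_mfd M k" by (rule atlas_jet_mfd)
  have "foot X \<in> points (jet_mfd M k)" using N.jet_pointsD(4)[OF X] .
  then have "foot (foot X) \<in> points M" by (rule jet_pointsD)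
  then obtain U \<phi> where "(U, \<phi>) \<in> charts M" "foot (foot X) \<in> U" by (rule obtain_chart)
  then show ?thesis using poly_family_adapted[OF _ X] that by blast
qed

end

section \<open>The covariant derivative in coordinates\<close>

context affine_atlas begin

definition smooth_coords :: "real \<Rightarrow> (real \<Rightarrow> 'i \<Rightarrow> real) \<Rightarrow> bool" where
  "smooth_coords \<epsilon> W \<longleftrightarrow> (\<forall>i\<in>index M. smooth_ivl \<epsilon> (\<lambda>t. W t i))"

definition coord_curve :: "'p set \<Rightarrow> ('p \<Rightarrow> 'i \<Rightarrow> real) \<Rightarrow> real \<Rightarrow> (real \<Rightarrow> 'i \<Rightarrow> real) \<Rightarrow> bool" where
  "coord_curve U \<phi> \<epsilon> c \<longleftrightarrow> \<epsilon> > 0 \<and> (\<forall>t. \<bar>t\<bar> < \<epsilon> \<longrightarrow> c t \<in> \<phi> ` U) \<and> smooth_coords \<epsilon> c"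

text \<open>The covariant derivative on bare component functions along a curve given by its
  coordinates. Sums, multiples and polynomials can be inserted directly, without first making
  tangent vectors of them.\<close>

definition cov :: "'p set \<Rightarrow> ('p \<Rightarrow> 'i \<Rightarrow> real) \<Rightarrow> (real \<Rightarrow> 'i \<Rightarrow> real) \<Rightarrow> (real \<Rightarrow> 'i \<Rightarrow> real) \<Rightarrow> real \<Rightarrow> 'i \<Rightarrow> real" where
  "cov U \<phi> c W t l = deriv (\<lambda>r. W r l) t + (\<Sum>i\<in>index M. \<Sum>j\<in>index M.
     christoffel M nab U \<phi> i j l (inv_into U \<phi> (c t)) * deriv (\<lambda>r. c r i) t * W t j)"

lemma smooth_coordsD: "smooth_coords \<epsilon> W \<Longrightarrow> i \<in> index M \<Longrightarrow> smooth_ivl \<epsilon> (\<lambda>t. W t i)"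
  by (simp add: smooth_coords_def)

lemma coord_curve_pos: "coord_curve U \<phi> \<epsilon> c \<Longrightarrow> \<epsilon> > 0"
  by (simp add: coord_curve_def)

lemma coord_curve_mem: "coord_curve U \<phi> \<epsilon> c \<Longrightarrow> \<bar>t\<bar> < \<epsilon> \<Longrightarrow> c t \<in> \<phi> ` U"
  by (simp add: coord_curve_def)

lemma coord_curve_smooth: "coord_curve U \<phi> \<epsilon> c \<Longrightarrow> i \<in> index M \<Longrightarrow> smooth_ivl \<epsilon> (\<lambda>t. c t i)"
  by (simp add: coord_curve_def smooth_coords_def)

lemma curve_in_coord_curve: "curve_in U \<phi> \<epsilon> c \<Longrightarrow> coord_curve U \<phi> \<epsilon> (\<lambda>t. \<phi> (c t))"
  by (simp add: curve_in_def coord_curve_def smooth_coords_def)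

lemma smooth_christoffel_curve:
  assumes U: "(U, \<phi>) \<in> charts M" and c: "coord_curve U \<phi> \<epsilon> c" and "i \<in> index M" "j \<in> index M" "l \<in> index M"
  shows "smooth_ivl \<epsilon> (\<lambda>t. christoffel M nab U \<phi> i j l (inv_into U \<phi> (c t)))"
  by (rule smooth_ivl_compose[where g = c, OF finite_index chart_open[OF U] christoffel_smooth[OF U assms(3-5)]
    coord_curve_mem[OF c] coord_curve_smooth[OF c]])

lemma smooth_cov:
  assumes U: "(U, \<phi>) \<in> charts M" and c: "coord_curve U \<phi> \<epsilon> c" and W: "smooth_coords \<epsilon> W"
  shows "smooth_coords \<epsilon> (cov U \<phi> c W)"
  unfolding smooth_coords_def cov_def
  by (intro ballI smooth_ivl_add smooth_ivl_sum smooth_ivl_mult smooth_christoffel_curve[OF U c]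
      smooth_ivl_deriv[of _ "\<lambda>r. W r _"] smooth_ivl_deriv[of _ "\<lambda>r. c r _"] smooth_coordsD[OF W] coord_curve_smooth[OF c])

lemma smooth_cov_funpow:
  assumes "(U, \<phi>) \<in> charts M" "coord_curve U \<phi> \<epsilon> c" "smooth_coords \<epsilon> W"
  shows "smooth_coords \<epsilon> ((cov U \<phi> c ^^ a) W)"
  using assms by (induction a) (auto intro: smooth_cov)

lemma cov_cong:
  assumes c: "\<And>t. \<bar>t\<bar> < \<epsilon> \<Longrightarrow> c t = c' t" and W: "\<And>t i. \<bar>t\<bar> < \<epsilon> \<Longrightarrow> i \<in> index M \<Longrightarrow> W t i = W' t i"
    and t: "\<bar>t\<bar> < \<epsilon>" and l: "l \<in> index M"
  shows "cov U \<phi> c W t l = cov U \<phi> c' W' t l"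
proof -
  have "deriv (\<lambda>r. W r l) t = deriv (\<lambda>r. W' r l) t" by (rule deriv_cong_ivl[OF W[OF _ l] t])
  moreover have "deriv (\<lambda>r. c r i) t = deriv (\<lambda>r. c' r i) t" for i by (rule deriv_cong_ivl[OF _ t]) (simp add: c)
  ultimately show ?thesis using c[OF t] W[OF t] by (simp add: cov_def)
qed

lemma cov_funpow_cong:
  assumes c: "\<And>t. \<bar>t\<bar> < \<epsilon> \<Longrightarrow> c t = c' t" and W: "\<And>t i. \<bar>t\<bar> < \<epsilon> \<Longrightarrow> i \<in> index M \<Longrightarrow> W t i = W' t i"
  shows "\<bar>t\<bar> < \<epsilon> \<Longrightarrow> l \<in> index M \<Longrightarrow> (cov U \<phi> c ^^ a) W t l = (cov U \<phi> c' ^^ a) W' t l"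
proof (induction a arbitrary: t l)
  case (Suc a)
  show ?case using cov_cong[OF c Suc.IH Suc.prems] by simp
qed (use W in simp)

lemma cov_add:
  assumes W: "smooth_coords \<epsilon> W" and W': "smooth_coords \<epsilon> W'" and t: "\<bar>t\<bar> < \<epsilon>" and l: "l \<in> index M"
  shows "cov U \<phi> c (\<lambda>t i. W t i + W' t i) t l = cov U \<phi> c W t l + cov U \<phi> c W' t l"
  unfolding cov_def deriv_add_ivl[OF smooth_coordsD[OF W l] smooth_coordsD[OF W' l] t]
  by (simp add: distrib_left sum.distrib)

lemma cov_scale:
  assumes W: "smooth_coords \<epsilon> W" and t: "\<bar>t\<bar> < \<epsilon>" and l: "l \<in> index M"
  shows "cov U \<phi> c (\<lambda>t i. r * W t i) t l = r * cov U \<phi> c W t l"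
proof -
  have "deriv (\<lambda>t. r * W t l) t = r * deriv (\<lambda>t. W t l) t"
    by (rule DERIV_imp_deriv, rule DERIV_cmult[OF smooth_ivl_DERIV[OF smooth_coordsD[OF W l] t]])
  then show ?thesis by (simp add: cov_def distrib_left sum_distrib_left mult_ac)
qed

lemma cov_times_id:
  assumes W: "smooth_coords \<epsilon> W" and t: "\<bar>t\<bar> < \<epsilon>" and l: "l \<in> index M"
  shows "cov U \<phi> c (\<lambda>t i. t * W t i) t l = t * cov U \<phi> c W t l + W t l"
proof -
  have "deriv (\<lambda>t. t * W t l) t = W t l + t * deriv (\<lambda>t. W t l) t"
    using deriv_mult_ivl[OF smooth_ivl_id smooth_coordsD[OF W l] t] by simp
  then show ?thesis by (simp add: cov_def distrib_left sum_distrib_left mult_ac)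
qed

lemma smooth_coords_scale: "smooth_coords \<epsilon> W \<Longrightarrow> smooth_coords \<epsilon> (\<lambda>t i. r * W t i)"
  by (simp add: smooth_coords_def smooth_ivl_mult smooth_ivl_const)

lemma smooth_coords_times_id: "smooth_coords \<epsilon> W \<Longrightarrow> smooth_coords \<epsilon> (\<lambda>t i. t * W t i)"
  by (simp add: smooth_coords_def smooth_ivl_mult smooth_ivl_id)

section \<open>Powers of the coordinate operator\<close>

lemma cov_funpow_add:
  assumes U: "(U, \<phi>) \<in> charts M" and c: "coord_curve U \<phi> \<epsilon> c" and W: "smooth_coords \<epsilon> W" and W': "smooth_coords \<epsilon> W'"
  shows "\<bar>t\<bar> < \<epsilon> \<Longrightarrow> l \<in> index M \<Longrightarrow> (cov U \<phi> c ^^ a) (\<lambda>t i. W t i + W' t i) t l =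
    (cov U \<phi> c ^^ a) W t l + (cov U \<phi> c ^^ a) W' t l"
proof (induction a arbitrary: t l)
  case (Suc a)
  have "(cov U \<phi> c ^^ Suc a) (\<lambda>t i. W t i + W' t i) t l =
      cov U \<phi> c (\<lambda>t i. (cov U \<phi> c ^^ a) W t i + (cov U \<phi> c ^^ a) W' t i) t l"
    using cov_cong[OF refl Suc.IH Suc.prems] by simp
  also have "\<dots> = (cov U \<phi> c ^^ Suc a) W t l + (cov U \<phi> c ^^ Suc a) W' t l"
    using cov_add[OF smooth_cov_funpow[OF U c W] smooth_cov_funpow[OF U c W'] Suc.prems] by simp
  finally show ?case .
qed simp

lemma cov_funpow_scale:
  assumes U: "(U, \<phi>) \<in> charts M" and c: "coord_curve U \<phi> \<epsilon> c" and W: "smooth_coords \<epsilon> W"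
  shows "\<bar>t\<bar> < \<epsilon> \<Longrightarrow> l \<in> index M \<Longrightarrow> (cov U \<phi> c ^^ a) (\<lambda>t i. r * W t i) t l = r * (cov U \<phi> c ^^ a) W t l"
proof (induction a arbitrary: t l)
  case (Suc a)
  have "(cov U \<phi> c ^^ Suc a) (\<lambda>t i. r * W t i) t l = cov U \<phi> c (\<lambda>t i. r * (cov U \<phi> c ^^ a) W t i) t l"
    using cov_cong[OF refl Suc.IH Suc.prems] by simp
  also have "\<dots> = r * (cov U \<phi> c ^^ Suc a) W t l"
    using cov_scale[OF smooth_cov_funpow[OF U c W] Suc.prems] by simp
  finally show ?case .
qed simp

text \<open>The operator sends t W to t times its value on W, plus W itself; moving t past the
  \<open>a\<close>-th power leaves \<open>a\<close> copies of the power below. For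
  \<open>a = 0\<close> the truncated \<open>a - 1\<close> is harmless because of the factor
  \<open>a\<close>.\<close>

lemma cov_funpow_times_id:
  assumes U: "(U, \<phi>) \<in> charts M" and c: "coord_curve U \<phi> \<epsilon> c" and W: "smooth_coords \<epsilon> W"
  shows "\<bar>t\<bar> < \<epsilon> \<Longrightarrow> l \<in> index M \<Longrightarrow> (cov U \<phi> c ^^ a) (\<lambda>t i. t * W t i) t l =
    t * (cov U \<phi> c ^^ a) W t l + real a * (cov U \<phi> c ^^ (a - 1)) W t l"
proof (induction a arbitrary: t l)
  case (Suc a)
  note s = smooth_cov_funpow[OF U c W]
  have "(cov U \<phi> c ^^ Suc a) (\<lambda>t i. t * W t i) t l =
      cov U \<phi> c (\<lambda>t i. t * (cov U \<phi> c ^^ a) W t i + real a * (cov U \<phi> c ^^ (a - 1)) W t i) t l"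
    using cov_cong[OF refl Suc.IH Suc.prems] by simp
  also have "\<dots> = cov U \<phi> c (\<lambda>t i. t * (cov U \<phi> c ^^ a) W t i) t l +
      cov U \<phi> c (\<lambda>t i. real a * (cov U \<phi> c ^^ (a - 1)) W t i) t l"
    by (rule cov_add[OF smooth_coords_times_id[OF s] smooth_coords_scale[OF s] Suc.prems])
  also have "\<dots> = t * cov U \<phi> c ((cov U \<phi> c ^^ a) W) t l + (cov U \<phi> c ^^ a) W t l +
      real a * cov U \<phi> c ((cov U \<phi> c ^^ (a - 1)) W) t l"
    using cov_times_id[OF s Suc.prems] cov_scale[OF s Suc.prems] by simp
  also have "real a * cov U \<phi> c ((cov U \<phi> c ^^ (a - 1)) W) t l = real a * (cov U \<phi> c ^^ a) W t l"
    by (cases a) simp_all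
  finally show ?case by (simp add: algebra_simps)
qed simp

text \<open>The operator differentiates components and curve once each, which costs one order of
  contact; the Christoffel symbols along the two curves keep theirs by
  \<open>jet_eq_compose\<close>.\<close>

lemma cov_jet_eq:
  assumes U: "(U, \<phi>) \<in> charts M" and c: "coord_curve U \<phi> \<epsilon> c" and c': "coord_curve U \<phi> \<epsilon> c'"
    and W: "smooth_coords \<epsilon> W" and W': "smooth_coords \<epsilon> W'"
    and cc: "\<And>i. i \<in> index M \<Longrightarrow> jet_eq (Suc m) (\<lambda>t. c t i) (\<lambda>t. c' t i)"
    and WW: "\<And>i. i \<in> index M \<Longrightarrow> jet_eq (Suc m) (\<lambda>t. W t i) (\<lambda>t. W' t i)" and l: "l \<in> index M"
  shows "jet_eq m (\<lambda>t. cov U \<phi> c W t l) (\<lambda>t. cov U \<phi> c' W' t l)"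
proof -
  note e = coord_curve_pos[OF c]
  have low: "jet_eq m f h" if "jet_eq (Suc m) f h" for f h using jet_eq_mono[OF that] by simp
  have d: "jet_eq m (deriv f) (deriv h)" if "jet_eq (Suc m) f h" for f h using that by (simp add: jet_eq_Suc)
  have G: "jet_eq m (\<lambda>t. christoffel M nab U \<phi> i j l (inv_into U \<phi> (c t)))
      (\<lambda>t. christoffel M nab U \<phi> i j l (inv_into U \<phi> (c' t)))" if "i \<in> index M" "j \<in> index M" for i j
    by (rule jet_eq_compose[where c = c and d = c', OF e finite_index chart_open[OF U] coord_curve_mem[OF c] coord_curve_smooth[OF c]
      coord_curve_mem[OF c'] coord_curve_smooth[OF c'] christoffel_smooth[OF U that l] low[OF cc]])
  show ?thesis
    unfolding cov_def
    by (intro jet_eq_add[OF e] jet_eq_sum[OF e] jet_eq_mult[OF e] smooth_ivl_sum smooth_ivl_mult G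
        smooth_christoffel_curve[OF U c] smooth_christoffel_curve[OF U c'] smooth_ivl_deriv[of _ "\<lambda>r. W r _"]
        smooth_ivl_deriv[of _ "\<lambda>r. W' r _"] smooth_ivl_deriv[of _ "\<lambda>r. c r _"] smooth_ivl_deriv[of _ "\<lambda>r. c' r _"]
        smooth_coordsD[OF W] smooth_coordsD[OF W'] coord_curve_smooth[OF c] coord_curve_smooth[OF c'] l
        d[OF WW] d[OF cc] low[OF WW])
qed

text \<open>Contact of order \<open>m + a\<close> is spent one order per application, so
  \<open>m\<close> varies in the induction; the case of interest is \<open>m = 0\<close>.\<close>

lemma cov_funpow_jet_eq:
  assumes U: "(U, \<phi>) \<in> charts M" and c: "coord_curve U \<phi> \<epsilon> c" and c': "coord_curve U \<phi> \<epsilon> c'"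
    and W: "smooth_coords \<epsilon> W" and W': "smooth_coords \<epsilon> W'"
  shows "(\<And>i. i \<in> index M \<Longrightarrow> jet_eq (m + a) (\<lambda>t. c t i) (\<lambda>t. c' t i)) \<Longrightarrow>
    (\<And>i. i \<in> index M \<Longrightarrow> jet_eq (m + a) (\<lambda>t. W t i) (\<lambda>t. W' t i)) \<Longrightarrow> l \<in> index M \<Longrightarrow>
    jet_eq m (\<lambda>t. (cov U \<phi> c ^^ a) W t l) (\<lambda>t. (cov U \<phi> c' ^^ a) W' t l)"
proof (induction a arbitrary: m l)
  case (Suc a)
  have "jet_eq m (\<lambda>t. cov U \<phi> c ((cov U \<phi> c ^^ a) W) t l) (\<lambda>t. cov U \<phi> c' ((cov U \<phi> c' ^^ a) W') t l)"
  proof (rule cov_jet_eq[OF U c c' smooth_cov_funpow[OF U c W] smooth_cov_funpow[OF U c' W'] _ _ Suc.prems(3)])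
    show "jet_eq (Suc m) (\<lambda>t. c t i) (\<lambda>t. c' t i)" if "i \<in> index M" for i
      using jet_eq_mono[OF Suc.prems(1)[OF that]] by simp
    show "jet_eq (Suc m) (\<lambda>t. (cov U \<phi> c ^^ a) W t i) (\<lambda>t. (cov U \<phi> c' ^^ a) W' t i)" if "i \<in> index M" for i
      by (rule Suc.IH) (use Suc.prems that in simp_all)
  qed
  then show ?case by simp
qed simp

text \<open>The claim covers all small times and not just 0, because each application differentiates
  the outcome of the previous one near the point.\<close>

lemma cov_deriv_along_funpow:
  assumes U: "(U, \<phi>) \<in> charts M" and c: "curve_in U \<phi> \<epsilon> c" and W: "smooth_coords \<epsilon> W"
    and X: "\<And>t. \<bar>t\<bar> < \<epsilon> \<Longrightarrow> X t \<in> tangent_space M (c t)"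
      "\<And>t i. \<bar>t\<bar> < \<epsilon> \<Longrightarrow> i \<in> index M \<Longrightarrow> tcomp \<phi> (X t) i = W t i"
  shows "\<bar>t\<bar> < \<epsilon> \<Longrightarrow> (cov_deriv_along M nab c ^^ a) X t \<in> tangent_space M (c t) \<and>
    (\<forall>i\<in>index M. tcomp \<phi> ((cov_deriv_along M nab c ^^ a) X t) i = (cov U \<phi> (\<lambda>t. \<phi> (c t)) ^^ a) W t i)"
proof (induction a arbitrary: t)
  case 0 then show ?case using X by simp
next
  case (Suc a)
  let ?X = "(cov_deriv_along M nab c ^^ a) X" and ?c = "\<lambda>t. \<phi> (c t)"
  have Xa: "\<And>t. \<bar>t\<bar> < \<epsilon> \<Longrightarrow> ?X t \<in> tangent_space M (c t)"
    and Wa: "\<And>t i. \<bar>t\<bar> < \<epsilon> \<Longrightarrow> i \<in> index M \<Longrightarrow> tcomp \<phi> (?X t) i = (cov U \<phi> ?c ^^ a) W t i"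
    using Suc.IH by blast+
  have sm: "smooth_ivl \<epsilon> (\<lambda>r. tcomp \<phi> (?X r) i)" if "i \<in> index M" for i
    by (rule smooth_ivl_cong[OF smooth_coordsD[OF smooth_cov_funpow[OF U curve_in_coord_curve[OF c] W] that]])
      (simp add: Wa that)
  have ct: "c t \<in> U" using c Suc.prems by (simp add: curve_in_def)
  have "tcomp \<phi> (cov_deriv_along M nab c ?X t) l = cov U \<phi> ?c ((cov U \<phi> ?c ^^ a) W) t l" if l: "l \<in> index M" for l
  proof -
    have "deriv (\<lambda>r. tcomp \<phi> (?X r) l) t = deriv (\<lambda>r. (cov U \<phi> ?c ^^ a) W r l) t"
      by (rule deriv_cong_ivl[OF Wa[OF _ l] Suc.prems])
    then show ?thesis
      using tcomp_cov_deriv[OF U c Suc.prems Xa sm l] Wa[OF Suc.prems] U ct by (simp add: cov_def)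
  qed
  then show ?case using cov_deriv_in_tangent_space[OF U c Suc.prems Xa sm] by simp
qed

section \<open>Independence of the adapted family\<close>

lemma smooth_coords_variation:
  "family_in U \<phi> \<epsilon> \<gamma> \<Longrightarrow> (U, \<phi>) \<in> charts M \<Longrightarrow> smooth_coords \<epsilon> (\<lambda>t i. tcomp \<phi> (variation \<gamma> t) i)"
  using smooth_variation by (simp add: smooth_coords_def)

lemma
  assumes U: "(U, \<phi>) \<in> charts M" and f: "family_in U \<phi> \<epsilon> \<gamma>"
  shows family_cov_deriv_in_tangent_space: "family_cov_deriv M nab a \<gamma> \<in> tangent_space M (\<gamma> 0 0)"
    and tcomp_family_cov_deriv: "l \<in> index M \<Longrightarrow> tcomp \<phi> (family_cov_deriv M nab a \<gamma>) l =
      (1 / fact a) * (cov U \<phi> (\<lambda>t. \<phi> (\<gamma> 0 t)) ^^ a) (\<lambda>t i. tcomp \<phi> (variation \<gamma> t) i) 0 l"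
proof -
  have 0: "\<bar>0\<bar> < \<epsilon>" using family_in_pos[OF f] by simp
  note c = family_in_curves(1)[OF f 0]
  have *: "(cov_deriv_along M nab (\<gamma> 0) ^^ a) (variation \<gamma>) 0 \<in> tangent_space M (\<gamma> 0 0) \<and>
     (\<forall>i\<in>index M. tcomp \<phi> ((cov_deriv_along M nab (\<gamma> 0) ^^ a) (variation \<gamma>) 0) i =
       (cov U \<phi> (\<lambda>t. \<phi> (\<gamma> 0 t)) ^^ a) (\<lambda>t i. tcomp \<phi> (variation \<gamma> t) i) 0 i)"
    by (rule cov_deriv_along_funpow[OF U c smooth_coords_variation[OF f U] variation_in_tangent_space[OF f U] refl 0])
  have e: "family_cov_deriv M nab a \<gamma> = tscale M (1 / fact a) ((cov_deriv_along M nab (\<gamma> 0) ^^ a) (variation \<gamma>) 0)"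
    unfolding family_cov_deriv_def variation_def[abs_def] ..
  show "family_cov_deriv M nab a \<gamma> \<in> tangent_space M (\<gamma> 0 0)"
    unfolding e using tscale_in_tangent_space * by blast
  show "l \<in> index M \<Longrightarrow> tcomp \<phi> (family_cov_deriv M nab a \<gamma>) l =
      (1 / fact a) * (cov U \<phi> (\<lambda>t. \<phi> (\<gamma> 0 t)) ^^ a) (\<lambda>t i. tcomp \<phi> (variation \<gamma> t) i) 0 l"
    unfolding e using tcomp_tscale[OF conjunct1[OF *] U curve_in_0[OF c]] * by simp
qed

text \<open>\<open>\<nabla>\<^sup>a\<close> of the variation field at the origin only involves the \<open>a\<close>-jets of the curve and of the
  components of the field, and both are read off \<open>X\<close>.\<close>

lemma family_cov_deriv_unique:
  assumes g: "adapted M k X \<gamma>" and g': "adapted M k X \<gamma>'" and a: "a \<le> k"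
  shows "family_cov_deriv M nab a \<gamma> = family_cov_deriv M nab a \<gamma>'"
proof -
  note gD = adaptedD[OF g] and gD' = adaptedD[OF g']
  obtain U \<phi> e where U: "(U, \<phi>) \<in> charts M" and e: "family_in U \<phi> e \<gamma>" using obtain_family_chart[OF gD(1)] .
  have base: "\<gamma>' 0 0 = \<gamma> 0 0"
    using smooth_family_adapted(4)[OF gD(1), of k] smooth_family_adapted(4)[OF gD'(1), of k] gD(3) gD'(3) by simp
  have e0: "\<gamma> 0 0 \<in> U" using e by (simp add: family_in_def)
  obtain e' where e': "family_in U \<phi> e' \<gamma>'" using smooth_family_chart[OF gD'(1) U] base e0 by auto
  define \<epsilon> where "\<epsilon> = min e e'"
  have pos: "\<epsilon> > 0" "\<epsilon> \<le> e" "\<epsilon> \<le> e'" using family_in_pos[OF e] family_in_pos[OF e'] by (auto simp: \<epsilon>_def)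
  note f = family_in_mono[OF e pos(1,2)] and f' = family_in_mono[OF e' pos(1,3)]
  have 0: "\<bar>0\<bar> < \<epsilon>" using pos by simp
  note c = family_in_curves(1)[OF f 0] and c' = family_in_curves(1)[OF f' 0]
  have cc: "jet_eq k (\<lambda>t. \<phi> (\<gamma> 0 t) i) (\<lambda>t. \<phi> (\<gamma>' 0 t) i)" if i: "i \<in> index M" for i
    unfolding jet_eq_def
  proof (intro allI impI)
    fix b assume b: "b \<le> k"
    show "(deriv ^^ b) (\<lambda>t. \<phi> (\<gamma> 0 t) i) 0 = (deriv ^^ b) (\<lambda>t. \<phi> (\<gamma>' 0 t) i) 0"
      using jet_coord_jet[OF curve_in_smooth_curve[OF U c] U curve_in_0[OF c] i b]
        jet_coord_jet[OF curve_in_smooth_curve[OF U c'] U curve_in_0[OF c'] i b] gD(2) gD'(2) by simp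
  qed
  have WW: "jet_eq k (\<lambda>t. tcomp \<phi> (variation \<gamma> t) i) (\<lambda>t. tcomp \<phi> (variation \<gamma>' t) i)" if i: "i \<in> index M" for i
    unfolding jet_eq_def
  proof (intro allI impI)
    fix b assume b: "b \<le> k"
    show "(deriv ^^ b) (\<lambda>t. tcomp \<phi> (variation \<gamma> t) i) 0 = (deriv ^^ b) (\<lambda>t. tcomp \<phi> (variation \<gamma>' t) i) 0"
      using tcomp_jet_velocity[OF f U i b] tcomp_jet_velocity[OF f' U i b] gD(3) gD'(3) by simp
  qed
  \<comment> \<open>Only values at the origin are compared, that is contact of order 0 after
    \<open>a\<close> applications, so contact of order \<open>a \<le> k\<close> suffices.\<close>
  have "(cov U \<phi> (\<lambda>t. \<phi> (\<gamma> 0 t)) ^^ a) (\<lambda>t i. tcomp \<phi> (variation \<gamma> t) i) 0 l =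
      (cov U \<phi> (\<lambda>t. \<phi> (\<gamma>' 0 t)) ^^ a) (\<lambda>t i. tcomp \<phi> (variation \<gamma>' t) i) 0 l" if l: "l \<in> index M" for l
    by (rule jet_eq_0[of 0], rule cov_funpow_jet_eq[OF U curve_in_coord_curve[OF c] curve_in_coord_curve[OF c']
          smooth_coords_variation[OF f U] smooth_coords_variation[OF f' U] _ _ l])
      (use jet_eq_mono[OF cc] jet_eq_mono[OF WW] a in auto)
  moreover have t': "family_cov_deriv M nab a \<gamma>' \<in> tangent_space M (\<gamma> 0 0)"
    using family_cov_deriv_in_tangent_space[OF U f', of a] unfolding base .
  ultimately show ?thesis
    by (intro tangent_eqI[OF family_cov_deriv_in_tangent_space[OF U f] t' U e0])
      (simp add: tcomp_family_cov_deriv[OF U f] tcomp_family_cov_deriv[OF U f'])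
qed

text \<open>An adapted family at hand shows that the one chosen by \<open>SOME\<close> is adapted as
  well, and uniqueness equates the two; the map can be computed on any convenient family.\<close>

lemma induced_connection_map_eq:
  assumes g: "adapted M k X \<gamma>" and a: "\<alpha> \<in> {1..k}"
  shows "induced_connection_map M nab k X \<alpha> = family_cov_deriv M nab \<alpha> \<gamma>"
proof -
  have "adapted M k X (SOME \<gamma>. adapted M k X \<gamma>)" by (rule someI[of "adapted M k X" \<gamma>, OF g])
  from family_cov_deriv_unique[OF this g] a show ?thesis by (simp add: induced_connection_map_def)
qed

end

section \<open>Linearity and smoothness\<close>

context atlas begin

lemma poly_coords_cong:
  assumes "\<And>b i. b \<le> k \<Longrightarrow> i \<in> index M \<Longrightarrow> y (b, i) = y' (b, i)"
  shows "poly_coords k y = poly_coords k y'"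
  using assms by (intro ext) (simp add: poly_coords_def)

end

context affine_atlas begin

text \<open>In the formula the foot point enters through the curve and the components of
  \<open>X\<close> through the field. On a fixed fibre the operator is therefore fixed, and the
  expression is linear in \<open>X\<close>.\<close>

lemma
  assumes U: "(U, \<phi>) \<in> charts M" and X: "X \<in> points (TB (jet_mfd M k))" and foot: "foot (foot X) \<in> U"
    and a: "\<alpha> \<in> {1..k}"
  shows induced_connection_map_in_tangent_space: "induced_connection_map M nab k X \<alpha> \<in> tangent_space M (foot (foot X))"
    and tcomp_induced_connection_map: "l \<in> index M \<Longrightarrow> tcomp \<phi> (induced_connection_map M nab k X \<alpha>) l =
      (1 / fact \<alpha>) * (cov U \<phi> (poly_coords k (jet_coord M k \<phi> (foot X))) ^^ \<alpha>)
        (poly_coords k (tcomp (jet_coord M k \<phi>) X)) 0 l"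
proof -
  interpret N: atlas "jet_mfd M k" by (rule atlas_jet_mfd)
  let ?y = "jet_coord M k \<phi> (foot X)" and ?v = "tcomp (jet_coord M k \<phi>) X"
  let ?g = "poly_family U \<phi> k ?y ?v"
  have y: "base_coords ?y \<in> \<phi> ` U"
    unfolding base_coords_jet_coord[OF N.jet_pointsD(4)[OF X] U foot] using foot by (rule imageI)
  obtain \<epsilon> where f: "family_in U \<phi> \<epsilon> ?g"
    and eq: "\<And>s t. \<bar>s\<bar> < \<epsilon> \<Longrightarrow> \<bar>t\<bar> < \<epsilon> \<Longrightarrow> \<phi> (?g s t) = poly_coords k (\<lambda>z. ?y z + s * ?v z) t"
    using poly_family_in[OF U y, of k ?v] by blast
  note ad = poly_family_adapted[OF U X foot]
  have 0: "\<bar>0\<bar> < \<epsilon>" using family_in_pos[OF f] by simp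
  have g0: "?g 0 0 = foot (foot X)"
    using smooth_family_adapted(4)[OF adaptedD(1)[OF ad], of k] adaptedD(3)[OF ad] by simp
  note K = induced_connection_map_eq[OF ad a]
  show "induced_connection_map M nab k X \<alpha> \<in> tangent_space M (foot (foot X))"
    using family_cov_deriv_in_tangent_space[OF U f, of \<alpha>] unfolding K g0 .
  show "tcomp \<phi> (induced_connection_map M nab k X \<alpha>) l =
      (1 / fact \<alpha>) * (cov U \<phi> (poly_coords k ?y) ^^ \<alpha>) (poly_coords k ?v) 0 l" if l: "l \<in> index M"
  proof -
    have c: "\<phi> (?g 0 t) = poly_coords k ?y t" if "\<bar>t\<bar> < \<epsilon>" for t using eq[OF 0 that] by simp
    have "(cov U \<phi> (\<lambda>t. \<phi> (?g 0 t)) ^^ \<alpha>) (\<lambda>t i. tcomp \<phi> (variation ?g t) i) 0 l =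
        (cov U \<phi> (poly_coords k ?y) ^^ \<alpha>) (poly_coords k ?v) 0 l"
      by (rule cov_funpow_cong[OF c tcomp_variation_poly_family[OF U f eq] 0 l])
    then show ?thesis unfolding K tcomp_family_cov_deriv[OF U f l] by simp
  qed
qed

lemma smooth_poly_coords: "smooth_coords \<epsilon> (poly_coords k v)"
  unfolding smooth_coords_def poly_coords_def
  by (simp, intro ballI smooth_ivl_sum smooth_ivl_mult smooth_ivl_power smooth_ivl_const smooth_ivl_id)

lemma poly_coords_coord_curve:
  assumes U: "(U, \<phi>) \<in> charts M" and y: "base_coords y \<in> \<phi> ` U"
  obtains \<epsilon> where "coord_curve U \<phi> \<epsilon> (poly_coords k y)"
proof -
  obtain \<epsilon> where e: "curve_in U \<phi> \<epsilon> (poly_curve U \<phi> k y)"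
    "\<And>t. \<bar>t\<bar> < \<epsilon> \<Longrightarrow> \<phi> (poly_curve U \<phi> k y t) = poly_coords k y t" using poly_curve_in[OF U y, of k] by blast
  have "poly_coords k y t \<in> \<phi> ` U" if "\<bar>t\<bar> < \<epsilon>" for t
    unfolding e(2)[OF that, symmetric] using e(1) that by (auto simp: curve_in_def)
  moreover have "\<epsilon> > 0" using e(1) by (simp add: curve_in_def)
  ultimately have "coord_curve U \<phi> \<epsilon> (poly_coords k y)"
    unfolding coord_curve_def using smooth_poly_coords by blast
  then show ?thesis by (rule that)
qed

lemma induced_connection_map_linear:
  assumes u: "u \<in> points (jet_mfd M k)" and a: "\<alpha> \<in> {1..k}"
  shows "tlinear (jet_mfd M k) u M (foot u) (\<lambda>X. induced_connection_map M nab k X \<alpha>)"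
proof -
  interpret N: atlas "jet_mfd M k" by (rule atlas_jet_mfd)
  obtain U \<phi> where U: "(U, \<phi>) \<in> charts M" "foot u \<in> U" using obtain_chart[OF jet_pointsD(4)[OF u]] .
  let ?y = "jet_coord M k \<phi> u" and ?\<psi> = "jet_coord M k \<phi>"
  note D = jet_chart_mem[OF U(1), of k]
  have uD: "u \<in> {u \<in> points (jet_mfd M k). foot u \<in> U}" using u U(2) by (intro CollectI conjI)
  have y: "base_coords ?y \<in> \<phi> ` U"
    unfolding base_coords_jet_coord[OF u U] using U(2) by (rule imageI)
  obtain \<epsilon> where c: "coord_curve U \<phi> \<epsilon> (poly_coords k ?y)" using poly_coords_coord_curve[OF U(1) y] .
  have 0: "\<bar>0\<bar> < \<epsilon>" using coord_curve_pos[OF c] by simp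
  have K: "induced_connection_map M nab k X \<alpha> \<in> tangent_space M (foot u)"
    "\<And>l. l \<in> index M \<Longrightarrow> tcomp \<phi> (induced_connection_map M nab k X \<alpha>) l =
      (1 / fact \<alpha>) * (cov U \<phi> (poly_coords k ?y) ^^ \<alpha>) (poly_coords k (tcomp ?\<psi> X)) 0 l"
    if "X \<in> tangent_space (jet_mfd M k) u" for X
  proof -
    note XD = N.tangent_spaceD[OF that]
    have f: "foot (foot X) \<in> U" unfolding XD(2) by (rule U(2))
    show "induced_connection_map M nab k X \<alpha> \<in> tangent_space M (foot u)"
      using induced_connection_map_in_tangent_space[OF U(1) XD(1) f a] unfolding XD(2) .
    show "\<And>l. l \<in> index M \<Longrightarrow> tcomp \<phi> (induced_connection_map M nab k X \<alpha>) l =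
      (1 / fact \<alpha>) * (cov U \<phi> (poly_coords k ?y) ^^ \<alpha>) (poly_coords k (tcomp ?\<psi> X)) 0 l"
      using tcomp_induced_connection_map[OF U(1) XD(1) f a] unfolding XD(2) .
  qed
  show ?thesis
  proof (rule N.tlinearI[OF atlas_axioms jet_pointsD(4)[OF u] K(1) U])
    fix v w l assume v: "v \<in> tangent_space (jet_mfd M k) u" and w: "w \<in> tangent_space (jet_mfd M k) u" and l: "l \<in> index M"
    have "poly_coords k (tcomp ?\<psi> (tadd (jet_mfd M k) v w)) t i =
        poly_coords k (tcomp ?\<psi> v) t i + poly_coords k (tcomp ?\<psi> w) t i" if "i \<in> index M" for t i
      using that by (simp add: poly_coords_def N.tcomp_tadd[OF v w D uD] distrib_right sum.distrib)
    then have "(cov U \<phi> (poly_coords k ?y) ^^ \<alpha>) (poly_coords k (tcomp ?\<psi> (tadd (jet_mfd M k) v w))) 0 l =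
        (cov U \<phi> (poly_coords k ?y) ^^ \<alpha>) (\<lambda>t i. poly_coords k (tcomp ?\<psi> v) t i + poly_coords k (tcomp ?\<psi> w) t i) 0 l"
      by (intro cov_funpow_cong[OF refl _ 0 l])
    then show "tcomp \<phi> (induced_connection_map M nab k (tadd (jet_mfd M k) v w) \<alpha>) l =
        tcomp \<phi> (induced_connection_map M nab k v \<alpha>) l + tcomp \<phi> (induced_connection_map M nab k w \<alpha>) l"
      unfolding K(2)[OF v l] K(2)[OF w l] K(2)[OF N.tadd_in_tangent_space[OF v w] l]
      using cov_funpow_add[OF U(1) c smooth_poly_coords smooth_poly_coords 0 l] by (simp add: distrib_left add_divide_distrib)
  next
    fix r v l assume v: "v \<in> tangent_space (jet_mfd M k) u" and l: "l \<in> index M"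
    have "poly_coords k (tcomp ?\<psi> (tscale (jet_mfd M k) r v)) t i = r * poly_coords k (tcomp ?\<psi> v) t i"
      if "i \<in> index M" for t i
      using that by (simp add: poly_coords_def N.tcomp_tscale[OF v D uD] sum_distrib_left mult_ac)
    then have "(cov U \<phi> (poly_coords k ?y) ^^ \<alpha>) (poly_coords k (tcomp ?\<psi> (tscale (jet_mfd M k) r v))) 0 l =
        (cov U \<phi> (poly_coords k ?y) ^^ \<alpha>) (\<lambda>t i. r * poly_coords k (tcomp ?\<psi> v) t i) 0 l"
      by (intro cov_funpow_cong[OF refl _ 0 l])
    then show "tcomp \<phi> (induced_connection_map M nab k (tscale (jet_mfd M k) r v) \<alpha>) l =
        r * tcomp \<phi> (induced_connection_map M nab k v \<alpha>) l"
      unfolding K(2)[OF v l] K(2)[OF N.tscale_in_tangent_space[OF v] l]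
      using cov_funpow_scale[OF U(1) c smooth_poly_coords 0 l] by simp
  qed
qed

text \<open>Coordinates of a vector tangent to the jet manifold are indexed by \<open>(0, z)\<close>
  for the foot point and \<open>(1, z)\<close> for the components. With time adjoined as
  \<open>None\<close>, the operator becomes \<open>E\<close>, where \<open>partial None\<close>
  replaces the time derivative; its powers stay smooth in time and parameters jointly, and time is
  set to 0 at the end.\<close>

lemma smooth_cov_poly_coords:
  fixes k :: nat
  assumes U: "(U, \<phi>) \<in> charts M" and l: "l \<in> index M"
  defines "P \<equiv> {..1::nat} \<times> ({..k} \<times> index M)"
  shows "smooth_on_coords P {x \<in> extensional P. base_coords (\<lambda>z. x (0, z)) \<in> \<phi> ` U}
    (\<lambda>x. (cov U \<phi> (poly_coords k (\<lambda>z. x (0, z))) ^^ a) (poly_coords k (\<lambda>z. x (1, z))) 0 l)"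
proof -
  define J where "J = insert None (Some ` P)"
  have fin: "finite P" using finite_index by (auto simp: P_def)
  have NJ: "None \<in> J" by (simp add: J_def)
  define c where "c x = poly_coords k (\<lambda>z. x (Some (0, z))) (x None)" for x :: "(nat \<times> nat \<times> 'i) option \<Rightarrow> real"
  define w where "w i x = poly_coords k (\<lambda>z. x (Some (1, z))) (x None) i" for i and x :: "(nat \<times> nat \<times> 'i) option \<Rightarrow> real"
  have c: "smooth_on_coords J S (\<lambda>x. c x i)" and w: "smooth_on_coords J S (w i)"
    if "i \<in> index M" "openin (powertop_real J) S" for i S
    using that unfolding c_def w_def poly_coords_def
    by (simp_all, (intro smooth_on_coords_sum smooth_on_coords_mult smooth_on_coords_power smooth_on_coords_proj;
        auto simp: J_def P_def)+)
  define T where "T = {x \<in> extensional J. c x \<in> \<phi> ` U}"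
  have T: "openin (powertop_real J) T" unfolding T_def
    by (rule openin_preimage_coords[OF openin_extensional chart_open[OF U] _ c[OF _ openin_extensional]])
      (simp_all add: c_def)
  define E where "E H l x = partial None (H l) x + (\<Sum>i\<in>index M. \<Sum>j\<in>index M.
      christoffel M nab U \<phi> i j l (inv_into U \<phi> (c x)) * partial None (\<lambda>x. c x i) x * H j x)"
    for H :: "'i \<Rightarrow> ((nat \<times> nat \<times> 'i) option \<Rightarrow> real) \<Rightarrow> real" and l x
  have E: "smooth_on_coords J T (E H l)" if H: "\<And>i. i \<in> index M \<Longrightarrow> smooth_on_coords J T (H i)" and l: "l \<in> index M" for H l
  proof -
    have G: "smooth_on_coords J T (\<lambda>x. christoffel M nab U \<phi> i j l (inv_into U \<phi> (c x)))"
      if "i \<in> index M" "j \<in> index M" for i j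
      by (rule smooth_on_coords_compose[where G = c, OF finite_index chart_open[OF U] T _ christoffel_smooth[OF U that l] c[OF _ T]])
        (auto simp: T_def)
    show ?thesis
      unfolding E_def
      by (intro smooth_on_coords_add[OF T] smooth_on_coords_sum[OF T] smooth_on_coords_mult[OF T] G H l
          smooth_on_coords_partial[OF c[OF _ T] NJ] smooth_on_coords_partial[OF H[OF l] NJ])
  qed
  have Ea: "i \<in> index M \<Longrightarrow> smooth_on_coords J T ((E ^^ a) w i)" for i
  proof (induction a arbitrary: i)
    case (Suc a)
    show ?case using E[OF Suc.IH Suc.prems] by simp
  qed (use w T in simp)
  \<comment> \<open>With all parameters frozen and \<open>None\<close> moving, \<open>E\<close> is
    \<open>cov\<close>. The induction ranges over all \<open>x\<close>, since
    \<open>partial None\<close> looks at neighbouring points on the line in this direction.\<close>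
  have id: "(E ^^ a) w l x = (cov U \<phi> (\<lambda>t. c (x(None := t))) ^^ a) (\<lambda>t i. w i (x(None := t))) (x None) l" for x l
  proof (induction a arbitrary: x l)
    case (Suc a)
    define A where "A = (E ^^ a) w"
    define B where "B = (cov U \<phi> (\<lambda>t. c (x(None := t))) ^^ a) (\<lambda>t i. w i (x(None := t)))"
    have IH: "A l (x(None := r)) = B r l" for l r
      unfolding A_def B_def Suc.IH by (simp only: fun_upd_upd fun_upd_same)
    have IH0: "A l x = B (x None) l" for l using IH[of l "x None"] by (simp only: fun_upd_triv)
    have "(E ^^ Suc a) w l x = E A l x" by (simp add: A_def)
    also have "\<dots> = cov U \<phi> (\<lambda>t. c (x(None := t))) B (x None) l"
      unfolding E_def cov_def partial_def IH IH0 fun_upd_triv ..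
    also have "\<dots> = (cov U \<phi> (\<lambda>t. c (x(None := t))) ^^ Suc a) (\<lambda>t i. w i (x(None := t))) (x None) l"
      unfolding B_def by simp
    finally show ?case .
  qed simp
  from smooth_on_coords_slice(2)[OF fin T[unfolded J_def] Ea[OF l, unfolded J_def]]
  have "smooth_on_coords P {y \<in> extensional P. case_option 0 y \<in> T} (\<lambda>y. (E ^^ a) w l (case_option 0 y))" .
  moreover have "(E ^^ a) w l (case_option 0 y) =
      (cov U \<phi> (poly_coords k (\<lambda>z. y (0, z))) ^^ a) (poly_coords k (\<lambda>z. y (1, z))) 0 l" for y
    unfolding id c_def w_def by simp
  moreover have "{y \<in> extensional P. case_option 0 y \<in> T} = {x \<in> extensional P. base_coords (\<lambda>z. x (0, z)) \<in> \<phi> ` U}"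
  proof -
    have "case_option 0 y \<in> extensional J" if "y \<in> extensional P" for y :: "nat \<times> nat \<times> 'i \<Rightarrow> real"
      using that by (auto simp: extensional_def J_def split: option.split)
    then show ?thesis by (auto simp: T_def c_def poly_coords_0)
  qed
  ultimately show ?thesis by simp
qed

section \<open>Smoothness into the Whitney sum\<close>

lemma obtain_jet_chart:
  assumes "X \<in> points (TB (jet_mfd M k))"
  obtains U \<phi> where "(U, \<phi>) \<in> charts M" "foot (foot X) \<in> U"
proof -
  interpret N: atlas "jet_mfd M k" by (rule atlas_jet_mfd)
  show ?thesis using obtain_chart[OF jet_pointsD(4)[OF N.jet_pointsD(4)[OF assms]]] that by blast
qed

lemma induced_connection_map_whitney:
  assumes X: "X \<in> points (TB (jet_mfd M k))"
  shows "induced_connection_map M nab k X \<in> whitney_points M k"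
proof -
  obtain U \<phi> where U: "(U, \<phi>) \<in> charts M" "foot (foot X) \<in> U" using obtain_jet_chart[OF X] .
  have "induced_connection_map M nab k X \<in> {1..k} \<rightarrow>\<^sub>E tangent_space M (foot (foot X))"
  proof (rule PiE_I)
    show "induced_connection_map M nab k X \<alpha> \<in> tangent_space M (foot (foot X))" if "\<alpha> \<in> {1..k}" for \<alpha>
      by (rule induced_connection_map_in_tangent_space[OF U(1) X U(2) that])
    show "induced_connection_map M nab k X \<alpha> = undefined" if "\<alpha> \<notin> {1..k}" for \<alpha>
      by (simp only: induced_connection_map_def restrict_apply that if_False)
  qed
  then show ?thesis using chart_subset_points[OF U(1)] U(2) unfolding whitney_points_def by blast
qed

lemma foot_induced_connection_map:
  assumes X: "X \<in> points (TB (jet_mfd M k))" and a: "\<alpha> \<in> {1..k}"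
  shows "foot (induced_connection_map M nab k X \<alpha>) = foot (foot X)"
proof -
  obtain U \<phi> where U: "(U, \<phi>) \<in> charts M" "foot (foot X) \<in> U" using obtain_jet_chart[OF X] .
  show ?thesis by (rule tangent_spaceD(2)[OF induced_connection_map_in_tangent_space[OF U(1) X U(2) a]])
qed

text \<open>In a chart of the Whitney sum the block 0 is the base point, which the map preserves,
  and the other blocks are the explicit formula. The charts read the base point off the component
  with index 1, which is where \<open>k \<ge> 1\<close> enters.\<close>

lemma induced_connection_map_smooth:
  assumes k: "k \<ge> 1"
  shows "smooth_map_on (TB (jet_mfd M k)) (whitney_sum M k) (points (TB (jet_mfd M k))) (induced_connection_map M nab k)"
  unfolding smooth_map_on_def
proof (intro ballI conjI)
  interpret N: atlas "jet_mfd M k" by (rule atlas_jet_mfd)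
  interpret TN: atlas "TB (jet_mfd M k)" by (rule N.atlas_jet_mfd)
  let ?K = "induced_connection_map M nab k"
  fix X assume X: "X \<in> points (TB (jet_mfd M k))"
  show "?K X \<in> points (whitney_sum M k)"
    using induced_connection_map_whitney[OF X] by (simp add: whitney_sum_def)
  obtain U \<phi> where U: "(U, \<phi>) \<in> charts M" "foot (foot X) \<in> U" using obtain_jet_chart[OF X] .
  define D where "D = {u \<in> points (jet_mfd M k). foot u \<in> U}"
  define W where "W = {X \<in> points (TB (jet_mfd M k)). foot X \<in> D}"
  define \<Phi> where "\<Phi> = jet_coord (jet_mfd M k) 1 (jet_coord M k \<phi>)"
  define E where "E = {w \<in> whitney_points M k. foot (w 1) \<in> U}"
  define \<omega> where "\<omega> w = restrict (\<lambda>(\<alpha>, i). if \<alpha> = 0 then \<phi> (foot (w 1)) i else tcomp \<phi> (w \<alpha>) i)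
              ({..k} \<times> index M)" for w
  have D: "(D, jet_coord M k \<phi>) \<in> charts (jet_mfd M k)" unfolding D_def by (rule jet_chart_mem[OF U(1)])
  have W: "(W, \<Phi>) \<in> charts (TB (jet_mfd M k))" unfolding W_def \<Phi>_def by (rule N.jet_chart_mem[OF D])
  have E: "(E, \<omega>) \<in> charts (whitney_sum M k)"
    unfolding whitney_sum_def E_def \<omega>_def[abs_def] using U(1) by force
  have WD: "Y \<in> points (TB (jet_mfd M k))" "foot (foot Y) \<in> U" "foot Y \<in> points (jet_mfd M k)" if "Y \<in> W" for Y
    using that unfolding W_def D_def by blast+
  have XW: "X \<in> W" unfolding W_def D_def using X U(2) N.jet_pointsD(4)[OF X] by blast
  have KE: "?K ` W \<subseteq> E"
  proof (rule image_subsetI)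
    fix Y assume Y: "Y \<in> W"
    have "foot (?K Y 1) \<in> U" using foot_induced_connection_map[OF WD(1)[OF Y], of 1] k WD(2)[OF Y] by simp
    then show "?K Y \<in> E" unfolding E_def using induced_connection_map_whitney[OF WD(1)[OF Y]] by blast
  qed
  define P where "P = {..1::nat} \<times> ({..k} \<times> index M)"
  have ix: "index (TB (jet_mfd M k)) = P" by (simp add: P_def)
  have op: "openin (powertop_real P) (\<Phi> ` W)" using TN.chart_open[OF W] unfolding ix .
  have \<Phi>: "\<Phi> Y (0, b, i) = jet_coord M k \<phi> (foot Y) (b, i)" "\<Phi> Y (1, b, i) = tcomp (jet_coord M k \<phi>) Y (b, i)"
    if "Y \<in> W" "b \<le> k" "i \<in> index M" for Y b i
    unfolding \<Phi>_def
    using N.jet_coord_0[OF WD(1)[OF that(1)], of "(b, i)"] N.jet_coord_1[of "(b, i)"] that(2,3) by simp_all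
  have sub: "\<Phi> ` W \<subseteq> {x \<in> extensional P. base_coords (\<lambda>z. x (0, z)) \<in> \<phi> ` U}"
  proof (rule image_subsetI)
    fix Y assume Y: "Y \<in> W"
    have "base_coords (\<lambda>z. \<Phi> Y (0, z)) = base_coords (jet_coord M k \<phi> (foot Y))"
      unfolding base_coords_def by (rule restrict_ext) (use \<Phi>(1)[OF Y] in simp)
    also have "\<dots> = \<phi> (foot (foot Y))" by (rule base_coords_jet_coord[OF WD(3)[OF Y] U(1) WD(2)[OF Y]])
    finally have "base_coords (\<lambda>z. \<Phi> Y (0, z)) \<in> \<phi> ` U" using WD(2)[OF Y] by simp
    then show "\<Phi> Y \<in> {x \<in> extensional P. base_coords (\<lambda>z. x (0, z)) \<in> \<phi> ` U}"
      using openin_powertop_subset[OF op] Y by blast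
  qed
  have sm: "smooth_on_coords P (\<Phi> ` W) (\<lambda>x. \<omega> (?K (inv_into W \<Phi> x)) z)" if z: "z \<in> index (whitney_sum M k)" for z
  proof -
    obtain \<alpha> l where al: "z = (\<alpha>, l)" "\<alpha> \<le> k" "l \<in> index M" using z by (auto simp: whitney_sum_def)
    show ?thesis
    proof (cases "\<alpha> = 0")
      case True
      have "(0, 0, l) \<in> P" using al by (simp add: P_def)
      from smooth_on_coords_proj[OF this]
      show ?thesis
      proof (rule smooth_on_coords_cong[OF op])
        fix x assume "x \<in> \<Phi> ` W"
        then obtain Y where Y: "Y \<in> W" "x = \<Phi> Y" by blast
        have "x (0, 0, l) = \<phi> (foot (foot Y)) l"
          unfolding Y(2) \<Phi>(1)[OF Y(1) le0 al(3)] by (rule jet_coord_0[OF WD(3)[OF Y(1)] al(3)])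
        moreover have "foot (?K Y 1) = foot (foot Y)" using foot_induced_connection_map[OF WD(1)[OF Y(1)], of 1] k by simp
        ultimately show "x (0, 0, l) = \<omega> (?K (inv_into W \<Phi> x)) z"
          unfolding Y(2) TN.chart_inv[OF W Y(1)] \<omega>_def al(1) using True al by simp
      qed
    next
      case False
      then have a: "\<alpha> \<in> {1..k}" using al by simp
      have "smooth_on_coords P (\<Phi> ` W) (\<lambda>x. (1 / fact \<alpha>) *
          (cov U \<phi> (poly_coords k (\<lambda>z. x (0, z))) ^^ \<alpha>) (poly_coords k (\<lambda>z. x (1, z))) 0 l)"
        by (intro smooth_on_coords_mult[OF op] smooth_on_coords_const
            smooth_on_coords_subset[OF smooth_cov_poly_coords[OF U(1) al(3), of k \<alpha>, folded P_def] sub])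
      then show ?thesis
      proof (rule smooth_on_coords_cong[OF op])
        fix x assume "x \<in> \<Phi> ` W"
        then obtain Y where Y: "Y \<in> W" "x = \<Phi> Y" by blast
        have e: "poly_coords k (\<lambda>z. x (0, z)) = poly_coords k (jet_coord M k \<phi> (foot Y))"
          "poly_coords k (\<lambda>z. x (1, z)) = poly_coords k (tcomp (jet_coord M k \<phi>) Y)"
          unfolding Y(2) by (rule poly_coords_cong, rule \<Phi>[OF Y(1)], assumption+)+
        show "(1 / fact \<alpha>) * (cov U \<phi> (poly_coords k (\<lambda>z. x (0, z))) ^^ \<alpha>) (poly_coords k (\<lambda>z. x (1, z))) 0 l =
            \<omega> (?K (inv_into W \<Phi> x)) z"
          unfolding e tcomp_induced_connection_map[OF U(1) WD(1,2)[OF Y(1)] a al(3), symmetric]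
          unfolding Y(2) TN.chart_inv[OF W Y(1)] \<omega>_def al(1) using False al by simp
      qed
    qed
  qed
  have "\<exists>W'. openin (mfd_topology (TB (jet_mfd M k))) W' \<and> X \<in> W' \<and> W' \<subseteq> points (TB (jet_mfd M k)) \<inter> W \<and> ?K ` W' \<subseteq> E \<and>
      (\<forall>j\<in>index (whitney_sum M k). smooth_on_coords (index (TB (jet_mfd M k))) (\<Phi> ` W') (\<lambda>x. \<omega> (?K (inv_into W \<Phi> x)) j))"
    unfolding ix
    using TN.chart_openin[OF W] XW TN.chart_subset_points[OF W] KE sm by (intro exI[of _ W] conjI ballI) (assumption | rule Int_greatest order_refl)+
  then show "\<exists>(U, \<phi>)\<in>charts (TB (jet_mfd M k)). \<exists>(V, \<psi>)\<in>charts (whitney_sum M k). \<exists>W.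
      openin (mfd_topology (TB (jet_mfd M k))) W \<and> X \<in> W \<and> W \<subseteq> points (TB (jet_mfd M k)) \<inter> U \<and> ?K ` W \<subseteq> V \<and>
      (\<forall>j\<in>index (whitney_sum M k). smooth_on_coords (index (TB (jet_mfd M k))) (\<phi> ` W) (\<lambda>x. \<psi> (?K (inv_into U \<phi> x)) j))"
    by (intro bexI[of _ "(W, \<Phi>)"] case_prodI bexI[of _ "(E, \<omega>)"] W E)
qed

end

section \<open>The almost-tangent structure and towers\<close>

lemma smooth_ivl_higher_deriv: "smooth_ivl \<epsilon> f \<Longrightarrow> smooth_ivl \<epsilon> ((deriv ^^ b) f)"
  by (induction b) (auto intro: smooth_ivl_deriv)

text \<open>The commutation with t again, now for plain derivatives; after division by factorials it
  is the shift of Taylor coefficients.\<close>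

lemma higher_deriv_times_id:
  assumes g: "smooth_ivl \<epsilon> g"
  shows "\<bar>t\<bar> < \<epsilon> \<Longrightarrow> (deriv ^^ b) (\<lambda>t. t * g t) t = t * (deriv ^^ b) g t + real b * (deriv ^^ (b - 1)) g t"
proof (induction b arbitrary: t)
  case (Suc b)
  note s = smooth_ivl_higher_deriv[OF g]
  have "(deriv ^^ Suc b) (\<lambda>t. t * g t) t = deriv (\<lambda>t. t * (deriv ^^ b) g t + real b * (deriv ^^ (b - 1)) g t) t"
    using deriv_cong_ivl[OF Suc.IH Suc.prems] by simp
  also have "\<dots> = (deriv ^^ b) g t + t * deriv ((deriv ^^ b) g) t + real b * deriv ((deriv ^^ (b - 1)) g) t"
    using deriv_add_ivl[OF smooth_ivl_mult[OF smooth_ivl_id s] smooth_ivl_mult[OF smooth_ivl_const s] Suc.prems]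
      deriv_mult_ivl[OF smooth_ivl_id s Suc.prems] deriv_mult_ivl[OF smooth_ivl_const s Suc.prems] by simp
  also have "real b * deriv ((deriv ^^ (b - 1)) g) t = real b * (deriv ^^ b) g t"
    by (cases b) simp_all
  finally show ?case by (simp add: algebra_simps)
qed simp

definition shear :: "(real \<Rightarrow> real \<Rightarrow> 'p) \<Rightarrow> real \<Rightarrow> real \<Rightarrow> 'p" where
  "shear \<gamma> s t = \<gamma> (s * t) t"

lemma shear_0 [simp]: "shear \<gamma> 0 = \<gamma> 0"
  by (simp add: shear_def fun_eq_iff)

section \<open>Sheared families and the almost-tangent structure\<close>

context atlas begin

lemma shear_family_in:
  assumes f: "family_in U \<phi> \<epsilon> \<gamma>"
  shows "family_in U \<phi> (min \<epsilon> 1) (shear \<gamma>)"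
  unfolding family_in_def
proof (intro conjI allI impI ballI)
  \<comment> \<open>The cap 1 on the radius keeps the product of s and t within the bound on s, so
    the sheared arguments stay in the square.\<close>
  have m: "\<bar>s * t\<bar> < \<epsilon>" if "\<bar>s\<bar> < min \<epsilon> 1" "\<bar>t\<bar> < min \<epsilon> 1" for s t :: real
  proof -
    have "\<bar>s\<bar> * \<bar>t\<bar> \<le> \<bar>s\<bar> * 1" using that by (intro mult_left_mono) auto
    then show ?thesis using that by (simp add: abs_mult)
  qed
  show "shear \<gamma> s t \<in> U" if "\<bar>s\<bar> < min \<epsilon> 1" "\<bar>t\<bar> < min \<epsilon> 1" for s t
    using f m[OF that] that(2) by (simp add: family_in_def shear_def)
  show "min \<epsilon> 1 > 0" using family_in_pos[OF f] by simp
  fix i assume i: "i \<in> index M"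
  have F: "smooth_on_coords UNIV (square \<epsilon>) (\<lambda>x. \<phi> (\<gamma> (x False) (x True)) i)" using f i by (simp add: family_in_def)
  have "smooth_on_coords UNIV (square (min \<epsilon> 1)) (\<lambda>x. x False * x True)"
    "smooth_on_coords UNIV (square (min \<epsilon> 1)) (\<lambda>x. x True)"
    by (intro smooth_on_coords_mult[OF openin_bool_box] smooth_on_coords_proj UNIV_I)+
  then have p: "smooth_on_coords UNIV (square (min \<epsilon> 1)) (\<lambda>x. pt (x False * x True) (x True) z)" for z
    by (cases z) (simp_all only: if_True if_False)
  have "smooth_on_coords UNIV (square (min \<epsilon> 1))
      (\<lambda>y. (\<lambda>x. \<phi> (\<gamma> (x False) (x True)) i) (pt (y False * y True) (y True)))"
    by (rule smooth_on_coords_compose[where G = "\<lambda>x. pt (x False * x True) (x True)", OF finite openin_bool_box openin_bool_box _ F p])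
      (use m in auto)
  then show "smooth_on_coords UNIV (square (min \<epsilon> 1)) (\<lambda>x. \<phi> (shear \<gamma> (x False) (x True)) i)"
    by (simp add: shear_def)
qed

lemma smooth_family_shear: "smooth_family M \<gamma> \<Longrightarrow> smooth_family M (shear \<gamma>)"
  using obtain_family_chart[of \<gamma>] shear_family_in family_in_smooth_family by metis

text \<open>At fixed t the parameter enters through the product s t, so the chain rule at s = 0
  contributes the factor t.\<close>

lemma tcomp_variation_shear:
  assumes U: "(U, \<phi>) \<in> charts M" and f: "family_in U \<phi> \<epsilon> \<gamma>" and t: "\<bar>t\<bar> < min \<epsilon> 1" and i: "i \<in> index M"
  shows "tcomp \<phi> (variation (shear \<gamma>) t) i = t * tcomp \<phi> (variation \<gamma> t) i"
proof -
  have te: "\<bar>t\<bar> < \<epsilon>" and 0: "\<bar>0\<bar> < \<epsilon>" using t family_in_pos[OF f] by auto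
  have "smooth_ivl \<epsilon> (\<lambda>s. \<phi> (\<gamma> s t) i)" using family_in_curves(2)[OF f te] i by (simp add: curve_in_def)
  then have "((\<lambda>s. \<phi> (\<gamma> s t) i) has_real_derivative deriv (\<lambda>s. \<phi> (\<gamma> s t) i) 0) (at (0 * t))"
    using smooth_ivl_DERIV[OF _ 0] by simp
  moreover have "((\<lambda>s. s * t) has_real_derivative t) (at 0)"
    by (auto intro!: derivative_eq_intros)
  ultimately have "((\<lambda>s. \<phi> (\<gamma> (s * t) t) i) has_real_derivative deriv (\<lambda>s. \<phi> (\<gamma> s t) i) 0 * t) (at 0)"
    by (rule DERIV_chain2)
  then show ?thesis
    unfolding tcomp_variation[OF shear_family_in[OF f] U t i] tcomp_variation[OF f U te i]
    by (simp add: shear_def DERIV_imp_deriv)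
qed

text \<open>The family \<open>\<gamma>(st, t)\<close> has variation field \<open>t V(t)\<close>, which multiplies the Taylor series of \<open>V\<close>
  by \<open>t\<close>, i.e. shifts its coefficients.\<close>

lemma almost_tangent_adapted:
  assumes g: "adapted M k X \<gamma>"
  shows "almost_tangent M k X = jet_velocity k (shear \<gamma>)"
proof -
  interpret N: atlas "jet_mfd M k" by (rule atlas_jet_mfd)
  note gD = adaptedD[OF g]
  have foot: "foot (foot X) = \<gamma> 0 0" using smooth_family_adapted(4)[OF gD(1), of k] gD(3) by simp
  have X: "X \<in> points (TB (jet_mfd M k))" using smooth_family_adapted(2)[OF gD(1), of k] unfolding gD(3) .
  let ?Y = "jet_velocity k (shear \<gamma>)"
  have Y: "?Y \<in> tangent_space (jet_mfd M k) (foot X)"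
    using smooth_family_adapted(2,3)[OF smooth_family_shear[OF gD(1)], of k] gD(2)
    by (intro N.tangent_spaceI) simp_all
  \<comment> \<open>The velocity of the sheared family is one vector, and its shifted components are
    computed in an arbitrary chart at the base point; this settles existence in the description of
    \<open>almost_tangent\<close> for all charts together.\<close>
  have shift: "tcomp (jet_coord M k \<phi>) ?Y (0, i) = 0"
    "\<And>\<alpha>. \<alpha> < k \<Longrightarrow> tcomp (jet_coord M k \<phi>) ?Y (Suc \<alpha>, i) = tcomp (jet_coord M k \<phi>) X (\<alpha>, i)"
    if U: "(U, \<phi>) \<in> charts M" "foot (foot X) \<in> U" and i: "i \<in> index M" for U \<phi> i
  proof -
    obtain \<epsilon> where f: "family_in U \<phi> \<epsilon> \<gamma>" using smooth_family_chart[OF gD(1) U(1)] U(2) unfolding foot by blast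
    let ?V = "\<lambda>t. tcomp \<phi> (variation \<gamma> t) i"
    have 0: "\<bar>0\<bar> < min \<epsilon> 1" using family_in_pos[OF f] by simp
    have sV: "smooth_ivl (min \<epsilon> 1) ?V" using smooth_ivl_mono[OF smooth_variation[OF f U(1) i]] by simp
    have d: "(deriv ^^ b) (\<lambda>t. tcomp \<phi> (variation (shear \<gamma>) t) i) 0 = real b * (deriv ^^ (b - 1)) ?V 0" for b
    proof -
      have "(deriv ^^ b) (\<lambda>t. tcomp \<phi> (variation (shear \<gamma>) t) i) 0 = (deriv ^^ b) (\<lambda>t. t * ?V t) 0"
        by (rule higher_deriv_cong_ivl[OF tcomp_variation_shear[OF U(1) f _ i] 0])
      then show ?thesis using higher_deriv_times_id[OF sV 0] by simp
    qed
    note s = tcomp_jet_velocity[OF shear_family_in[OF f] U(1) i]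
    show "tcomp (jet_coord M k \<phi>) ?Y (0, i) = 0" using s[of 0 k] d[of 0] by simp
    show "tcomp (jet_coord M k \<phi>) ?Y (Suc \<alpha>, i) = tcomp (jet_coord M k \<phi>) X (\<alpha>, i)" if a: "\<alpha> < k" for \<alpha>
    proof -
      have "tcomp (jet_coord M k \<phi>) ?Y (Suc \<alpha>, i) = real (Suc \<alpha>) * (deriv ^^ \<alpha>) ?V 0 / fact (Suc \<alpha>)"
        using s[of "Suc \<alpha>" k] a d[of "Suc \<alpha>"] by simp
      also have "\<dots> = (deriv ^^ \<alpha>) ?V 0 / fact \<alpha>" by (simp add: field_simps del: of_nat_Suc)
      also have "\<dots> = tcomp (jet_coord M k \<phi>) X (\<alpha>, i)"
        using tcomp_jet_velocity[OF f U(1) i, of \<alpha> k] a gD(3) by simp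
      finally show ?thesis .
    qed
  qed
  show ?thesis
    unfolding almost_tangent_def
  proof (rule the_equality)
    show "?Y \<in> tangent_space (jet_mfd M k) (foot X) \<and>
     (\<forall>(U, \<phi>)\<in>charts M. foot (foot X) \<in> U \<longrightarrow> (\<forall>i\<in>index M.
        tcomp (jet_coord M k \<phi>) ?Y (0, i) = 0 \<and>
        (\<forall>\<alpha><k. tcomp (jet_coord M k \<phi>) ?Y (Suc \<alpha>, i) = tcomp (jet_coord M k \<phi>) X (\<alpha>, i))))"
      using Y shift by blast
    fix Z assume Z: "Z \<in> tangent_space (jet_mfd M k) (foot X) \<and>
     (\<forall>(U, \<phi>)\<in>charts M. foot (foot X) \<in> U \<longrightarrow> (\<forall>i\<in>index M.
        tcomp (jet_coord M k \<phi>) Z (0, i) = 0 \<and>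
        (\<forall>\<alpha><k. tcomp (jet_coord M k \<phi>) Z (Suc \<alpha>, i) = tcomp (jet_coord M k \<phi>) X (\<alpha>, i))))"
    have u: "foot X \<in> points (jet_mfd M k)" by (rule N.jet_pointsD(4)[OF X])
    obtain U \<phi> where U: "(U, \<phi>) \<in> charts M" "foot (foot X) \<in> U" using obtain_chart[OF jet_pointsD(4)[OF u]] .
    show "Z = ?Y"
    proof (rule N.tangent_eqI[OF conjunct1[OF Z] Y jet_chart_mem[OF U(1)]])
      show "foot X \<in> {u \<in> points (jet_mfd M k). foot u \<in> U}" using u U(2) by (intro CollectI conjI)
      fix z assume "z \<in> index (jet_mfd M k)"
      then obtain b i where z: "z = (b, i)" "b \<le> k" "i \<in> index M" by auto
      have Zc: "tcomp (jet_coord M k \<phi>) Z (0, i) = 0"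
        "\<And>\<alpha>. \<alpha> < k \<Longrightarrow> tcomp (jet_coord M k \<phi>) Z (Suc \<alpha>, i) = tcomp (jet_coord M k \<phi>) X (\<alpha>, i)"
        using Z U z(3) by blast+
      show "tcomp (jet_coord M k \<phi>) Z z = tcomp (jet_coord M k \<phi>) ?Y z"
        using Zc shift[OF U z(3)] z by (cases b) simp_all
    qed
  qed
qed

text \<open>\<open>pushforward\<close> follows the representative \<open>rep X\<close>, which need
  not be the curve of jets of \<gamma>. Both vectors have as components the order 0 components of
  \<open>X\<close>, because the base point is the order 0 block of a jet chart.\<close>

lemma pushforward_foot:
  assumes g: "adapted M k X \<gamma>"
  shows "pushforward M foot X = variation \<gamma> 0"
proof -
  interpret N: atlas "jet_mfd M k" by (rule atlas_jet_mfd)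
  note gD = adaptedD[OF g]
  have X: "X \<in> points (TB (jet_mfd M k))" using smooth_family_adapted(2)[OF gD(1), of k] unfolding gD(3) .
  obtain U \<phi> \<epsilon> where U: "(U, \<phi>) \<in> charts M" and f: "family_in U \<phi> \<epsilon> \<gamma>" using obtain_family_chart[OF gD(1)] .
  have foot: "foot (foot X) = \<gamma> 0 0" using smooth_family_adapted(4)[OF gD(1), of k] gD(3) by simp
  have g0: "\<gamma> 0 0 \<in> U" using f by (simp add: family_in_def)
  let ?D = "{u \<in> points (jet_mfd M k). foot u \<in> U}"
  note D = jet_chart_mem[OF U, of k]
  note XD = N.jet_pointsD[OF X]
  have "rep X 0 \<in> ?D" unfolding XD(3)[symmetric] using XD(4) foot g0 by (intro CollectI conjI) simp_all
  then obtain e where e: "N.curve_in ?D (jet_coord M k \<phi>) e (rep X)" using N.smooth_curve_chart[OF XD(1) D] by blast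
  have pos: "\<bar>0\<bar> < e" using e by (simp add: N.curve_in_def)
  have r: "rep X t \<in> points (jet_mfd M k)" "foot (rep X t) \<in> U" if "\<bar>t\<bar> < e" for t
    using e that unfolding N.curve_in_def by blast+
  have c: "jet_coord M k \<phi> (rep X t) (0, i) = \<phi> (foot (rep X t)) i" if "\<bar>t\<bar> < e" "i \<in> index M" for t i
    using jet_coord_0[OF r(1)[OF that(1)] that(2)] .
  have q: "curve_in U \<phi> e (\<lambda>t. foot (rep X t))"
    unfolding curve_in_def
  proof (intro conjI allI impI ballI)
    fix i assume i: "i \<in> index M"
    have "smooth_ivl e (\<lambda>t. jet_coord M k \<phi> (rep X t) (0, i))" using e i by (simp add: N.curve_in_def)
    then show "smooth_ivl e (\<lambda>t. \<phi> (foot (rep X t)) i)" by (rule smooth_ivl_cong) (rule c[OF _ i])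
  qed (use pos r in auto)
  note sq = curve_in_smooth_curve[OF U q]
  have q0: "foot (rep X 0) = \<gamma> 0 0" using foot XD(3) by simp
  have t0: "\<bar>0\<bar> < \<epsilon>" using family_in_pos[OF f] by simp
  have "pushforward M foot X \<in> tangent_space M (\<gamma> 0 0)"
    unfolding pushforward_def by (rule jet_in_tangent_space[OF sq q0])
  then show ?thesis
  proof (rule tangent_eqI[OF _ variation_in_tangent_space[OF f U t0] U g0])
    fix i assume i: "i \<in> index M"
    have "tcomp \<phi> (pushforward M foot X) i = deriv (\<lambda>t. \<phi> (foot (rep X t)) i) 0"
      unfolding pushforward_def using tcomp_jet[OF sq U _ i] q0 g0 by simp
    also have "\<dots> = deriv (\<lambda>t. jet_coord M k \<phi> (rep X t) (0, i)) 0"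
      by (rule deriv_cong_ivl[OF _ pos]) (rule c[OF _ i, symmetric])
    also have "\<dots> = tcomp (jet_coord M k \<phi>) X (0, i)" by (simp add: tcomp_def)
    also have "\<dots> = tcomp \<phi> (variation \<gamma> 0) i"
      using tcomp_jet_velocity[OF f U i, of 0 k] gD(3) by simp
    finally show "tcomp \<phi> (pushforward M foot X) i = tcomp \<phi> (variation \<gamma> 0) i" .
  qed
qed

section \<open>Projections to lower order\<close>

lemma jet_proj_jet:
  assumes q: "smooth_curve M q" and m: "m \<le> k"
  shows "jet_proj M m (jet M k q) = jet M m q"
proof -
  obtain U \<phi> \<epsilon> where U: "(U, \<phi>) \<in> charts M" "curve_in U \<phi> \<epsilon> q" using obtain_curve_chart[OF q] .
  show ?thesis
    unfolding jet_proj_def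
    by (rule jet_cong[OF rep_jet_smooth[OF q] q _ U(1)])
      (use rep_jet_0[OF q] curve_in_0[OF U(2)] jet_eq_mono[OF rep_jet_eq[OF q U(1)] m] in auto)
qed

text \<open>In charts the projection drops the coordinates of order above \<open>m\<close>, so its
  differential keeps the components up to \<open>m\<close>; for the velocity of a family these are
  Taylor coefficients of the variation field, the same at orders \<open>k\<close> and
  \<open>m\<close>.\<close>

lemma pushforward_jet_proj:
  assumes g: "adapted M k X \<gamma>" and m: "m \<le> k"
  shows "pushforward (jet_mfd M m) (jet_proj M m) X = jet_velocity m \<gamma>"
proof -
  interpret N: atlas "jet_mfd M k" by (rule atlas_jet_mfd)
  interpret L: atlas "jet_mfd M m" by (rule atlas_jet_mfd)
  note gD = adaptedD[OF g]
  have X: "X \<in> points (TB (jet_mfd M k))" using smooth_family_adapted(2)[OF gD(1), of k] unfolding gD(3) .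
  obtain U \<phi> \<epsilon> where U: "(U, \<phi>) \<in> charts M" and f: "family_in U \<phi> \<epsilon> \<gamma>" using obtain_family_chart[OF gD(1)] .
  have t0: "\<bar>0\<bar> < \<epsilon>" using family_in_pos[OF f] by simp
  note sg = curve_in_smooth_curve[OF U family_in_curves(1)[OF f t0]]
  have foot: "foot (foot X) = \<gamma> 0 0" using smooth_family_adapted(4)[OF gD(1), of k] gD(3) by simp
  have g0: "\<gamma> 0 0 \<in> U" using f by (simp add: family_in_def)
  let ?D = "\<lambda>k. {u \<in> points (jet_mfd M k). foot u \<in> U}"
  note D = jet_chart_mem[OF U]
  note XD = N.jet_pointsD[OF X]
  have "rep X 0 \<in> ?D k" unfolding XD(3)[symmetric] using XD(4) foot g0 by (intro CollectI conjI) simp_all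
  then obtain e where e: "N.curve_in (?D k) (jet_coord M k \<phi>) e (rep X)" using N.smooth_curve_chart[OF XD(1) D] by blast
  have pos: "\<bar>0\<bar> < e" using e by (simp add: N.curve_in_def)
  have r: "rep X t \<in> points (jet_mfd M k)" "foot (rep X t) \<in> U" if "\<bar>t\<bar> < e" for t
    using e that unfolding N.curve_in_def by blast+
  let ?q = "\<lambda>t. jet_proj M m (rep X t)"
  have qD: "?q t \<in> ?D m" if "\<bar>t\<bar> < e" for t
    using jet_in_points[OF jet_pointsD(1)[OF r(1)[OF that]], of m] foot_jet[OF jet_pointsD(1)[OF r(1)[OF that]], of m]
      jet_pointsD(3)[OF r(1)[OF that]] r(2)[OF that]
    unfolding jet_proj_def by (intro CollectI conjI) simp_all
  have c: "jet_coord M m \<phi> (?q t) (b, i) = jet_coord M k \<phi> (rep X t) (b, i)"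
    if "\<bar>t\<bar> < e" "i \<in> index M" "b \<le> m" for t b i
  proof -
    note j = jet_pointsD[OF r(1)[OF that(1)]]
    have "rep (rep X t) 0 \<in> U" using r(2)[OF that(1)] j(3) by simp
    from jet_coord_jet[OF j(1) U this that(2,3)]
    show ?thesis unfolding jet_proj_def using that(2,3) m by (simp add: jet_coord_def)
  qed
  have q: "L.curve_in (?D m) (jet_coord M m \<phi>) e ?q"
    unfolding L.curve_in_def
  proof (intro conjI allI impI ballI)
    show "?q t \<in> ?D m" if "\<bar>t\<bar> < e" for t using qD[OF that] .
    fix z assume "z \<in> index (jet_mfd M m)"
    then obtain b i where z: "z = (b, i)" "b \<le> m" "i \<in> index M" by auto
    have "smooth_ivl e (\<lambda>t. jet_coord M k \<phi> (rep X t) (b, i))" using e z m by (simp add: N.curve_in_def)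
    then show "smooth_ivl e (\<lambda>t. jet_coord M m \<phi> (?q t) z)"
      unfolding z(1) by (rule smooth_ivl_cong) (rule c[OF _ z(3,2), symmetric])
  qed (use pos in simp)
  note sq = L.curve_in_smooth_curve[OF D q]
  have q0: "?q 0 = jet M m (\<gamma> 0)"
    unfolding XD(3)[symmetric] gD(2)[symmetric] by (rule jet_proj_jet[OF sg m])
  have "pushforward (jet_mfd M m) (jet_proj M m) X \<in> tangent_space (jet_mfd M m) (jet M m (\<gamma> 0))"
    unfolding pushforward_def by (rule L.jet_in_tangent_space[OF sq q0])
  moreover have "jet M m (\<gamma> 0) \<in> ?D m" using qD[OF pos] unfolding q0 .
  ultimately show ?thesis
  proof (rule L.tangent_eqI[OF _ jet_velocity_in_tangent_space[OF f U] D])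
    fix z assume "z \<in> index (jet_mfd M m)"
    then obtain b i where z: "z = (b, i)" "b \<le> m" "i \<in> index M" by auto
    have zi: "(b, i) \<in> index (jet_mfd M m)" using z by simp
    have "tcomp (jet_coord M m \<phi>) (pushforward (jet_mfd M m) (jet_proj M m) X) (b, i) =
        deriv (\<lambda>t. jet_coord M m \<phi> (?q t) (b, i)) 0"
      unfolding pushforward_def by (rule L.tcomp_jet[OF sq D qD[OF pos] zi])
    also have "\<dots> = deriv (\<lambda>t. jet_coord M k \<phi> (rep X t) (b, i)) 0"
      by (rule deriv_cong_ivl[OF c[OF _ z(3,2)] pos])
    also have "\<dots> = tcomp (jet_coord M k \<phi>) X (b, i)" by (simp add: tcomp_def)
    also have "\<dots> = tcomp (jet_coord M m \<phi>) (jet_velocity m \<gamma>) (b, i)"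
      using tcomp_jet_velocity[OF f U z(3), of b k] tcomp_jet_velocity[OF f U z(3), of b m] gD(3) z(2) m by simp
    finally show "tcomp (jet_coord M m \<phi>) (pushforward (jet_mfd M m) (jet_proj M m) X) z =
        tcomp (jet_coord M m \<phi>) (jet_velocity m \<gamma>) z" unfolding z(1) .
  qed
qed

end

section \<open>The axioms on the almost-tangent structure\<close>

context affine_atlas begin

text \<open>The shear leaves the curve at s = 0 alone, so the same operator acts on t V; at t = 0
  only the commutator term survives, and its factor \<open>Suc a\<close> cancels against the
  factorial.\<close>

lemma family_cov_deriv_shear:
  assumes g: "smooth_family M \<gamma>"
  shows "family_cov_deriv M nab (Suc a) (shear \<gamma>) = family_cov_deriv M nab a \<gamma>"
proof -
  obtain U \<phi> e where U: "(U, \<phi>) \<in> charts M" and e: "family_in U \<phi> e \<gamma>" using obtain_family_chart[OF g] .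
  define \<epsilon> where "\<epsilon> = min e 1"
  have f: "family_in U \<phi> \<epsilon> \<gamma>" and f': "family_in U \<phi> \<epsilon> (shear \<gamma>)"
    using family_in_mono[OF e, of \<epsilon>] shear_family_in[OF e] family_in_pos[OF e] by (auto simp: \<epsilon>_def)
  have 0: "\<bar>0\<bar> < \<epsilon>" using family_in_pos[OF f] by simp
  note c = curve_in_coord_curve[OF family_in_curves(1)[OF f 0]]
  note sV = smooth_coords_variation[OF f U]
  have g0: "\<gamma> 0 0 \<in> U" using f by (simp add: family_in_def)
  have "shear \<gamma> 0 0 = \<gamma> 0 0" by simp
  with family_cov_deriv_in_tangent_space[OF U f', of "Suc a"]
  have "family_cov_deriv M nab (Suc a) (shear \<gamma>) \<in> tangent_space M (\<gamma> 0 0)" by simp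
  then show ?thesis
  proof (rule tangent_eqI[OF _ family_cov_deriv_in_tangent_space[OF U f] U g0])
    fix l assume l: "l \<in> index M"
    let ?c = "\<lambda>t. \<phi> (\<gamma> 0 t)" and ?W = "\<lambda>t i. tcomp \<phi> (variation \<gamma> t) i"
    have "(cov U \<phi> (\<lambda>t. \<phi> (shear \<gamma> 0 t)) ^^ Suc a) (\<lambda>t i. tcomp \<phi> (variation (shear \<gamma>) t) i) 0 l =
        (cov U \<phi> ?c ^^ Suc a) (\<lambda>t i. t * ?W t i) 0 l"
      by (rule cov_funpow_cong[OF _ tcomp_variation_shear[OF U e] 0 l]) (simp_all add: \<epsilon>_def)
    also have "\<dots> = real (Suc a) * (cov U \<phi> ?c ^^ a) ?W 0 l"
      using cov_funpow_times_id[OF U c sV 0 l, of "Suc a"] by simp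
    finally show "tcomp \<phi> (family_cov_deriv M nab (Suc a) (shear \<gamma>)) l = tcomp \<phi> (family_cov_deriv M nab a \<gamma>) l"
      unfolding tcomp_family_cov_deriv[OF U f' l] tcomp_family_cov_deriv[OF U f l]
      by (simp add: field_simps del: of_nat_Suc funpow.simps)
  qed
qed

lemma family_cov_deriv_0:
  assumes g: "smooth_family M \<gamma>"
  shows "family_cov_deriv M nab 0 \<gamma> = variation \<gamma> 0"
proof -
  obtain U \<phi> \<epsilon> where U: "(U, \<phi>) \<in> charts M" and f: "family_in U \<phi> \<epsilon> \<gamma>" using obtain_family_chart[OF g] .
  have 0: "\<bar>0\<bar> < \<epsilon>" using family_in_pos[OF f] by simp
  have g0: "\<gamma> 0 0 \<in> U" using f by (simp add: family_in_def)
  show ?thesis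
    by (rule tangent_eqI[OF family_cov_deriv_in_tangent_space[OF U f] variation_in_tangent_space[OF f U 0] U g0])
      (simp add: tcomp_family_cov_deriv[OF U f])
qed

text \<open>One identity for both axioms: \<open>a = 0\<close> yields the differential of the base
  point projection, and \<open>a \<ge> 1\<close> the relation between consecutive
  components.\<close>

lemma induced_connection_map_almost_tangent:
  assumes g: "adapted M k X \<gamma>" and a: "a < k"
  shows "induced_connection_map M nab k (almost_tangent M k X) (Suc a) = family_cov_deriv M nab a \<gamma>"
proof -
  note gD = adaptedD[OF g]
  have "adapted M k (almost_tangent M k X) (shear \<gamma>)"
    unfolding almost_tangent_adapted[OF g] by (rule smooth_family_adapted(1)[OF smooth_family_shear[OF gD(1)]])
  from induced_connection_map_eq[OF this, of "Suc a"] a family_cov_deriv_shear[OF gD(1), of a]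
  show ?thesis by simp
qed

lemma connection_map_induced:
  assumes k: "k \<ge> 1"
  shows "connection_map M k (induced_connection_map M nab k)"
  unfolding connection_map_def
proof (intro conjI ballI)
  fix X assume X: "X \<in> points (TB (jet_mfd M k))"
  obtain \<gamma> where g: "adapted M k X \<gamma>" using adapted_exists[OF X] .
  show "induced_connection_map M nab k (almost_tangent M k X) (\<alpha> + 1) = induced_connection_map M nab k X \<alpha>"
    if "\<alpha> \<in> {1..<k}" for \<alpha>
    using induced_connection_map_almost_tangent[OF g, of \<alpha>] induced_connection_map_eq[OF g, of \<alpha>] that by simp
  show "induced_connection_map M nab k (almost_tangent M k X) 1 = pushforward M foot X"
    using induced_connection_map_almost_tangent[OF g, of 0] k family_cov_deriv_0[OF adaptedD(1)[OF g]] pushforward_foot[OF g]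
    by simp
qed (rule induced_connection_map_smooth[OF k] induced_connection_map_linear | assumption)+

section \<open>Connection towers\<close>

definition tower_map :: "nat \<Rightarrow> (real \<Rightarrow> (real \<Rightarrow> 'p) set) set \<Rightarrow> (real \<Rightarrow> 'p) set" where
  "tower_map \<alpha> = (\<lambda>X\<in>points (TB (jet_mfd M \<alpha>)). induced_connection_map M nab \<alpha> X \<alpha>)"

lemma tower_map_pushforward:
  assumes g: "adapted M k X \<gamma>" and a: "1 \<le> \<alpha>" "\<alpha> \<le> k"
  shows "tower_map \<alpha> (pushforward (jet_mfd M \<alpha>) (jet_proj M \<alpha>) X) = family_cov_deriv M nab \<alpha> \<gamma>"
proof -
  note s = smooth_family_adapted[OF adaptedD(1)[OF g], of \<alpha>]
  have "tower_map \<alpha> (jet_velocity \<alpha> \<gamma>) = induced_connection_map M nab \<alpha> (jet_velocity \<alpha> \<gamma>) \<alpha>"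
    unfolding tower_map_def by (rule restrict_apply'[OF s(2)])
  also have "\<dots> = family_cov_deriv M nab \<alpha> \<gamma>" using induced_connection_map_eq[OF s(1)] a(1) by simp
  finally show ?thesis unfolding pushforward_jet_proj[OF g a(2)] .
qed

text \<open>Identifying every factor with one explicit map gives existence and uniqueness together,
  and it also evaluates the description inside \<open>induced_map\<close>.\<close>

lemma tower_factor_iff:
  assumes a: "\<alpha> \<in> {1..k}"
  shows "tower_factor M k (induced_connection_map M nab k) \<alpha> L \<longleftrightarrow> L = tower_map \<alpha>"
proof
  have K: "induced_connection_map M nab k X \<alpha> = tower_map \<alpha> (pushforward (jet_mfd M \<alpha>) (jet_proj M \<alpha>) X)"
    if X: "X \<in> points (TB (jet_mfd M k))" for X
  proof -
    obtain \<gamma> where g: "adapted M k X \<gamma>" using adapted_exists[OF X] .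
    show ?thesis using induced_connection_map_eq[OF g a] tower_map_pushforward[OF g] a by simp
  qed
  {
    assume L: "tower_factor M k (induced_connection_map M nab k) \<alpha> L"
    then have Lx: "L \<in> extensional (points (TB (jet_mfd M \<alpha>)))"
      and LK: "\<And>X. X \<in> points (TB (jet_mfd M k)) \<Longrightarrow>
        induced_connection_map M nab k X \<alpha> = L (pushforward (jet_mfd M \<alpha>) (jet_proj M \<alpha>) X)"
      unfolding tower_factor_def PiE_iff by blast+
    show "L = tower_map \<alpha>"
    proof (rule extensionalityI[OF Lx])
      \<comment> \<open>The restriction in \<open>tower_map\<close> matters here: factors are
        extensional, so they are determined by their values on tangent vectors.\<close>
      show "tower_map \<alpha> \<in> extensional (points (TB (jet_mfd M \<alpha>)))" unfolding tower_map_def by (rule restrict_extensional)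
      fix Y assume Y: "Y \<in> points (TB (jet_mfd M \<alpha>))"
      obtain \<gamma> where g: "adapted M \<alpha> Y \<gamma>" using adapted_exists[OF Y] .
      \<comment> \<open>A family adapted to \<open>Y\<close> lifts it: its velocity at order
        \<open>k\<close> projects to \<open>Y\<close>, and the factorisation there forces the value
        of \<open>L\<close> at \<open>Y\<close>.\<close>
      note s = smooth_family_adapted[OF adaptedD(1)[OF g], of k]
      have "pushforward (jet_mfd M \<alpha>) (jet_proj M \<alpha>) (jet_velocity k \<gamma>) = Y"
        using pushforward_jet_proj[OF s(1), of \<alpha>] a adaptedD(3)[OF g] by simp
      then show "L Y = tower_map \<alpha> Y" using LK[OF s(2)] K[OF s(2)] by simp
    qed
  next
    assume L: "L = tower_map \<alpha>"
    have "tower_map \<alpha> \<in> points (TB (jet_mfd M \<alpha>)) \<rightarrow>\<^sub>E points (TB M)"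
      unfolding tower_map_def
    proof (rule restrict_PiE_iff[THEN iffD2], rule ballI)
      fix Y assume Y: "Y \<in> points (TB (jet_mfd M \<alpha>))"
      obtain U \<phi> where U: "(U, \<phi>) \<in> charts M" "foot (foot Y) \<in> U" using obtain_jet_chart[OF Y] .
      have "\<alpha> \<in> {1..\<alpha>}" using a by simp
      from tangent_spaceD(1)[OF induced_connection_map_in_tangent_space[OF U(1) Y U(2) this]]
      show "induced_connection_map M nab \<alpha> Y \<alpha> \<in> points (TB M)" .
    qed
    then show "tower_factor M k (induced_connection_map M nab k) \<alpha> L"
      unfolding tower_factor_def L using K by blast
  }
qed

text \<open>A family adapted to \<open>X\<close> at order \<alpha> computes the components of all
  orders up to \<alpha>, so the map induced from the top and the map constructed directly at order
  \<alpha> have the same values.\<close>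

lemma connection_tower_family_induced:
  assumes k: "k \<ge> 1"
  shows "connection_tower_family M k (\<lambda>\<alpha>. induced_connection_map M nab \<alpha>)"
  unfolding connection_tower_family_def connection_tower_def
proof (intro conjI ballI connection_map_induced[OF k])
  show "\<exists>!L. tower_factor M k (induced_connection_map M nab k) \<alpha> L" if "\<alpha> \<in> {1..k}" for \<alpha>
    by (simp add: tower_factor_iff[OF that])
  fix \<alpha> X assume a: "\<alpha> \<in> {1..k}" and X: "X \<in> points (TB (jet_mfd M \<alpha>))"
  obtain \<gamma> where g: "adapted M \<alpha> X \<gamma>" using adapted_exists[OF X] .
  have "induced_map M k (induced_connection_map M nab k) \<alpha> X = (\<lambda>\<mu>\<in>{1..\<alpha>}. family_cov_deriv M nab \<mu> \<gamma>)"
    unfolding induced_map_def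
  proof (rule restrict_ext)
    fix \<mu> assume m: "\<mu> \<in> {1..\<alpha>}"
    then have mk: "\<mu> \<in> {1..k}" using a by simp
    have "(THE L. tower_factor M k (induced_connection_map M nab k) \<mu> L) = tower_map \<mu>"
      unfolding tower_factor_iff[OF mk] by (rule the_eq_trivial)
    then show "(THE L. tower_factor M k (induced_connection_map M nab k) \<mu> L) (pushforward (jet_mfd M \<mu>) (jet_proj M \<mu>) X) =
        family_cov_deriv M nab \<mu> \<gamma>"
      using tower_map_pushforward[OF g] m by simp
  qed
  \<comment> \<open>The family \<gamma> is traded for the one chosen by \<open>SOME\<close>,
    simultaneously for all \<mu>, to reach the defining form of
    \<open>induced_connection_map\<close>.\<close>
  also have "\<dots> = (\<lambda>\<mu>\<in>{1..\<alpha>}. family_cov_deriv M nab \<mu> (SOME \<gamma>. adapted M \<alpha> X \<gamma>))"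
  proof (rule restrict_ext)
    fix \<mu> assume m: "\<mu> \<in> {1..\<alpha>}"
    show "family_cov_deriv M nab \<mu> \<gamma> = family_cov_deriv M nab \<mu> (SOME \<gamma>. adapted M \<alpha> X \<gamma>)"
      by (rule family_cov_deriv_unique[OF g someI[of "adapted M \<alpha> X" \<gamma>, OF g]]) (use m in simp)
  qed
  finally show "induced_connection_map M nab \<alpha> X = induced_map M k (induced_connection_map M nab k) \<alpha> X"
    unfolding induced_connection_map_def[of M nab \<alpha> X] by simp
qed

end

text \<open>The first two conjuncts make explicit that the construction is well defined, which the
  choice operator in \<open>induced_connection_map\<close> would otherwise hide: adapted families
  exist, and each of them gives the same value.\<close>

theorem theorem8:
  fixes M :: "('p, 'i) mfd"
    and g :: "(real \<Rightarrow> 'p) set \<Rightarrow> (real \<Rightarrow> 'p) set \<Rightarrow> real"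
    and nab :: "(real \<Rightarrow> 'p) set \<Rightarrow> ('p \<Rightarrow> (real \<Rightarrow> 'p) set) \<Rightarrow> (real \<Rightarrow> 'p) set"
    and k :: nat
  assumes "riemannian_manifold M g"
    and "levi_civita M g nab"
    and "k \<ge> 1"
  shows "(\<forall>X\<in>points (TB (jet_mfd M k)). \<exists>\<gamma>. adapted M k X \<gamma>) \<and>
    (\<forall>X\<in>points (TB (jet_mfd M k)). \<forall>\<gamma>. adapted M k X \<gamma> \<longrightarrow>
       (\<forall>\<alpha>\<in>{1..k}. induced_connection_map M nab k X \<alpha> = family_cov_deriv M nab \<alpha> \<gamma>)) \<and>
    connection_map M k (induced_connection_map M nab k) \<and>
    connection_tower_family M k (\<lambda>\<alpha>. induced_connection_map M nab \<alpha>)"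
proof -
  have "smooth_manifold M" "affine_connection M nab"
    using assms(1,2) unfolding riemannian_manifold_def levi_civita_def by blast+
  then interpret affine_atlas M nab
    by (intro affine_atlas.intro affine_atlas_axioms.intro smooth_manifold_imp_atlas)
  show ?thesis
    by (intro conjI ballI allI impI connection_map_induced connection_tower_family_induced assms(3))
      (blast intro: adapted_exists, rule induced_connection_map_eq)
qed

end
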